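(* Let $X:\Omega\times[0,1]\to\mathbb R$ be a one-dimensional Brownian motion and let $f\in\mathbb H$. Then, almost surely, the set $S(f)$ of $f$-rapid points of $X$ has Fourier dimension $1-\|f\|_{\mathbb H}^2$, and is therefore a Salem set.
   Context: A Brownian motion on $[0,1]$ over a probability space $(\Omega,\mathcal B,\mathbf P)$ is a process $X:\Omega\times[0,1]\to\mathbb R$ with almost surely continuous paths, $X(0)=0$ almost surely, and independent increments such that $X(t)-X(s)$ is normal with mean $0$ and variance $t-s$ for $0\le s<t\le1$. $\mathbb H$ is the Hilbert space of absolutely continuous functions $f:[0,1]\to\mathbb R$ with $f(0)=0$ and finite energy $$\|f\|_{\mathbb H}=\left(\int_0^1 (f'(s))^2\,ds\right)^{1/2}<\infty.$$ A point $t\in[0,1]$ is called $f$-rapid (for the sample path $X(\omega,\cdot)$) if $$\liminf_{h\to0^+}\ \sup_{0\le s\le1}\left|\frac{X(t+sh)-X(t)}{\sqrt{2h\log h^{-1}}}-f(s)\right|=0,$$ where only $h>0$ with $t+h\le1$ are considered (the single endpoint $t=1$, for which there is no such $h$, is disregarded). The set of $f$-rapid points is denoted $S(f)=S_\omega(f)$. The Fourier–Stieltjes transform of a finite Borel measure $\mu$ on $\mathbb R$ is $\hat\mu(u)=\int e^{ixu}\,d\mu(x)$. A compact set $K\subset\mathbb R$ is an $M_\beta$-set ($\beta>0$) if it carries a nonzero finite positive Borel measure $\mu$ with $\hat\mu(u)=o(|u|^{-\beta})$ as $|u|\to\infty$. The Fourier dimension $\dim_F K$ of a compact $K\subset\mathbb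 R$ is the supremum of those $a\in(0,1]$ such that $K$ is an $M_{a/2}$-set (and $0$ if there are none); the Fourier dimension of a non-compact set $E$ is the supremum of $\dim_F K$ over compact $K\subseteq E$. A set is a Salem set if its Fourier dimension equals its Hausdorff dimension.
   Formalization: The Fourier dimension is stated as max(0, 1−‖f‖²) instead of 1−‖f‖², because for ‖f‖>1 (e.g. f(s)=2s) the literal value is negative while a Fourier dimension is never negative; for ‖f‖≤1 the two agree. *)

theory Defs
  imports "HOL-Probability.Probability" "HOL-Library.Landau_Symbols"
begin

definition brownian_motion :: "'w measure \<Rightarrow> ('w \<Rightarrow> real \<Rightarrow> real) \<Rightarrow> bool" where
  "brownian_motion M X \<longleftrightarrow>
     prob_space M \<and>
     (\<forall>t\<in>{0..1}. (\<lambda>\<omega>. X \<omega> t) \<in> borel_measurable M) \<and>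
     (AE \<omega> in M. continuous_on {0..1} (X \<omega>)) \<and>
     (AE \<omega> in M. X \<omega> 0 = 0) \<and>
     (\<forall>(n::nat) (\<tau>::nat \<Rightarrow> real).
        0 \<le> \<tau> 0 \<and> \<tau> n \<le> 1 \<and> (\<forall>i<n. \<tau> i < \<tau> (Suc i)) \<longrightarrow>
        prob_space.indep_vars M (\<lambda>_. borel) (\<lambda>i \<omega>. X \<omega> (\<tau> (Suc i)) - X \<omega> (\<tau> i)) {..<n}) \<and>
     (\<forall>s t. 0 \<le> s \<and> s < t \<and> t \<le> 1 \<longrightarrow>
        distributed M lborel (\<lambda>\<omega>. X \<omega> t - X \<omega> s) (normal_density 0 (sqrt (t - s))))"

definition abs_continuous_on :: "real \<Rightarrow> real \<Rightarrow> (real \<Rightarrow> real) \<Rightarrow> bool" where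
  "abs_continuous_on a b f \<longleftrightarrow>
     (\<forall>\<epsilon>>0. \<exists>\<delta>>0. \<forall>(n::nat) (l::nat \<Rightarrow> real) (r::nat \<Rightarrow> real).
        (\<forall>i<n. a \<le> l i \<and> l i < r i \<and> r i \<le> b) \<and>
        disjoint_family_on (\<lambda>i. {l i<..<r i}) {..<n} \<and>
        (\<Sum>i<n. r i - l i) < \<delta> \<longrightarrow>
        (\<Sum>i<n. \<bar>f (r i) - f (l i)\<bar>) < \<epsilon>)"

text \<open>
  Elements of the space are represented by functions on the whole line of which only the values
  on \<open>[0,1]\<close> matter. For absolutely continuous \<open>f\<close> the classical derivative exists almost
  everywhere; \<^const>\<open>deriv\<close> is a junk value on the exceptional null set (and depends on the
  values outside the interval only at the two endpoints), which does not affect the integrals.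
\<close>

definition energy_space :: "(real \<Rightarrow> real) set" where
  "energy_space =
     {f. abs_continuous_on 0 1 f \<and> f 0 = 0 \<and>
         set_integrable lebesgue {0..1} (\<lambda>s. (deriv f s)\<^sup>2)}"

definition energy_norm :: "(real \<Rightarrow> real) \<Rightarrow> real" where
  "energy_norm f = sqrt (LINT s:{0..1}|lebesgue. (deriv f s)\<^sup>2)"

text \<open>
  Here \<open>x\<close> is a sample path. The supremum and the lower limit are taken in the extended reals,
  so that they are meaningful also for the exceptional, possibly unbounded, paths.
\<close>

definition rapid_points :: "(real \<Rightarrow> real) \<Rightarrow> (real \<Rightarrow> real) \<Rightarrow> real set" where
  "rapid_points f x =
     {t. 0 \<le> t \<and> t < 1 \<and>
         Liminf (at 0 within {0<..1 - t})
           (\<lambda>h. SUP s\<in>{0..1}.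
              ereal \<bar>(x (t + s * h) - x t) / sqrt (2 * h * ln (inverse h)) - f s\<bar>) = 0}"

text \<open>
  \<^const>\<open>char\<close> is the Fourier--Stieltjes transform \<open>u \<mapsto> \<integral> exp (i x u) d\<mu>(x)\<close>.
\<close>

definition M_set :: "real \<Rightarrow> real set \<Rightarrow> bool" where
  "M_set \<beta> K \<longleftrightarrow>
     compact K \<and>
     (\<exists>\<mu>::real measure. finite_measure \<mu> \<and> sets \<mu> = sets borel \<and>
        emeasure \<mu> K \<noteq> 0 \<and> emeasure \<mu> (- K) = 0 \<and>
        (\<lambda>u. norm (char \<mu> u)) \<in> o[at_infinity](\<lambda>u. \<bar>u\<bar> powr (- \<beta>)))"

definition fourier_dim_compact :: "real set \<Rightarrow> real" where
  "fourier_dim_compact K = Sup (insert 0 {a. 0 < a \<and> a \<le> 1 \<and> M_set (a / 2) K})"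

definition fourier_dim :: "real set \<Rightarrow> real" where
  "fourier_dim E =
     (if compact E then fourier_dim_compact E
      else (SUP K\<in>{K. compact K \<and> K \<subseteq> E}. fourier_dim_compact K))"

definition hausdorff_premeasure :: "real \<Rightarrow> real \<Rightarrow> real set \<Rightarrow> ennreal" where
  "hausdorff_premeasure s \<delta> E =
     (INF U\<in>{U::nat \<Rightarrow> real set. E \<subseteq> (\<Union>i. U i) \<and> (\<forall>i. bounded (U i) \<and> diameter (U i) \<le> \<delta>)}.
        \<Sum>i. ennreal (diameter (U i) powr s))"

definition hausdorff_measure :: "real \<Rightarrow> real set \<Rightarrow> ennreal" where
  "hausdorff_measure s E = (SUP \<delta>\<in>{0<..}. hausdorff_premeasure s \<delta> E)"

text \<open>
  Only exponents \<open>s > 0\<close> are used: since \<open>0 powr 0 = 0\<close>, \<^term>\<open>hausdorff_measure 0\<close> would not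
  be the counting measure. The set below contains every \<open>s > 1\<close>, so the infimum is genuine.
\<close>

definition hausdorff_dim :: "real set \<Rightarrow> real" where
  "hausdorff_dim E = Inf {s. 0 < s \<and> hausdorff_measure s E = 0}"

definition salem_set :: "real set \<Rightarrow> bool" where
  "salem_set E \<longleftrightarrow> fourier_dim E = hausdorff_dim E"

end

theory Submission
  imports Defs
begin

text \<open>
  Write \<open>\<alpha>\<close> for the square of the energy norm of \<open>f\<close>. An absolutely continuous function is
  differentiable almost everywhere and its dyadic energies
  \<open>2\<^sup>n \<Sum>k. (f ((k + 1) / 2\<^sup>n) - f (k / 2\<^sup>n))\<^sup>2\<close> increase to \<open>\<alpha>\<close>, so both bounds can be
  read off from finitely many increments of the path.

  Upper bound: near an \<open>f\<close>-rapid point, arbitrarily short windows of length \<open>h\<close> exist in which the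
  increments over \<open>n\<close> equal steps are almost as large as those of \<open>sqrt (2 h ln (1/h)) f\<close>. By the
  Gaussian tail bound this has probability about \<open>h\<close> to the power of the \<open>n\<close>-step energy of \<open>f\<close>.
  Counting cells gives a first-moment bound on the Hausdorff dimension, which dominates the
  Fourier dimension because \<open>M\<^sub>\<beta>\<close>-sets support measures of finite energy.

  Lower bound: a grid cell of side \<open>2\<^sup>-\<^sup>q\<close> is good if the path follows \<open>f\<close> on a window starting
  there; this has a probability \<open>p\<close> of order at least \<open>2\<^sup>-\<^sup>q\<^sup>\<alpha>\<close>, up to an arbitrarily small loss in
  the exponent. Replace the density \<open>\<psi>\<close> by \<open>\<psi> / p\<close> on the good cells and by \<open>0\<close> elsewhere. Since
  every grid cell is a candidate, the correction has mean exactly \<open>0\<close>, and its transform is a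
  random trigonometric sum that is periodic in the frequency, up to the explicit transform of one
  cell. Bernstein's inequality bounds it by about \<open>2\<close> to the power \<open>- q (1 - \<alpha>) / 2\<close> for all
  frequencies simultaneously. Iterating with rapidly increasing \<open>q\<close>, a weak limit is a measure on
  rapid points with transform \<open>o(\<bar>u\<bar> powr (- a / 2))\<close> for any prescribed \<open>a < 1 - \<alpha>\<close>.
\<close>

section \<open>Absolutely continuous functions and dyadic energies\<close>

text \<open>The cells that survive a stage depend on the path, so at the next stage no tail bound
  applies directly to the sum over them. Hence the correction is estimated inside every single
  dyadic cell k of every level m, for every window size \<rho>. These are countably many almost sure
  statements; after them the path is fixed and the construction is deterministic, each new level
  being as large as the cells already chosen demand, so dependence between stages is harmless. The
  condition a + \<alpha> < 1 is a balance of exponents: about 2^q centred weights of variance at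
  most 1/p, with p near 2^(-q \<alpha>), have a sum of size 2^(q (1 + \<alpha>) / 2), while the
  transform of one cell is of size 2^(-q (1 - a/2)) |u|^(-a/2). The product decays in q exactly when
  a < 1 - \<alpha>. The construction starts from [0, 1/2], so that all windows fit into [0, 1]. For
  energy at least 1 both dimensions are 0, which is why the difference in the result is truncated at
  0.\<close>

definition dy :: "nat \<Rightarrow> nat \<Rightarrow> real" where
  "dy n k = real k / 2 ^ n"

definition slope :: "(real \<Rightarrow> real) \<Rightarrow> nat \<Rightarrow> nat \<Rightarrow> real" where
  "slope f n k = 2 ^ n * (f (dy n (Suc k)) - f (dy n k))"

lemma dy_0 [simp]: "dy n 0 = 0"
  by (simp add: dy_def)

lemma dy_nonneg [simp]: "0 \<le> dy n k"
  by (simp add: dy_def)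

lemma dy_less_iff [simp]: "dy n j < dy n k \<longleftrightarrow> j < k"
  by (simp add: dy_def divide_less_cancel)

lemma dy_le_iff [simp]: "dy n j \<le> dy n k \<longleftrightarrow> j \<le> k"
  by (simp add: dy_def divide_le_cancel)

lemma dy_le_1: "k \<le> 2 ^ n \<Longrightarrow> dy n k \<le> 1"
  by (simp add: dy_def)

lemma dy_Suc: "dy n (Suc k) = dy n k + 1 / 2 ^ n"
  by (simp add: dy_def field_simps)

lemma dy_add: "dy n (j + k) = dy n j + dy n k"
  by (simp add: dy_def add_divide_distrib)

lemma dy_refine: "dy (n + d) (k * 2 ^ d) = dy n k"
  by (simp add: dy_def power_add)

lemma dy_refine_Suc: "dy (n + d) (k * 2 ^ d + 2 ^ d) = dy n (Suc k)"
  using dy_refine[of n d "Suc k"] by (simp add: algebra_simps)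

lemma slope_increment: "f (dy n (Suc k)) - f (dy n k) = slope f n k / 2 ^ n"
  by (simp add: slope_def)

lemma sum_dyadic_refine:
  fixes h :: "nat \<Rightarrow> real"
  shows
  "(\<Sum>j<2 ^ (n + d). h j) = (\<Sum>k<2 ^ n. \<Sum>i<2 ^ d. h (k * 2 ^ d + i))"
proof -
  have "(\<Sum>j<2 ^ (n + d). h j) = (\<Sum>k<2 ^ n. sum h {k * 2 ^ d ..< k * 2 ^ d + 2 ^ d})"
    by (simp add: sum.nat_group power_add)
  also have "\<dots> = (\<Sum>k<2 ^ n. \<Sum>i<2 ^ d. h (k * 2 ^ d + i))"
  proof (rule sum.cong[OF refl])
    fix k show "sum h {k * 2 ^ d..<k * 2 ^ d + 2 ^ d} = (\<Sum>i<2 ^ d. h (k * 2 ^ d + i))"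
      using sum.shift_bounds_nat_ivl[of h 0 "k * 2 ^ d" "2 ^ d"] by (simp add: atLeast0LessThan add.commute)
  qed
  finally show ?thesis .
qed

text \<open>By telescoping, the slope on a cell is the mean of the slopes on its subcells: dyadic
  slopes form a martingale. Convex functionals such as variation and arc length therefore increase
  under refinement.\<close>

lemma sum_slope_refine:
  "(\<Sum>i<2 ^ d. slope f (n + d) (k * 2 ^ d + i)) = 2 ^ d * slope f n k"
proof -
  have "(\<Sum>i<2 ^ d. slope f (n + d) (k * 2 ^ d + i))
      = 2 ^ (n + d) * (\<Sum>i<2 ^ d. f (dy (n + d) (k * 2 ^ d + Suc i)) - f (dy (n + d) (k * 2 ^ d + i)))"
    by (simp add: slope_def sum_distrib_left)
  also have "(\<Sum>i<2 ^ d. f (dy (n + d) (k * 2 ^ d + Suc i)) - f (dy (n + d) (k * 2 ^ d + i)))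
      = f (dy n (Suc k)) - f (dy n k)"
    using sum_lessThan_telescope[of "\<lambda>i. f (dy (n + d) (k * 2 ^ d + i))" "2 ^ d"]
    by (simp add: dy_refine dy_refine_Suc)
  finally show ?thesis by (simp add: slope_def power_add)
qed

section \<open>Absolute continuity for finite and dyadic families\<close>

lemma abs_continuous_on_finite_family:
  fixes I :: "'i set"
  assumes "abs_continuous_on a b f" and "0 < \<epsilon>"
  obtains \<delta> where "0 < \<delta>" and
    "\<forall>(I::'i set) l r. finite I \<longrightarrow> (\<forall>i\<in>I. a \<le> l i \<and> l i < r i \<and> r i \<le> b) \<longrightarrow>
       disjoint_family_on (\<lambda>i. {l i<..<r i}) I \<longrightarrow> (\<Sum>i\<in>I. r i - l i) < \<delta> \<longrightarrow>
       (\<Sum>i\<in>I. \<bar>f (r i) - f (l i)\<bar>) < \<epsilon>"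
proof -
  from assms(1)[unfolded abs_continuous_on_def, rule_format, OF assms(2)]
  obtain \<delta> where \<delta>: "\<delta> > 0" and H: "\<forall>(n::nat) (l::nat \<Rightarrow> real) (r::nat \<Rightarrow> real).
        (\<forall>i<n. a \<le> l i \<and> l i < r i \<and> r i \<le> b) \<and>
        disjoint_family_on (\<lambda>i. {l i<..<r i}) {..<n} \<and>
        (\<Sum>i<n. r i - l i) < \<delta> \<longrightarrow>
        (\<Sum>i<n. \<bar>f (r i) - f (l i)\<bar>) < \<epsilon>"
    by (elim exE conjE)
  show thesis
  proof (rule that[OF \<delta>], intro allI impI)
    fix I :: "'i set" and l r
    assume I: "finite I" "\<forall>i\<in>I. a \<le> l i \<and> l i < r i \<and> r i \<le> b"
       "disjoint_family_on (\<lambda>i. {l i<..<r i}) I" "(\<Sum>i\<in>I. r i - l i) < \<delta>"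
    \<comment> \<open>The definition indexes families by initial segments of the naturals; the
      families used below are indexed by a one-point type, by cells, and by pairs of a cell and a
      subcell.\<close>
    obtain h where h: "bij_betw h {..<card I} I"
      using ex_bij_betw_nat_finite[OF I(1)] by (auto simp: atLeast0LessThan)
    have hI: "h i \<in> I" if "i < card I" for i using h that by (auto simp: bij_betw_def)
    have inj: "inj_on h {..<card I}" using h by (auto simp: bij_betw_def)
    have *: "(\<Sum>i<card I. g (h i)) = (\<Sum>i\<in>I. g i)" for g :: "'i \<Rightarrow> real"
      by (rule sum.reindex_bij_betw[OF h])
    have "(\<Sum>i<card I. \<bar>f (r (h i)) - f (l (h i))\<bar>) < \<epsilon>"
    proof (rule H[rule_format], intro conjI)
      show "\<forall>i<card I. a \<le> l (h i) \<and> l (h i) < r (h i) \<and> r (h i) \<le> b"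
        using I(2) hI by auto
      show "disjoint_family_on (\<lambda>i. {l (h i)<..<r (h i)}) {..<card I}"
        unfolding disjoint_family_on_def
      proof (intro ballI impI)
        fix i j assume ij: "i \<in> {..<card I}" "j \<in> {..<card I}" "i \<noteq> j"
        then have "h i \<noteq> h j" using inj by (auto simp: inj_on_def)
        then show "{l (h i)<..<r (h i)} \<inter> {l (h j)<..<r (h j)} = {}"
          using I(3) hI ij unfolding disjoint_family_on_def by auto
      qed
      show "(\<Sum>i<card I. r (h i) - l (h i)) < \<delta>"
        using I(4) *[of "\<lambda>i. r i - l i"] by simp
    qed
    then show "(\<Sum>i\<in>I. \<bar>f (r i) - f (l i)\<bar>) < \<epsilon>"
      using *[of "\<lambda>i. \<bar>f (r i) - f (l i)\<bar>"] by simp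
  qed
qed

lemma abs_continuous_on_imp_continuous_on:
  assumes "abs_continuous_on a b f"
  shows "continuous_on {a..b} f"
  unfolding continuous_on_iff
proof (intro ballI allI impI)
  fix x \<epsilon> :: real assume x: "x \<in> {a..b}" and "0 < \<epsilon>"
  obtain \<delta> where \<delta>: "0 < \<delta>" and H: "\<forall>(I::unit set) l r. finite I \<longrightarrow> (\<forall>i\<in>I. a \<le> l i \<and> l i < r i \<and> r i \<le> b) \<longrightarrow>
       disjoint_family_on (\<lambda>i. {l i<..<r i}) I \<longrightarrow> (\<Sum>i\<in>I. r i - l i) < \<delta> \<longrightarrow>
       (\<Sum>i\<in>I. \<bar>f (r i) - f (l i)\<bar>) < \<epsilon>"
    by (rule abs_continuous_on_finite_family[OF assms \<open>0 < \<epsilon>\<close>, where 'i=unit]) (rule that)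
  have *: "\<bar>f v - f u\<bar> < \<epsilon>" if "a \<le> u" "u < v" "v \<le> b" "v - u < \<delta>" for u v
    using H[rule_format, of "{()}" "\<lambda>_. u" "\<lambda>_. v"] that by (simp add: disjoint_family_on_def)
  show "\<exists>d>0. \<forall>x'\<in>{a..b}. dist x' x < d \<longrightarrow> dist (f x') (f x) < \<epsilon>"
  proof (intro exI[of _ \<delta>] conjI ballI impI \<delta>)
    fix y assume y: "y \<in> {a..b}" "dist y x < \<delta>"
    consider "y < x" | "y = x" | "x < y" by linarith
    then show "dist (f y) (f x) < \<epsilon>"
    proof cases
      case 1 then show ?thesis using *[of y x] x y by (auto simp: dist_real_def abs_if split: if_splits)
    next
      case 2 then show ?thesis using \<open>0 < \<epsilon>\<close> by simp
    next
      case 3 then show ?thesis using *[of x y] x y by (auto simp: dist_real_def abs_if split: if_splits)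
    qed
  qed
qed

lemma dyadic_cells_disjoint:
  "inj_on g I \<Longrightarrow> disjoint_family_on (\<lambda>i. {dy n (g i)<..<dy n (Suc (g i))}) I"
  unfolding disjoint_family_on_def
proof (intro ballI impI)
  fix i j assume "inj_on g I" "i \<in> I" "j \<in> I" "i \<noteq> j"
  then have "g i \<noteq> g j" by (auto simp: inj_on_def)
  then have "g i < g j \<or> g j < g i" by auto
  then have "dy n (Suc (g i)) \<le> dy n (g j) \<or> dy n (Suc (g j)) \<le> dy n (g i)" by auto
  then show "{dy n (g i)<..<dy n (Suc (g i))} \<inter> {dy n (g j)<..<dy n (Suc (g j))} = {}"
    by auto
qed

lemma abs_continuous_on_dyadic:
  assumes "abs_continuous_on 0 1 f" and "0 < \<epsilon>"
  obtains \<delta> where "0 < \<delta>" and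
    "\<forall>(I::'i set) n (g::'i \<Rightarrow> nat). finite I \<longrightarrow> inj_on g I \<longrightarrow> (\<forall>i\<in>I. g i < 2 ^ n) \<longrightarrow>
       real (card I) / 2 ^ n < \<delta> \<longrightarrow> (\<Sum>i\<in>I. \<bar>slope f n (g i)\<bar> / 2 ^ n) < \<epsilon>"
proof -
  obtain \<delta> where \<delta>: "0 < \<delta>" and H: "\<forall>(I::'i set) l r. finite I \<longrightarrow> (\<forall>i\<in>I. 0 \<le> l i \<and> l i < r i \<and> r i \<le> 1) \<longrightarrow>
       disjoint_family_on (\<lambda>i. {l i<..<r i}) I \<longrightarrow> (\<Sum>i\<in>I. r i - l i) < \<delta> \<longrightarrow>
       (\<Sum>i\<in>I. \<bar>f (r i) - f (l i)\<bar>) < \<epsilon>"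
    by (rule abs_continuous_on_finite_family[OF assms, where 'i='i]) (rule that)
  show thesis
  proof (rule that[OF \<delta>], intro allI impI)
    fix I :: "'i set" and n and g :: "'i \<Rightarrow> nat"
    assume I: "finite I" "inj_on g I" "\<forall>i\<in>I. g i < 2 ^ n" "real (card I) / 2 ^ n < \<delta>"
    have "(\<Sum>i\<in>I. \<bar>f (dy n (Suc (g i))) - f (dy n (g i))\<bar>) < \<epsilon>"
    proof (rule H[rule_format])
      show "finite I" by fact
      show "0 \<le> dy n (g i) \<and> dy n (g i) < dy n (Suc (g i)) \<and> dy n (Suc (g i)) \<le> 1" if "i \<in> I" for i
        using I(3)[rule_format, OF that] by (simp add: dy_le_1)
      show "disjoint_family_on (\<lambda>i. {dy n (g i)<..<dy n (Suc (g i))}) I"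
        using dyadic_cells_disjoint[OF I(2)] .
      show "(\<Sum>i\<in>I. dy n (Suc (g i)) - dy n (g i)) < \<delta>"
        using I(4) by (simp add: dy_Suc)
    qed
    then show "(\<Sum>i\<in>I. \<bar>slope f n (g i)\<bar> / 2 ^ n) < \<epsilon>"
      by (simp add: slope_increment)
  qed
qed

lemma abs_slope_sum_refine:
  "(\<Sum>k<2 ^ n. \<bar>slope f n k\<bar> / 2 ^ n) \<le> (\<Sum>k<2 ^ (n + d). \<bar>slope f (n + d) k\<bar> / 2 ^ (n + d))"
proof -
  have "\<bar>slope f n k\<bar> / 2 ^ n \<le> (\<Sum>i<2 ^ d. \<bar>slope f (n + d) (k * 2 ^ d + i)\<bar> / 2 ^ (n + d))" for k
  proof -
    have "2 ^ d * \<bar>slope f n k\<bar> = \<bar>\<Sum>i<2 ^ d. slope f (n + d) (k * 2 ^ d + i)\<bar>"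
      by (simp add: sum_slope_refine abs_mult)
    also have "\<dots> \<le> (\<Sum>i<2 ^ d. \<bar>slope f (n + d) (k * 2 ^ d + i)\<bar>)" by (rule sum_abs)
    finally have "2 ^ d * \<bar>slope f n k\<bar> / 2 ^ (n + d) \<le> (\<Sum>i<2 ^ d. \<bar>slope f (n + d) (k * 2 ^ d + i)\<bar>) / 2 ^ (n + d)"
      by (rule divide_right_mono) simp
    then show ?thesis by (simp add: sum_divide_distrib power_add)
  qed
  then show ?thesis unfolding sum_dyadic_refine by (rule sum_mono)
qed

text \<open>Cut the interval into \<open>2 ^ n0\<close> cells shorter than the \<delta> that belongs
  to the tolerance 1. Each carries variation below 1 at every finer level, and passing to a finer
  level only increases the sums, so \<open>2 ^ n0\<close> bounds them all.\<close>

lemma dyadic_variation_bounded: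
  assumes "abs_continuous_on 0 1 f"
  obtains V where "0 < V" "\<And>n. (\<Sum>k<2 ^ n. \<bar>slope f n k\<bar> / 2 ^ n) \<le> V"
proof -
  obtain \<delta> where \<delta>: "0 < \<delta>" and H: "\<forall>(I::nat set) n g. finite I \<longrightarrow> inj_on g I \<longrightarrow> (\<forall>i\<in>I. g i < 2 ^ n) \<longrightarrow>
       real (card I) / 2 ^ n < \<delta> \<longrightarrow> (\<Sum>i\<in>I. \<bar>slope f n (g i)\<bar> / 2 ^ n) < 1"
    by (rule abs_continuous_on_dyadic[OF assms, of 1, where 'i=nat]) (simp, rule that)
  obtain n0 where n0: "(1/2::real) ^ n0 < \<delta>"
    using real_arch_pow_inv[OF \<delta>, of "1/2"] by auto
  have "(\<Sum>k<2 ^ n. \<bar>slope f n k\<bar> / 2 ^ n) \<le> 2 ^ n0" for n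
  proof -
    have "(\<Sum>k<2 ^ n. \<bar>slope f n k\<bar> / 2 ^ n) \<le> (\<Sum>k<2 ^ (n0 + n). \<bar>slope f (n0 + n) k\<bar> / 2 ^ (n0 + n))"
      using abs_slope_sum_refine[of f n n0] by (simp add: add.commute)
    also have "\<dots> = (\<Sum>k<2 ^ n0. \<Sum>i<2 ^ n. \<bar>slope f (n0 + n) (k * 2 ^ n + i)\<bar> / 2 ^ (n0 + n))"
      by (rule sum_dyadic_refine)
    also have "\<dots> \<le> (\<Sum>k<(2::nat) ^ n0. 1)"
    proof (intro sum_mono less_imp_le H[rule_format])
      fix k assume k: "k \<in> {..<(2::nat) ^ n0}"
      show "inj_on ((+) (k * 2 ^ n)) {..<2 ^ n}" by simp
      fix i assume "i \<in> {..<(2::nat) ^ n}"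
      then have "k * 2 ^ n + i < k * 2 ^ n + 2 ^ n" by simp
      also have "\<dots> = Suc k * 2 ^ n" by simp
      also have "\<dots> \<le> 2 ^ n0 * 2 ^ n" using k by (intro mult_right_mono) auto
      finally show "k * 2 ^ n + i < 2 ^ (n0 + n)" by (simp add: power_add)
    qed (use n0 in \<open>auto simp: power_add field_simps\<close>)
    finally show ?thesis by simp
  qed
  then show thesis by (intro that[of "2 ^ n0"]) auto
qed

text \<open>The arc length of the dyadic polygons is bounded and increasing, so the gap \<open>B\<close> in the
  tangent inequality for \<open>\<lambda>x. sqrt (1 + x\<^sup>2)\<close> has small mean; this makes the dyadic slopes
  an \<open>L\<^sup>1\<close> Cauchy sequence.\<close>

lemma arclength_bregman:
  fixes x s :: real
  defines "B \<equiv> sqrt (1 + x\<^sup>2) - sqrt (1 + s\<^sup>2) - s * (x - s) / sqrt (1 + s\<^sup>2)"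
  shows "0 \<le> B"
    and "0 < \<tau> \<Longrightarrow> \<bar>s\<bar> \<le> \<Lambda> \<Longrightarrow> \<bar>x - s\<bar> \<le> \<tau> + 2 * (1 + \<Lambda> + \<tau>) * (1 + \<Lambda>\<^sup>2) / \<tau> * B"
proof -
  define p q where "p = sqrt (1 + x\<^sup>2)" and "q = sqrt (1 + s\<^sup>2)"
  have pos: "1 \<le> p" "1 \<le> q" by (auto simp: p_def q_def)
  have p2: "p\<^sup>2 = 1 + x\<^sup>2" and q2: "q\<^sup>2 = 1 + s\<^sup>2" by (auto simp: p_def q_def)
  have Bq: "B * q = p * q - (1 + s * x)"
  proof -
    have "B * q = p * q - q\<^sup>2 - s * (x - s)"
      unfolding B_def p_def[symmetric] q_def[symmetric] using pos
      by (simp add: field_simps power2_eq_square)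
    moreover have "q * q = 1 + s * s" using q2 by (simp add: power2_eq_square)
    ultimately show ?thesis by (simp add: power2_eq_square algebra_simps)
  qed
  \<comment> \<open>Lagrange's identity. Together with \<open>Bq\<close> it factors (x - s)^2 as B q
    times (p q + 1 + s x), so the tangent gap B controls the square of x - s.\<close>
  have id: "(p * q)\<^sup>2 - (1 + s * x)\<^sup>2 = (x - s)\<^sup>2"
    by (simp add: power_mult_distrib p2 q2) (simp add: power2_eq_square algebra_simps)
  have "(1 + s * x)\<^sup>2 \<le> (p * q)\<^sup>2" using id zero_le_power2[of "x - s"] by linarith
  then have abs: "\<bar>1 + s * x\<bar> \<le> p * q" using pos by (simp add: abs_le_square_iff[symmetric])
  then have "0 \<le> B * q" using Bq by linarith
  then show B0: "0 \<le> B" using pos by (simp add: zero_le_mult_iff)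
  assume \<tau>: "0 < \<tau>" and s: "\<bar>s\<bar> \<le> \<Lambda>"
  have "(x - s)\<^sup>2 = (B * q) * (p * q + (1 + s * x))"
    unfolding Bq id[symmetric] by (simp add: power2_eq_square algebra_simps)
  also have "\<dots> \<le> (B * q) * (2 * (p * q))"
    using abs \<open>0 \<le> B * q\<close> by (intro mult_left_mono) auto
  also have "\<dots> = 2 * B * p * (1 + s\<^sup>2)" using q2 by (simp add: power2_eq_square)
  finally have 1: "(x - s)\<^sup>2 \<le> 2 * B * p * (1 + s\<^sup>2)" .
  have "s\<^sup>2 \<le> \<Lambda>\<^sup>2" using s by (simp add: abs_le_square_iff[symmetric])
  have "p \<le> 1 + \<bar>x\<bar>" unfolding p_def
    by (rule real_le_lsqrt) (auto simp: power2_eq_square algebra_simps)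
  then have p: "p \<le> 1 + \<Lambda> + \<bar>x - s\<bar>" using s by linarith
  show "\<bar>x - s\<bar> \<le> \<tau> + 2 * (1 + \<Lambda> + \<tau>) * (1 + \<Lambda>\<^sup>2) / \<tau> * B"
  proof (cases "\<bar>x - s\<bar> \<le> \<tau>")
    case True
    have "0 \<le> 2 * (1 + \<Lambda> + \<tau>) * (1 + \<Lambda>\<^sup>2) / \<tau> * B" using B0 \<tau> s by auto
    then show ?thesis using True by linarith
  next
    case False
    define y where "y = \<bar>x - s\<bar>"
    have y: "\<tau> < y" using False by (simp add: y_def)
    have L: "0 \<le> \<Lambda>" using s by linarith
    have "y * y \<le> 2 * B * p * (1 + s\<^sup>2)" using 1 by (simp add: y_def power2_eq_square)
    also have "\<dots> \<le> 2 * B * (1 + \<Lambda> + y) * (1 + \<Lambda>\<^sup>2)"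
      using p \<open>s\<^sup>2 \<le> \<Lambda>\<^sup>2\<close> B0 pos by (intro mult_mono) (auto simp: y_def)
    \<comment> \<open>The factor p grows linearly in y, so one power of y has to be divided out.
      This uses \<open>\<tau> < y\<close> and is the source of the factor 1 / \<tau>.\<close>
    finally have "\<tau> * (y * y) \<le> \<tau> * (2 * B * (1 + \<Lambda> + y) * (1 + \<Lambda>\<^sup>2))" using \<tau> by simp
    also have "\<dots> = 2 * B * (1 + \<Lambda>\<^sup>2) * (\<tau> * (1 + \<Lambda>) + \<tau> * y)" by (simp add: algebra_simps)
    also have "\<dots> \<le> 2 * B * (1 + \<Lambda>\<^sup>2) * (y * (1 + \<Lambda>) + \<tau> * y)"
      using B0 y L \<tau> by (intro mult_left_mono add_mono mult_right_mono) auto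
    finally have "\<tau> * y * y \<le> 2 * B * (1 + \<Lambda>\<^sup>2) * (1 + \<Lambda> + \<tau>) * y" by (simp add: algebra_simps)
    then have "\<tau> * y \<le> 2 * B * (1 + \<Lambda>\<^sup>2) * (1 + \<Lambda> + \<tau>)" using y \<tau> by (simp add: mult_le_cancel_right)
    then have "y \<le> 2 * (1 + \<Lambda> + \<tau>) * (1 + \<Lambda>\<^sup>2) / \<tau> * B" using \<tau> by (simp add: field_simps)
    then show ?thesis using \<tau> by (simp add: y_def)
  qed
qed

text \<open>On cells with slope at most \<Lambda> the tangent gap bounds the change of slope. By
  Markov's inequality the steeper cells have total length at most V / \<Lambda> = \<delta> / 2, so
  absolute continuity makes both the coarse and the fine variation over them small. The four
  quarters of \<epsilon> go to \<tau>, to the gap, and to the fine and the coarse slopes on steep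
  cells.\<close>

lemma dyadic_slopes_Cauchy:
  assumes ac: "abs_continuous_on 0 1 f" and \<epsilon>: "0 < \<epsilon>"
  obtains n where "\<And>d. (\<Sum>k<2 ^ n. \<Sum>i<2 ^ d. \<bar>slope f (n + d) (k * 2 ^ d + i) - slope f n k\<bar> / 2 ^ (n + d)) \<le> \<epsilon>"
proof -
  obtain V where V: "0 < V" "\<And>n. (\<Sum>k<2 ^ n. \<bar>slope f n k\<bar> / 2 ^ n) \<le> V"
    using dyadic_variation_bounded[OF ac] by blast
  obtain \<delta> where \<delta>: "0 < \<delta>" and UI: "\<forall>(I::(nat \<times> nat) set) n g. finite I \<longrightarrow> inj_on g I \<longrightarrow> (\<forall>i\<in>I. g i < 2 ^ n) \<longrightarrow>
       real (card I) / 2 ^ n < \<delta> \<longrightarrow> (\<Sum>i\<in>I. \<bar>slope f n (g i)\<bar> / 2 ^ n) < \<epsilon> / 4"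
    by (rule abs_continuous_on_dyadic[OF ac, of "\<epsilon> / 4", where 'i="nat \<times> nat"]) (use \<epsilon> in simp, rule that)
  define \<Lambda> where "\<Lambda> = 2 * V / \<delta>"
  have \<Lambda>: "0 < \<Lambda>" "V / \<Lambda> < \<delta>" using V \<delta> by (auto simp: \<Lambda>_def)
  define \<tau> where "\<tau> = \<epsilon> / 4"
  have \<tau>: "0 < \<tau>" using \<epsilon> by (simp add: \<tau>_def)
  define K where "K = 2 * (1 + \<Lambda> + \<tau>) * (1 + \<Lambda>\<^sup>2) / \<tau>"
  have K: "0 < K" using \<Lambda> \<tau> by (auto simp: K_def intro!: divide_pos_pos mult_pos_pos add_pos_nonneg)
  define \<Phi> where "\<Phi> n = (\<Sum>k<2 ^ n. sqrt (1 + (slope f n k)\<^sup>2) / 2 ^ n)" for n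
  define B where "B x s = sqrt (1 + x\<^sup>2) - sqrt (1 + s\<^sup>2) - s * (x - s) / sqrt (1 + s\<^sup>2)" for x s :: real
  have B0: "0 \<le> B x s" for x s unfolding B_def by (rule arclength_bregman)
  have BK: "\<bar>x - s\<bar> \<le> \<tau> + K * B x s" if "\<bar>s\<bar> \<le> \<Lambda>" for x s
    unfolding B_def K_def by (rule arclength_bregman(2)[OF \<tau> that])
  \<comment> \<open>The linear term of the tangent inequality cancels, because the fine slopes
    average to the coarse one; what remains is the increase of arc length.\<close>
  have Bsum: "(\<Sum>k<2 ^ n. \<Sum>i<2 ^ d. B (slope f (n + d) (k * 2 ^ d + i)) (slope f n k) / 2 ^ (n + d)) = \<Phi> (n + d) - \<Phi> n" for n d
  proof -
    have "(\<Sum>i<2 ^ d. B (slope f (n + d) (k * 2 ^ d + i)) (slope f n k) / 2 ^ (n + d))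
      = (\<Sum>i<2 ^ d. sqrt (1 + (slope f (n + d) (k * 2 ^ d + i))\<^sup>2) / 2 ^ (n + d)) - sqrt (1 + (slope f n k)\<^sup>2) / 2 ^ n" for k
    proof -
      define s where "s = slope f n k"
      define x where "x i = slope f (n + d) (k * 2 ^ d + i)" for i
      have sx: "(\<Sum>i<2 ^ d. x i) = 2 ^ d * s" unfolding x_def s_def by (rule sum_slope_refine)
      have "(\<Sum>i<2 ^ d. B (x i) s) = (\<Sum>i<2 ^ d. sqrt (1 + (x i)\<^sup>2)) - 2 ^ d * sqrt (1 + s\<^sup>2)
           - s * ((\<Sum>i<2 ^ d. x i) - 2 ^ d * s) / sqrt (1 + s\<^sup>2)"
        by (simp add: B_def sum_subtractf sum_distrib_left sum_divide_distrib[symmetric] right_diff_distrib diff_divide_distrib)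
      also have "\<dots> = (\<Sum>i<2 ^ d. sqrt (1 + (x i)\<^sup>2)) - 2 ^ d * sqrt (1 + s\<^sup>2)"
        by (simp add: sx)
      finally have "(\<Sum>i<2 ^ d. B (x i) s) / 2 ^ (n + d) = (\<Sum>i<2 ^ d. sqrt (1 + (x i)\<^sup>2)) / 2 ^ (n + d) - 2 ^ d * sqrt (1 + s\<^sup>2) / 2 ^ (n + d)"
        by (simp add: diff_divide_distrib)
      then show ?thesis unfolding x_def s_def by (simp add: sum_divide_distrib power_add)
    qed
    then show ?thesis unfolding \<Phi>_def sum_dyadic_refine[of _ n d] by (simp add: sum_subtractf)
  qed
  have step: "\<Phi> n \<le> \<Phi> (n + d)" for n d
    using Bsum[where n=n and d=d] sum_nonneg[of "{..<2^n}" "\<lambda>k. \<Sum>i<2 ^ d. B (slope f (n + d) (k * 2 ^ d + i)) (slope f n k) / 2 ^ (n + d)"]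
    by (simp add: B0 sum_nonneg)
  have bd: "\<Phi> n \<le> 1 + V" for n
  proof -
    have "sqrt (1 + x\<^sup>2) \<le> 1 + \<bar>x\<bar>" for x :: real
      by (rule real_le_lsqrt) (auto simp: power2_eq_square algebra_simps)
    then have "\<Phi> n \<le> (\<Sum>k<2 ^ n. (1 + \<bar>slope f n k\<bar>) / 2 ^ n)"
      unfolding \<Phi>_def by (intro sum_mono divide_right_mono) auto
    also have "\<dots> = 1 + (\<Sum>k<2 ^ n. \<bar>slope f n k\<bar> / 2 ^ n)"
      by (simp add: add_divide_distrib sum.distrib)
    finally show ?thesis using V(2)[of n] by linarith
  qed
  obtain n where n: "\<And>d. \<Phi> (n + d) - \<Phi> n \<le> \<epsilon> / (4 * K)"
  proof -
    have inc: "incseq \<Phi>" by (rule incseq_SucI) (use step[of _ 1] in simp)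
    have "convergent \<Phi>"
      using inc bd by (metis incseq_convergent convergentI)
    then obtain l where l: "\<Phi> \<longlonglongrightarrow> l" by (auto simp: convergent_def)
    have le: "\<Phi> n \<le> l" for n using incseq_le[OF inc l] .
    have "eventually (\<lambda>n. l - \<epsilon> / (4 * K) < \<Phi> n) sequentially"
      using l by (rule order_tendstoD) (use K \<epsilon> in simp)
    then obtain n where "l - \<epsilon> / (4 * K) < \<Phi> n" by (auto simp: eventually_sequentially)
    then show thesis using le by (intro that[of n]) (smt (verit))
  qed
  show thesis
  proof (rule that[of n])
    fix d
    define Bk where "Bk = {k. k < 2 ^ n \<and> \<Lambda> < \<bar>slope f n k\<bar>}"
    have fin: "finite Bk" unfolding Bk_def by simp
    have cardB: "real (card Bk) / 2 ^ n < \<delta>"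
    proof -
      have "real (card Bk) / 2 ^ n * \<Lambda> = (\<Sum>k\<in>Bk. \<Lambda> / 2 ^ n)" by simp
      also have "\<dots> \<le> (\<Sum>k\<in>Bk. \<bar>slope f n k\<bar> / 2 ^ n)"
        by (intro sum_mono divide_right_mono) (auto simp: Bk_def)
      also have "\<dots> \<le> (\<Sum>k<2 ^ n. \<bar>slope f n k\<bar> / 2 ^ n)"
        by (intro sum_mono2) (auto simp: Bk_def)
      also have "\<dots> \<le> V" by (rule V)
      finally have "real (card Bk) / 2 ^ n \<le> V / \<Lambda>" using \<Lambda> by (simp add: pos_le_divide_eq)
      then show ?thesis using \<Lambda> by linarith
    qed
    define x where "x k i = slope f (n + d) (k * 2 ^ d + i)" for k i
    define s where "s k = slope f n k" for k
    define b where "b k = (if k \<in> Bk then 1 else 0 :: real)" for k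
    define w where "w = 1 / (2::real) ^ (n + d)"
    have w: "0 < w" by (simp add: w_def)
    have pt: "\<bar>x k i - s k\<bar> \<le> \<tau> + K * B (x k i) (s k) + b k * \<bar>x k i\<bar> + b k * \<bar>s k\<bar>" if "k < 2 ^ n" for k i
    proof (cases "k \<in> Bk")
      case True
      have "0 \<le> \<tau> + K * B (x k i) (s k)" using \<tau> K B0 by (simp add: less_imp_le)
      then show ?thesis using True by (simp add: b_def)
    next
      case False
      then show ?thesis using BK[of "s k" "x k i"] that by (simp add: b_def s_def Bk_def)
    qed
    have "(\<Sum>k<2 ^ n. \<Sum>i<2 ^ d. \<bar>x k i - s k\<bar> * w)
        \<le> (\<Sum>k<2 ^ n. \<Sum>i<2 ^ d. (\<tau> + K * B (x k i) (s k) + b k * \<bar>x k i\<bar> + b k * \<bar>s k\<bar>) * w)"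
      using pt w by (intro sum_mono mult_right_mono) auto
    also have "\<dots> = (\<Sum>k<(2::nat) ^ n. \<Sum>i<(2::nat) ^ d. \<tau> * w) + K * (\<Sum>k<2 ^ n. \<Sum>i<2 ^ d. B (x k i) (s k) * w)
       + (\<Sum>k<2 ^ n. \<Sum>i<2 ^ d. b k * \<bar>x k i\<bar> * w) + (\<Sum>k<2 ^ n. \<Sum>i<(2::nat) ^ d. b k * \<bar>s k\<bar> * w)"
      by (simp add: distrib_right sum.distrib sum_distrib_left mult.assoc)
    also have "(\<Sum>k<(2::nat) ^ n. \<Sum>i<(2::nat) ^ d. \<tau> * w) = \<tau>"
      by (simp add: w_def power_add)
    also have "(\<Sum>k<2 ^ n. \<Sum>i<2 ^ d. B (x k i) (s k) * w) = \<Phi> (n + d) - \<Phi> n"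
      using Bsum[where n=n and d=d] by (simp add: x_def s_def w_def)
    also have "(\<Sum>k<2 ^ n. \<Sum>i<2 ^ d. b k * \<bar>x k i\<bar> * w) \<le> \<epsilon> / 4"
    proof -
      have "(\<Sum>k<2 ^ n. \<Sum>i<2 ^ d. b k * \<bar>x k i\<bar> * w) = (\<Sum>k\<in>Bk. \<Sum>i<2 ^ d. \<bar>x k i\<bar> * w)"
        by (rule sum.mono_neutral_cong_right) (auto simp: b_def Bk_def)
      also have "\<dots> = (\<Sum>(k,i)\<in>Bk \<times> {..<2 ^ d}. \<bar>x k i\<bar> * w)"
        by (rule sum.cartesian_product)
      also have "\<dots> = (\<Sum>p\<in>Bk \<times> {..<2 ^ d}. \<bar>slope f (n + d) (fst p * 2 ^ d + snd p)\<bar> / 2 ^ (n + d))"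
        by (intro sum.cong) (auto simp: x_def w_def)
      also have "\<dots> < \<epsilon> / 4"
      proof (rule UI[rule_format])
        show "finite (Bk \<times> {..<(2::nat) ^ d})" using fin by simp
        show "inj_on (\<lambda>p. fst p * 2 ^ d + snd p) (Bk \<times> {..<(2::nat) ^ d})"
        proof (rule inj_onI)
          fix p q :: "nat \<times> nat"
          assume p: "p \<in> Bk \<times> {..<2 ^ d}" and q: "q \<in> Bk \<times> {..<2 ^ d}"
            and e: "fst p * 2 ^ d + snd p = fst q * 2 ^ d + snd q"
          have "(fst p * 2 ^ d + snd p) div 2 ^ d = fst p" "(fst q * 2 ^ d + snd q) div 2 ^ d = fst q"
            using p q by auto
          then have "fst p = fst q" using e by simp
          then show "p = q" using e by (simp add: prod_eq_iff)
        qed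
        fix p assume p: "p \<in> Bk \<times> {..<(2::nat) ^ d}"
        then have "fst p * 2 ^ d + snd p < Suc (fst p) * 2 ^ d" by auto
        also have "\<dots> \<le> 2 ^ n * 2 ^ d" using p by (intro mult_right_mono) (auto simp: Bk_def)
        finally show "fst p * 2 ^ d + snd p < 2 ^ (n + d)" by (simp add: power_add)
      next
        show "real (card (Bk \<times> {..<(2::nat) ^ d})) / 2 ^ (n + d) < \<delta>"
          using cardB by (simp add: card_cartesian_product power_add)
      qed
      finally show ?thesis by simp
    qed
    also have "(\<Sum>k<2 ^ n. \<Sum>i<(2::nat) ^ d. b k * \<bar>s k\<bar> * w) \<le> \<epsilon> / 4"
    proof -
      have "(\<Sum>k<2 ^ n. \<Sum>i<(2::nat) ^ d. b k * \<bar>s k\<bar> * w) = (\<Sum>k\<in>Bk. \<bar>s k\<bar> / 2 ^ n)"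
        by (rule sum.mono_neutral_cong_right) (auto simp: b_def Bk_def w_def power_add)
      also have "\<dots> = (\<Sum>p\<in>Bk \<times> {0::nat}. \<bar>slope f n (fst p)\<bar> / 2 ^ n)"
        by (rule sum.reindex_bij_witness[where i=fst and j="\<lambda>k. (k,0)"]) (auto simp: s_def)
      also have "\<dots> < \<epsilon> / 4"
        by (rule UI[rule_format]) (use fin cardB in \<open>auto simp: Bk_def inj_on_def card_cartesian_product\<close>)
      finally show ?thesis by simp
    qed
    also have "K * (\<Phi> (n + d) - \<Phi> n) \<le> K * (\<epsilon> / (4 * K))" using n K by (intro mult_left_mono) auto
    also have "K * (\<epsilon> / (4 * K)) = \<epsilon> / 4" using K by simp
    finally have "(\<Sum>k<2 ^ n. \<Sum>i<2 ^ d. \<bar>x k i - s k\<bar> * w) \<le> \<epsilon>" by (simp add: \<tau>_def)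
    then show "(\<Sum>k<2 ^ n. \<Sum>i<2 ^ d. \<bar>slope f (n + d) (k * 2 ^ d + i) - slope f n k\<bar> / 2 ^ (n + d)) \<le> \<epsilon>"
      by (simp add: x_def s_def w_def)
  qed
qed

section \<open>Almost everywhere differentiability through dyadic interpolation\<close>

definition dyadic_interp :: "(real \<Rightarrow> real) \<Rightarrow> nat \<Rightarrow> real \<Rightarrow> real" where
  "dyadic_interp f n x =
     f (dy n (nat \<lfloor>x * 2 ^ n\<rfloor>)) + (x - dy n (nat \<lfloor>x * 2 ^ n\<rfloor>)) * slope f n (nat \<lfloor>x * 2 ^ n\<rfloor>)"

lemma nat_floor_dyadic:
  assumes "dy n k \<le> x" "x < dy n (Suc k)"
  shows "nat \<lfloor>x * 2 ^ n\<rfloor> = k"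
proof -
  have "\<lfloor>x * 2 ^ n\<rfloor> = int k"
    using assms by (intro floor_unique) (auto simp: dy_def field_simps)
  then show ?thesis by simp
qed

lemma dyadic_floor_bounds:
  assumes "0 \<le> x"
  shows "dy n (nat \<lfloor>x * 2 ^ n\<rfloor>) \<le> x" "x < dy n (Suc (nat \<lfloor>x * 2 ^ n\<rfloor>))"
proof -
  have "0 \<le> x * 2 ^ n" using assms by simp
  then have "real (nat \<lfloor>x * 2 ^ n\<rfloor>) \<le> x * 2 ^ n" "x * 2 ^ n < real (Suc (nat \<lfloor>x * 2 ^ n\<rfloor>))"
    by linarith+
  then show "dy n (nat \<lfloor>x * 2 ^ n\<rfloor>) \<le> x" "x < dy n (Suc (nat \<lfloor>x * 2 ^ n\<rfloor>))"
    by (auto simp: dy_def field_simps)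
qed

lemma dyadic_floor_less:
  fixes x :: real
  assumes "0 \<le> x" "x < 1"
  shows "nat \<lfloor>x * 2 ^ n\<rfloor> < 2 ^ n"
proof -
  have "dy n (2 ^ n) = 1" by (simp add: dy_def)
  then have "dy n (nat \<lfloor>x * 2 ^ n\<rfloor>) < dy n (2 ^ n)"
    using dyadic_floor_bounds(1)[OF assms(1), of n] assms(2) by linarith
  then show ?thesis by (simp only: dy_less_iff)
qed

lemma dyadic_interp_cell:
  assumes "dy n k \<le> x" "x \<le> dy n (Suc k)"
  shows "dyadic_interp f n x = f (dy n k) + (x - dy n k) * slope f n k"
proof (cases "x < dy n (Suc k)")
  case True
  then show ?thesis using nat_floor_dyadic[OF assms(1)] by (simp add: dyadic_interp_def)
next
  case False
  then have x: "x = dy n (Suc k)" using assms by simp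
  then have "nat \<lfloor>x * 2 ^ n\<rfloor> = Suc k" by (intro nat_floor_dyadic) auto
  then have "dyadic_interp f n x = f x" by (simp add: dyadic_interp_def x)
  also have "\<dots> = f (dy n k) + (x - dy n k) * slope f n k"
    using slope_increment[of f n k] by (simp add: x dy_Suc)
  finally show ?thesis .
qed

definition interp_error :: "(real \<Rightarrow> real) \<Rightarrow> nat \<Rightarrow> real \<Rightarrow> real" where
  "interp_error f n x = f x - dyadic_interp f n x"

lemma slope_interp_error:
  assumes "i < 2 ^ d"
  shows "slope (interp_error f n) (n + d) (k * 2 ^ d + i) = slope f (n + d) (k * 2 ^ d + i) - slope f n k"
proof -
  let ?j = "k * 2 ^ d + i"
  have 1: "dy n k \<le> dy (n + d) ?j" unfolding dy_refine[of n d k, symmetric] by simp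
  have 2: "dy (n + d) (Suc ?j) \<le> dy n (Suc k)" unfolding dy_refine_Suc[of n d k, symmetric] using assms by simp
  have 3: "dy (n + d) ?j \<le> dy (n + d) (Suc ?j)" by simp
  note 4 = order_trans[OF 1 3] order_trans[OF 3 2]
  have "dyadic_interp f n (dy (n + d) ?j) = f (dy n k) + (dy (n + d) ?j - dy n k) * slope f n k"
    by (intro dyadic_interp_cell 1 2 4)
  moreover have "dyadic_interp f n (dy (n + d) (Suc ?j)) = f (dy n k) + (dy (n + d) (Suc ?j) - dy n k) * slope f n k"
    by (intro dyadic_interp_cell 1 2 4)
  ultimately have "interp_error f n (dy (n + d) (Suc ?j)) - interp_error f n (dy (n + d) ?j)
     = slope f (n + d) ?j / 2 ^ (n + d) - slope f n k / 2 ^ (n + d)"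
    using slope_increment[of f "n + d" ?j] unfolding interp_error_def
    by (simp add: dy_Suc[of "n + d"] distrib_right left_diff_distrib)
  then have "slope (interp_error f n) (n + d) ?j / 2 ^ (n + d) = (slope f (n + d) ?j - slope f n k) / 2 ^ (n + d)"
    unfolding slope_increment by (simp add: diff_divide_distrib)
  then show ?thesis by simp
qed

text \<open>From level n on, the slopes of the error are differences of slopes of f, which are small
  in L^1. Any level m is dominated by level n + m, since refinement increases variation.\<close>

lemma interp_error_small_variation:
  assumes "abs_continuous_on 0 1 f" and "0 < \<epsilon>"
  obtains n where "\<And>m. (\<Sum>k<2 ^ m. \<bar>slope (interp_error f n) m k\<bar> / 2 ^ m) \<le> \<epsilon>"
proof -
  obtain n where n: "\<And>d. (\<Sum>k<2 ^ n. \<Sum>i<2 ^ d. \<bar>slope f (n + d) (k * 2 ^ d + i) - slope f n k\<bar> / 2 ^ (n + d)) \<le> \<epsilon>"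
    using dyadic_slopes_Cauchy[OF assms] by blast
  show thesis
  proof (rule that[of n])
    fix m
    have "(\<Sum>k<2 ^ m. \<bar>slope (interp_error f n) m k\<bar> / 2 ^ m)
        \<le> (\<Sum>k<2 ^ (n + m). \<bar>slope (interp_error f n) (n + m) k\<bar> / 2 ^ (n + m))"
      using abs_slope_sum_refine[of "interp_error f n" m n] by (simp add: add.commute)
    also have "\<dots> = (\<Sum>k<2 ^ n. \<Sum>i<2 ^ m. \<bar>slope f (n + m) (k * 2 ^ m + i) - slope f n k\<bar> / 2 ^ (n + m))"
      unfolding sum_dyadic_refine by (intro sum.cong refl) (simp add: slope_interp_error)
    also have "\<dots> \<le> \<epsilon>" by (rule n)
    finally show "(\<Sum>k<2 ^ m. \<bar>slope (interp_error f n) m k\<bar> / 2 ^ m) \<le> \<epsilon>" .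
  qed
qed

definition steep :: "(real \<Rightarrow> real) \<Rightarrow> real \<Rightarrow> real set" where
  "steep F c = (\<Union>(m,a,b)\<in>{(m,a,b). a < b \<and> b \<le> 2 ^ m \<and> c * (dy m b - dy m a) < \<bar>F (dy m b) - F (dy m a)\<bar>}.
      {dy m a<..<dy m b})"

text \<open>All intervals are cut at the finest level M that occurs. Disjoint open intervals have
  disjoint sets of level M subcells, so the family costs no more than the variation at that
  level.\<close>

lemma dyadic_family_variation:
  fixes F :: "real \<Rightarrow> real" and C :: "(nat \<times> nat \<times> nat) set"
  assumes var: "\<And>m. (\<Sum>k<2 ^ m. \<bar>slope F m k\<bar> / 2 ^ m) \<le> \<epsilon>"
    and fin: "finite C"
    and C: "\<And>m a b. (m,a,b) \<in> C \<Longrightarrow> a < b \<and> b \<le> 2 ^ m"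
    and disj: "\<And>m a b m' a' b'. (m,a,b) \<in> C \<Longrightarrow> (m',a',b') \<in> C \<Longrightarrow> (m,a,b) \<noteq> (m',a',b') \<Longrightarrow>
        {dy m a<..<dy m b} \<inter> {dy m' a'<..<dy m' b'} = {}"
  shows "(\<Sum>(m,a,b)\<in>C. \<bar>F (dy m b) - F (dy m a)\<bar>) \<le> \<epsilon>"
proof -
  obtain M where M: "\<And>m a b. (m,a,b) \<in> C \<Longrightarrow> m \<le> M"
  proof
    fix m a b assume "(m,a,b) \<in> C"
    then show "m \<le> Max (fst ` C)" using fin by (intro Max_ge) force+
  qed
  define A where "A = (\<lambda>(m,a,b::nat). {a * 2 ^ (M - m)..<b * 2 ^ (M - m)})"
  have dyM: "dy m a = dy M (a * 2 ^ (M - m))" if "m \<le> M" for m a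
    using dy_refine[of m "M - m" a] that by simp
  have "(\<Sum>(m,a,b)\<in>C. \<bar>F (dy m b) - F (dy m a)\<bar>) \<le> (\<Sum>p\<in>C. \<Sum>j\<in>A p. \<bar>slope F M j\<bar> / 2 ^ M)"
  proof (intro sum_mono)
    fix p assume "p \<in> C"
    then obtain m a b where p: "p = (m,a,b)" "(m,a,b) \<in> C" by (cases p) auto
    have "F (dy m b) - F (dy m a) = (\<Sum>j = a * 2 ^ (M - m)..<b * 2 ^ (M - m). F (dy M (Suc j)) - F (dy M j))"
      using sum_Suc_diff'[of "a * 2 ^ (M - m)" "b * 2 ^ (M - m)" "\<lambda>j. F (dy M j)"] C[OF p(2)]
      by (simp add: dyM[OF M[OF p(2)]])
    also have "\<bar>\<dots>\<bar> \<le> (\<Sum>j = a * 2 ^ (M - m)..<b * 2 ^ (M - m). \<bar>slope F M j\<bar> / 2 ^ M)"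
      unfolding slope_increment by (rule order_trans[OF sum_abs]) simp
    finally show "(case p of (m,a,b) \<Rightarrow> \<bar>F (dy m b) - F (dy m a)\<bar>) \<le> (\<Sum>j\<in>A p. \<bar>slope F M j\<bar> / 2 ^ M)"
      by (simp add: p A_def)
  qed
  also have "\<dots> = (\<Sum>j\<in>(\<Union>p\<in>C. A p). \<bar>slope F M j\<bar> / 2 ^ M)"
  proof (rule sum.UNION_disjoint[symmetric])
    show "\<forall>p\<in>C. \<forall>q\<in>C. p \<noteq> q \<longrightarrow> A p \<inter> A q = {}"
    proof (intro ballI impI)
      fix p q assume pq: "p \<in> C" "q \<in> C" "p \<noteq> q"
      obtain m a b m' a' b' where e: "p = (m,a,b)" "q = (m',a',b')" by (metis prod_cases3)
      show "A p \<inter> A q = {}"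
      proof (rule ccontr)
        assume "A p \<inter> A q \<noteq> {}"
        then obtain j where "j \<in> A p" "j \<in> A q" by blast
        then have j: "a * 2 ^ (M - m) \<le> j" "Suc j \<le> b * 2 ^ (M - m)" "a' * 2 ^ (M - m') \<le> j" "Suc j \<le> b' * 2 ^ (M - m')"
          by (auto simp: A_def e)
        have mm: "m \<le> M" "m' \<le> M" using pq M by (auto simp: e)
        have "dy m a \<le> dy M j" "dy M (Suc j) \<le> dy m b" "dy m' a' \<le> dy M j" "dy M (Suc j) \<le> dy m' b'"
          using j by (simp_all only: dyM[OF mm(1)] dyM[OF mm(2)] dy_le_iff)
        moreover have "dy M j < dy M (Suc j)" by simp
        \<comment> \<open>A common subcell would put its midpoint into both open intervals.\<close>
        moreover have "(u + v) / 2 \<in> {p<..<q} \<inter> {p'<..<q'}"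
          if "p \<le> u" "v \<le> q" "p' \<le> u" "v \<le> q'" "u < v" for u v p q p' q' :: real
          using that by auto
        ultimately have "(dy M j + dy M (Suc j)) / 2 \<in> {dy m a<..<dy m b} \<inter> {dy m' a'<..<dy m' b'}"
          by blast
        then show False using disj[of m a b m' a' b'] pq by (auto simp: e)
      qed
    qed
  qed (use fin in \<open>auto simp: A_def\<close>)
  also have "\<dots> \<le> (\<Sum>k<2 ^ M. \<bar>slope F M k\<bar> / 2 ^ M)"
  proof (rule sum_mono2)
    show "(\<Union>p\<in>C. A p) \<subseteq> {..<2 ^ M}"
    proof
      fix j assume "j \<in> (\<Union>p\<in>C. A p)"
      then obtain m a b where p: "(m,a,b) \<in> C" "j < b * 2 ^ (M - m)" by (auto simp: A_def)
      have "b * 2 ^ (M - m) \<le> 2 ^ m * 2 ^ (M - m)" using C[OF p(1)] by (intro mult_right_mono) auto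
      also have "\<dots> = 2 ^ M" using M[OF p(1)] by (simp add: power_add[symmetric])
      finally show "j \<in> {..<2 ^ M}" using p(2) by simp
    qed
  qed auto
  also have "\<dots> \<le> \<epsilon>" by (rule var)
  finally show ?thesis .
qed

text \<open>The weak type (1,1) estimate for the maximal function: a disjoint subfamily selected by
  Vitali's covering lemma has total length at most \<epsilon> / c, and enlarging it five times
  covers the set. Bounds for finite subfamilies suffice, since they pass to the countable
  union.\<close>

lemma steep_measure:
  assumes var: "\<And>m. (\<Sum>k<2 ^ m. \<bar>slope F m k\<bar> / 2 ^ m) \<le> \<epsilon>" and c: "0 < c"
  obtains T where "steep F c \<subseteq> T" "T \<in> lmeasurable" "measure lebesgue T \<le> 5 * \<epsilon> / c"
proof -
  define K where "K = {(m,a,b). a < b \<and> b \<le> 2 ^ m \<and> c * (dy m b - dy m a) < \<bar>F (dy m b) - F (dy m a)\<bar>}"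
  define ctr where "ctr = (\<lambda>(m,a,b). (dy m a + dy m b) / 2)"
  define rad where "rad = (\<lambda>(m,a,b). (dy m b - dy m a) / 2)"
  have ball: "ball (ctr (m,a,b)) (rad (m,a,b)) = {dy m a<..<dy m b}" for m a b
    by (simp add: ctr_def rad_def ball_eq_greaterThanLessThan field_simps)
  have sub: "steep F c \<subseteq> (\<Union>p\<in>K. ball (ctr p) (rad p))"
    unfolding steep_def K_def[symmetric] using ball by auto
  have r: "0 < rad p \<and> rad p \<le> 1" if "p \<in> K" for p
  proof -
    obtain m a b where e: "p = (m,a,b)" by (metis prod_cases3)
    have p: "p = (m,a,b)" "a < b" "b \<le> 2 ^ m" using that by (auto simp: K_def e)
    have "0 \<le> dy m a" "dy m b \<le> 1" "dy m a < dy m b" using p by (auto intro: dy_le_1)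
    moreover have "0 < (v - u) / 2 \<and> (v - u) / 2 \<le> 1" if "0 \<le> u" "v \<le> 1" "u < v" for u v :: real
      using that by auto
    ultimately have "0 < (dy m b - dy m a) / 2 \<and> (dy m b - dy m a) / 2 \<le> 1" by blast
    then show ?thesis by (simp only: p(1) rad_def prod.case)
  qed
  obtain C where C: "countable C" "C \<subseteq> K"
     "pairwise (\<lambda>i j. disjnt (ball (ctr i) (rad i)) (ball (ctr j) (rad j))) C"
     "steep F c \<subseteq> (\<Union>i\<in>C. ball (ctr i) (5 * rad i))"
    using Vitali_covering_lemma_balls[OF sub r] by blast
  have bd: "(\<Sum>p\<in>I. measure lebesgue (ball (ctr p) (5 * rad p))) \<le> 5 * \<epsilon> / c" if I: "I \<subseteq> C" "finite I" for I
  proof -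
    have IK: "I \<subseteq> K" using I C by auto
    have "measure lebesgue (ball (ctr p) (5 * rad p)) \<le> 5 / c * (case p of (m,a,b) \<Rightarrow> \<bar>F (dy m b) - F (dy m a)\<bar>)"
      if "p \<in> I" for p
    proof -
      have "p \<in> K" using that IK by blast
      then obtain m a b where p: "p = (m,a,b)" "c * (dy m b - dy m a) < \<bar>F (dy m b) - F (dy m a)\<bar>"
        by (auto simp: K_def)
      have "measure lebesgue (ball (ctr p) (5 * rad p)) = 5 * (dy m b - dy m a)"
      proof -
        have *: "measure lebesgue (ball x s) = 2 * s" if "0 < s" for x s :: real
          using that by (simp add: ball_eq_greaterThanLessThan)
        show ?thesis using *[of "5 * rad p" "ctr p"] r[OF \<open>p \<in> K\<close>] by (simp add: p(1) rad_def)
      qed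
      also have "\<dots> = 5 / c * (c * (dy m b - dy m a))" using c by simp
      also have "\<dots> \<le> 5 / c * \<bar>F (dy m b) - F (dy m a)\<bar>" using p c by (intro mult_left_mono) auto
      finally show ?thesis by (simp add: p)
    qed
    then have "(\<Sum>p\<in>I. measure lebesgue (ball (ctr p) (5 * rad p))) \<le> 5 / c * (\<Sum>(m,a,b)\<in>I. \<bar>F (dy m b) - F (dy m a)\<bar>)"
      unfolding sum_distrib_left by (rule sum_mono)
    also have "\<dots> \<le> 5 / c * \<epsilon>"
    proof (intro mult_left_mono dyadic_family_variation[OF var])
      fix m a b m' a' b'
      assume *: "(m,a,b) \<in> I" "(m',a',b') \<in> I" "(m,a,b) \<noteq> (m',a',b')"
      then have "(m,a,b) \<in> C" "(m',a',b') \<in> C" using I by auto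
      from pairwiseD[OF C(3) this *(3)]
      show "{dy m a<..<dy m b} \<inter> {dy m' a'<..<dy m' b'} = {}"
        by (simp only: disjnt_def ball)
    next
      fix m a b assume "(m,a,b) \<in> I"
      then have "(m,a,b) \<in> K" using IK by blast
      then show "a < b \<and> b \<le> 2 ^ m" by (simp add: K_def)
    qed (use I c in auto)
    finally show ?thesis by simp
  qed
  have bd': "measure lebesgue (\<Union>p\<in>I. ball (ctr p) (5 * rad p)) \<le> 5 * \<epsilon> / c" if I: "I \<subseteq> C" "finite I" for I
    by (rule order_trans[OF measure_UNION_le bd[OF I]]) (use I in auto)
  show thesis
  proof (rule that[OF C(4)])
    show "(\<Union>i\<in>C. ball (ctr i) (5 * rad i)) \<in> lmeasurable"
      by (rule fmeasurable_UN_bound[OF C(1) _ bd']) auto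
    show "measure lebesgue (\<Union>i\<in>C. ball (ctr i) (5 * rad i)) \<le> 5 * \<epsilon> / c"
      by (rule measure_UN_bound[OF C(1) _ bd']) auto
  qed
qed

lemma dyadic_floor_tendsto:
  "0 \<le> x \<Longrightarrow> (\<lambda>m. dy m (nat \<lfloor>x * 2 ^ m\<rfloor>)) \<longlonglongrightarrow> x"
proof -
  assume x: "0 \<le> x"
  have "(\<lambda>m. (1/2::real) ^ m) \<longlonglongrightarrow> 0" by (rule LIMSEQ_power_zero) simp
  then have "(\<lambda>m. x - (1/2::real) ^ m) \<longlonglongrightarrow> x - 0" by (intro tendsto_diff tendsto_const)
  then have l: "(\<lambda>m. x - (1/2::real) ^ m) \<longlonglongrightarrow> x" by simp
  show ?thesis
  proof (rule tendsto_sandwich[OF _ _ l tendsto_const])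
    show "\<forall>\<^sub>F m in sequentially. x - (1/2) ^ m \<le> dy m (nat \<lfloor>x * 2 ^ m\<rfloor>)"
      using dyadic_floor_bounds(2)[OF x] by (intro always_eventually) (simp add: dy_Suc power_one_over field_simps less_imp_le)
  qed (use dyadic_floor_bounds(1)[OF x] in auto)
qed

lemma dyadic_floor_Suc_tendsto:
  assumes "0 \<le> x" shows "(\<lambda>m. dy m (Suc (nat \<lfloor>x * 2 ^ m\<rfloor>))) \<longlonglongrightarrow> x"
proof -
  have "(\<lambda>m. (1/2::real) ^ m) \<longlonglongrightarrow> 0" by (rule LIMSEQ_power_zero) simp
  from tendsto_add[OF dyadic_floor_tendsto[OF assms] this]
  show ?thesis by (simp add: dy_Suc power_one_over)
qed

text \<open>Dyadic points approach u from below and v from above, and continuity carries the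
  estimate to the limit. That x is not dyadic keeps the left approximant strictly below x even when
  u = x, so x is inside the open intervals tested by \<open>steep\<close>.\<close>

lemma not_steep_bound:
  assumes cont: "continuous_on {0..1} f" and x: "x \<notin> range (\<lambda>(n,k). dy n k)"
    and cell: "dy n k < u" "u \<le> x" "x \<le> v" "v < dy n (Suc k)" and k: "Suc k \<le> 2 ^ n"
    and ns: "x \<notin> steep (interp_error f n) c"
  shows "\<bar>f v - f u - slope f n k * (v - u)\<bar> \<le> c * (v - u)"
proof -
  define G where "G y = f y - slope f n k * y" for y
  define a b where "a m = nat \<lfloor>u * 2 ^ m\<rfloor>" and "b m = Suc (nat \<lfloor>v * 2 ^ m\<rfloor>)" for m
  have u0: "0 \<le> u" using cell(1) dy_nonneg[of n k] by linarith
  have v0: "0 \<le> v" using cell u0 by linarith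
  have v1: "dy n (Suc k) \<le> 1" using k by (rule dy_le_1)
  have la: "(\<lambda>m. dy m (a m)) \<longlonglongrightarrow> u" unfolding a_def by (rule dyadic_floor_tendsto[OF u0])
  have lb: "(\<lambda>m. dy m (b m)) \<longlonglongrightarrow> v" unfolding b_def by (rule dyadic_floor_Suc_tendsto[OF v0])
  have ev: "eventually (\<lambda>m. dy n k < dy m (a m) \<and> dy m (b m) < dy n (Suc k)) sequentially"
    by (intro eventually_conj order_tendstoD(1)[OF la] order_tendstoD(2)[OF lb] cell)
  have ineq: "\<bar>G (dy m (b m)) - G (dy m (a m))\<bar> \<le> c * (dy m (b m) - dy m (a m))"
    if m: "dy n k < dy m (a m)" "dy m (b m) < dy n (Suc k)" for m
  proof -
    have "dy m (a m) \<le> u" unfolding a_def by (rule dyadic_floor_bounds[OF u0])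
    moreover have "dy m (a m) \<noteq> x" using x by auto
    ultimately have ax: "dy m (a m) < x" using cell by linarith
    have "v < dy m (b m)" unfolding b_def by (rule dyadic_floor_bounds[OF v0])
    then have xb: "x < dy m (b m)" using cell by linarith
    have ab: "a m < b m" using ax xb by (metis dy_less_iff less_trans)
    have "dy m (b m) < 1" using m(2) v1 by linarith
    then have "real (b m) < real (2 ^ m)" by (simp add: dy_def)
    then have b1: "b m \<le> 2 ^ m" by (simp only: of_nat_less_iff)
    have "\<not> c * (dy m (b m) - dy m (a m)) < \<bar>interp_error f n (dy m (b m)) - interp_error f n (dy m (a m))\<bar>"
    proof
      assume "c * (dy m (b m) - dy m (a m)) < \<bar>interp_error f n (dy m (b m)) - interp_error f n (dy m (a m))\<bar>"
      then have "x \<in> steep (interp_error f n) c"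
        unfolding steep_def using ab b1 ax xb by (intro UN_I[of "(m, a m, b m)"]) auto
      then show False using ns by simp
    qed
    \<comment> \<open>On a level n cell the interpolant is affine with the slope of that cell, so
      the error and \<open>G\<close> differ by a constant and have the same increments.\<close>
    moreover have "interp_error f n y = G y + (slope f n k * dy n k - f (dy n k))" if "dy n k \<le> y" "y \<le> dy n (Suc k)" for y
      using dyadic_interp_cell[OF that, of f] by (simp add: interp_error_def G_def algebra_simps)
    ultimately show ?thesis using m ax xb by (simp add: not_less)
  qed
  have isc: "isCont f y" if "dy n k < y" "y < dy n (Suc k)" for y
  proof -
    have "0 < y" "y < 1" using that v1 dy_nonneg[of n k] by linarith+
    then have "y \<in> interior {0..1}" by simp
    then show ?thesis using cont continuous_on_interior by blast
  qed
  have "isCont G u" "isCont G v"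
    unfolding G_def using cell by (intro isCont_diff isCont_mult continuous_const continuous_ident isc; linarith)+
  then have lG: "(\<lambda>m. G (dy m (a m))) \<longlonglongrightarrow> G u" "(\<lambda>m. G (dy m (b m))) \<longlonglongrightarrow> G v"
    using la lb isCont_tendsto_compose by blast+
  have "\<bar>G v - G u\<bar> \<le> c * (v - u)"
  proof (rule tendsto_le[OF sequentially_bot])
    show "(\<lambda>m. c * (dy m (b m) - dy m (a m))) \<longlonglongrightarrow> c * (v - u)" by (intro tendsto_intros la lb)
    show "(\<lambda>m. \<bar>G (dy m (b m)) - G (dy m (a m))\<bar>) \<longlonglongrightarrow> \<bar>G v - G u\<bar>" by (intro tendsto_intros lG)
    show "eventually (\<lambda>m. \<bar>G (dy m (b m)) - G (dy m (a m))\<bar> \<le> c * (dy m (b m) - dy m (a m))) sequentially"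
      using ev by eventually_elim (auto intro: ineq)
  qed
  then show ?thesis by (simp add: G_def algebra_simps)
qed

lemma real_arch_Suc: "\<exists>n. x < real (Suc n)"
proof -
  obtain n where "x < real n" using reals_Archimedean2 by blast
  then have "x < real (Suc n)" by simp
  then show ?thesis by blast
qed

lemma filter_Cauchy_real:
  fixes q :: "'a \<Rightarrow> real"
  assumes F: "F \<noteq> bot" and H: "\<And>c. 0 < c \<Longrightarrow> \<exists>s. eventually (\<lambda>y. \<bar>q y - s\<bar> \<le> c) F"
  shows "\<exists>L. (q \<longlongrightarrow> L) F"
proof -
  have "\<forall>j::nat. \<exists>s. eventually (\<lambda>y. \<bar>q y - s\<bar> \<le> 1 / real (Suc j)) F"
    by (intro allI H) simp
  then obtain s where s: "\<And>j::nat. eventually (\<lambda>y. \<bar>q y - s j\<bar> \<le> 1 / real (Suc j)) F"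
    by (auto dest!: choice)
  have sd: "\<bar>s i - s j\<bar> \<le> 1 / Suc i + 1 / Suc j" for i j
  proof -
    have "eventually (\<lambda>y. \<bar>q y - s i\<bar> \<le> 1 / Suc i \<and> \<bar>q y - s j\<bar> \<le> 1 / Suc j) F"
      using s by (intro eventually_conj) auto
    then obtain y where "\<bar>q y - s i\<bar> \<le> 1 / Suc i" "\<bar>q y - s j\<bar> \<le> 1 / Suc j"
      using eventually_happens'[OF F] by blast
    then show ?thesis by linarith
  qed
  have "Cauchy s"
  proof (rule metric_CauchyI)
    fix e :: real assume e: "0 < e"
    obtain N where N: "2 / e < real (Suc N)" using real_arch_Suc by blast
    have "dist (s i) (s j) < e" if "i \<ge> N" "j \<ge> N" for i j
    proof -
      have "1 / Suc i \<le> 1 / Suc N" "1 / Suc j \<le> 1 / Suc N" using that by (auto intro!: divide_left_mono)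
      moreover have "1 / Suc N < e / 2" using N e by (simp add: field_simps)
      ultimately show ?thesis using sd[of i j] by (simp add: dist_real_def)
    qed
    then show "\<exists>M. \<forall>m\<ge>M. \<forall>n\<ge>M. dist (s m) (s n) < e" by blast
  qed
  then obtain L where L: "s \<longlonglongrightarrow> L" using real_Cauchy_convergent by (auto simp: convergent_def)
  have sL: "\<bar>s j - L\<bar> \<le> 1 / Suc j" for j
  proof (rule tendsto_upperbound)
    show "(\<lambda>i. \<bar>s j - s i\<bar> - 1 / Suc i) \<longlonglongrightarrow> \<bar>s j - L\<bar>"
      using tendsto_diff[OF tendsto_rabs[OF tendsto_diff[OF tendsto_const L]] LIMSEQ_inverse_real_of_nat, of "s j"]
      by (simp add: inverse_eq_divide)
    show "eventually (\<lambda>i. \<bar>s j - s i\<bar> - 1 / Suc i \<le> 1 / Suc j) sequentially"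
      using sd[of j] by (auto simp: algebra_simps)
  qed simp
  show ?thesis
  proof (intro exI tendstoI)
    fix e :: real assume e: "0 < e"
    obtain N where N: "2 / e < real (Suc N)" using real_arch_Suc by blast
    then have "1 / Suc N < e / 2" using e by (simp add: field_simps)
    then show "eventually (\<lambda>y. dist (q y) L < e) F"
      using s[of N] sL[of N] by (auto elim!: eventually_mono simp: dist_real_def)
  qed
qed

text \<open>For each tolerance c, the slope of the level n cell around x is within c of all
  difference quotients close to x; hence these quotients satisfy Cauchy's criterion at x.\<close>

lemma differentiable_at_good_point:
  assumes cont: "continuous_on {0..1} f" and x: "0 < x" "x < 1" "x \<notin> range (\<lambda>(n,k). dy n k)"
    and good: "\<And>c. 0 < c \<Longrightarrow> \<exists>n. x \<notin> steep (interp_error f n) c"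
  shows "\<exists>D. (f has_real_derivative D) (at x)"
proof -
  have "\<exists>L. ((\<lambda>y. (f y - f x) / (y - x)) \<longlongrightarrow> L) (at x)"
  proof (rule filter_Cauchy_real)
    show "at x \<noteq> bot" by simp
    fix c :: real assume "0 < c"
    then obtain n where n: "x \<notin> steep (interp_error f n) c" using good by blast
    define k where "k = nat \<lfloor>x * 2 ^ n\<rfloor>"
    have "dy n k \<le> x" "x < dy n (Suc k)" unfolding k_def using x dyadic_floor_bounds by auto
    moreover have "dy n k \<noteq> x" using x by auto
    ultimately have cell: "dy n k < x" "x < dy n (Suc k)" by auto
    have k: "Suc k \<le> 2 ^ n" unfolding k_def using x by (intro Suc_leI dyadic_floor_less) auto
    have "eventually (\<lambda>y. y \<in> {dy n k<..<dy n (Suc k)}) (nhds x)"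
      using cell by (intro eventually_nhds_in_open) auto
    then have "eventually (\<lambda>y. y \<in> {dy n k<..<dy n (Suc k)} \<and> y \<noteq> x) (at x)"
      by (auto simp: eventually_at_filter elim: eventually_mono)
    then have "eventually (\<lambda>y. \<bar>(f y - f x) / (y - x) - slope f n k\<bar> \<le> c) (at x)"
    proof eventually_elim
      case (elim y)
      have "\<bar>f y - f x - slope f n k * (y - x)\<bar> \<le> c * \<bar>y - x\<bar>"
      proof (cases "y < x")
        case True
        then show ?thesis using not_steep_bound[OF cont x(3), of n k y x c] elim cell k n
          by (simp add: abs_le_iff algebra_simps)
      next
        case False
        then show ?thesis using not_steep_bound[OF cont x(3), of n k x y c] elim cell k n by simp
      qed
      moreover have "(f y - f x) / (y - x) - slope f n k = (f y - f x - slope f n k * (y - x)) / (y - x)"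
        using elim by (simp add: field_simps)
      ultimately show ?case using elim by (simp add: pos_divide_le_eq)
    qed
    then show "\<exists>s. eventually (\<lambda>y. \<bar>(f y - f x) / (y - x) - s\<bar> \<le> c) (at x)" by blast
  qed
  then show ?thesis by (simp add: has_field_derivative_iff)
qed

text \<open>A bad point is steep for the interpolation errors of all levels at some fixed threshold.
  Since the variation of these errors can be made arbitrarily small, the maximal estimate puts the
  bad points into sets of arbitrarily small measure.\<close>

lemma abs_continuous_on_differentiable_AE:
  assumes ac: "abs_continuous_on 0 1 f"
  shows "AE x in lborel. x \<in> {0..<1} \<longrightarrow> (\<exists>D. (f has_real_derivative D) (at x))"
proof -
  define B where "B j = (\<Inter>n. steep (interp_error f n) (1 / real (Suc j)))" for j
  have "negligible (B j)" for j
    unfolding negligible_outer_le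
  proof (intro allI impI)
    fix e :: real assume e: "0 < e"
    define c where "c = 1 / real (Suc j)"
    have c: "0 < c" by (simp add: c_def)
    \<comment> \<open>The variation e c / 5 offsets the factor 5 / c of the maximal
      estimate.\<close>
    obtain n where n: "\<And>m. (\<Sum>k<2 ^ m. \<bar>slope (interp_error f n) m k\<bar> / 2 ^ m) \<le> e * c / 5"
      using interp_error_small_variation[OF ac, of "e * c / 5"] e c by auto
    obtain T where T: "steep (interp_error f n) c \<subseteq> T" "T \<in> lmeasurable" "measure lebesgue T \<le> 5 * (e * c / 5) / c"
      using steep_measure[OF n c] by blast
    show "\<exists>T. B j \<subseteq> T \<and> T \<in> lmeasurable \<and> measure lebesgue T \<le> e"
    proof (intro exI conjI)
      show "B j \<subseteq> T" using T(1) unfolding B_def c_def by blast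
    qed (use T c in auto)
  qed
  then have "negligible (\<Union>j. B j)" by (intro negligible_countable_Union) auto
  then have "AE x in lebesgue. x \<notin> (\<Union>j. B j)"
    by (intro AE_not_in) (simp add: negligible_iff_null_sets)
  then have 1: "AE x in lborel. x \<notin> (\<Union>j. B j)"
    by (simp only: AE_completion_iff)
  have "countable (insert 0 (range (\<lambda>(n,k). dy n k)))" by (intro countable_insert countable_image) auto
  then have 2: "AE x in lborel. x \<notin> insert 0 (range (\<lambda>(n,k). dy n k))"
    by (intro AE_not_in countable_imp_null_set_lborel)
  show ?thesis using 1 2
  proof eventually_elim
    case (elim x)
    show ?case
    proof
      assume x: "x \<in> {0..<1}"
      show "\<exists>D. (f has_real_derivative D) (at x)"
      proof (rule differentiable_at_good_point)
        show "continuous_on {0..1} f" by (rule abs_continuous_on_imp_continuous_on[OF ac])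
        show "0 < x" "x < 1" using x elim by auto
        show "x \<notin> range (\<lambda>(n,k). dy n k)" using elim by auto
        fix c :: real assume c: "0 < c"
        obtain j where j: "1 / c < real (Suc j)" using real_arch_Suc by blast
        then have jc: "1 / real (Suc j) \<le> c" using c by (simp add: field_simps)
        have "x \<notin> B j" using elim by auto
        then obtain n where n: "x \<notin> steep (interp_error f n) (1 / real (Suc j))" by (auto simp: B_def)
        have "steep (interp_error f n) c \<subseteq> steep (interp_error f n) (1 / real (Suc j))"
        proof
          fix z assume "z \<in> steep (interp_error f n) c"
          then obtain m a b where p: "a < b" "b \<le> 2 ^ m" "c * (dy m b - dy m a) < \<bar>interp_error f n (dy m b) - interp_error f n (dy m a)\<bar>" "z \<in> {dy m a<..<dy m b}"
            by (auto simp: steep_def)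
          have "1 / real (Suc j) * (dy m b - dy m a) \<le> c * (dy m b - dy m a)"
            using p(1) by (intro mult_right_mono[OF jc]) (simp add: less_imp_le)
          then show "z \<in> steep (interp_error f n) (1 / real (Suc j))"
            unfolding steep_def using p by (intro UN_I[of "(m,a,b)"]) auto
        qed
        then show "\<exists>n. x \<notin> steep (interp_error f n) c" using n by blast
      qed
    qed
  qed
qed

section \<open>Dyadic slopes, the derivative and the energy\<close>

lemma slope_tendsto_derivative:
  assumes D: "(f has_real_derivative D) (at x)" and x: "0 \<le> x"
  shows "(\<lambda>n. slope f n (nat \<lfloor>x * 2 ^ n\<rfloor>)) \<longlonglongrightarrow> D"
proof (rule LIMSEQ_I)
  fix e :: real assume e: "0 < e"
  have "((\<lambda>y. (f y - f x) / (y - x)) \<longlongrightarrow> D) (at x)" using D by (simp add: has_field_derivative_iff)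
  then have "eventually (\<lambda>y. dist ((f y - f x) / (y - x)) D < e / 2) (at x)"
    using e by (intro tendstoD) auto
  then obtain d where d: "0 < d" "\<And>y. y \<noteq> x \<Longrightarrow> dist y x < d \<Longrightarrow> dist ((f y - f x) / (y - x)) D < e / 2"
    unfolding eventually_at by auto
  have lin: "\<bar>f y - f x - D * (y - x)\<bar> \<le> e / 2 * \<bar>y - x\<bar>" if "\<bar>y - x\<bar> < d" for y
  proof (cases "y = x")
    case False
    have "(f y - f x) / (y - x) - D = (f y - f x - D * (y - x)) / (y - x)" using False by (simp add: field_simps)
    then have "\<bar>f y - f x - D * (y - x)\<bar> / \<bar>y - x\<bar> < e / 2"
      using d(2)[of y] that False by (simp add: dist_real_def)
    then show ?thesis using False by (simp add: divide_less_eq less_imp_le)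
  qed simp
  obtain N where N: "(1/2::real) ^ N < d" using real_arch_pow_inv[OF d(1), of "1/2"] by auto
  show "\<exists>no. \<forall>n\<ge>no. norm (slope f n (nat \<lfloor>x * 2 ^ n\<rfloor>) - D) < e"
  proof (intro exI allI impI)
    fix n assume n: "N \<le> n"
    define k where "k = nat \<lfloor>x * 2 ^ n\<rfloor>"
    have b: "dy n k \<le> x" "x < dy n (Suc k)" unfolding k_def using dyadic_floor_bounds[OF x] by auto
    have w: "dy n (Suc k) - dy n k = (1/2) ^ n" by (simp add: dy_Suc power_one_over)
    have "(1/2::real) ^ n \<le> (1/2) ^ N" using n by (intro power_decreasing) auto
    then have wd: "dy n (Suc k) - dy n k < d" using N w by linarith
    \<comment> \<open>Straddle argument: x lies between the two ends of the cell, so the two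
      one-sided errors add up to e / 2 times the length of the whole cell.\<close>
    have "\<bar>f (dy n (Suc k)) - f x - D * (dy n (Suc k) - x)\<bar> \<le> e / 2 * (dy n (Suc k) - x)"
      using lin[of "dy n (Suc k)"] b wd by simp
    moreover have "\<bar>f (dy n k) - f x - D * (dy n k - x)\<bar> \<le> e / 2 * (x - dy n k)"
      using lin[of "dy n k"] b wd by simp
    moreover have "f (dy n (Suc k)) - f (dy n k) - D * (dy n (Suc k) - dy n k)
       = (f (dy n (Suc k)) - f x - D * (dy n (Suc k) - x)) - (f (dy n k) - f x - D * (dy n k - x))"
      by (simp add: algebra_simps)
    moreover have "e / 2 * (dy n (Suc k) - dy n k) = e / 2 * (dy n (Suc k) - x) + e / 2 * (x - dy n k)"
      unfolding distrib_left[symmetric] by simp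
    ultimately have "\<bar>f (dy n (Suc k)) - f (dy n k) - D * (dy n (Suc k) - dy n k)\<bar> \<le> e / 2 * (dy n (Suc k) - dy n k)"
      by linarith
    then have "\<bar>slope f n k - D\<bar> / 2 ^ n \<le> e / 2 / 2 ^ n"
      unfolding slope_increment w by (simp add: power_one_over diff_divide_distrib[symmetric])
    then have "\<bar>slope f n k - D\<bar> \<le> e / 2" by (subst (asm) divide_le_cancel) simp
    then show "norm (slope f n (nat \<lfloor>x * 2 ^ n\<rfloor>) - D) < e" using e by (simp add: k_def)
  qed
qed

lemma nn_integral_step_function:
  assumes "\<And>k. 0 \<le> h k"
  shows "(\<integral>\<^sup>+x. ennreal (h (nat \<lfloor>x * 2 ^ n\<rfloor>)) * indicator {0..<1::real} x \<partial>lborel) = ennreal (\<Sum>k<2 ^ n. h k / 2 ^ n)"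
proof -
  have pt: "ennreal (h (nat \<lfloor>x * 2 ^ n\<rfloor>)) * indicator {0..<1::real} x
      = (\<Sum>k<2 ^ n. ennreal (h k) * indicator {dy n k..<dy n (Suc k)} x)" for x
  proof (cases "x \<in> {0..<1::real}")
    case True
    define k0 where "k0 = nat \<lfloor>x * 2 ^ n\<rfloor>"
    have k0: "k0 < 2 ^ n" unfolding k0_def using True by (intro dyadic_floor_less) auto
    have x0: "0 \<le> x" using True by simp
    have "x \<in> {dy n k..<dy n (Suc k)} \<longleftrightarrow> k = k0" for k
      using nat_floor_dyadic[of n k x] dyadic_floor_bounds[OF x0, of n] unfolding k0_def atLeastLessThan_iff by blast
    then have "indicator {dy n k..<dy n (Suc k)} x = (if k = k0 then 1 else 0 :: ennreal)" for k
      by (simp only: indicator_def of_bool_def)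
    then have "(\<Sum>k<2 ^ n. ennreal (h k) * indicator {dy n k..<dy n (Suc k)} x) = (\<Sum>k<2 ^ n. if k = k0 then ennreal (h k) else 0)"
      by (intro sum.cong) auto
    also have "\<dots> = ennreal (h k0)" using k0 by simp
    finally show ?thesis using True by (simp add: k0_def)
  next
    case False
    have "x \<notin> {dy n k..<dy n (Suc k)}" if "k < 2 ^ n" for k
    proof
      assume x: "x \<in> {dy n k..<dy n (Suc k)}"
      have "0 \<le> x" using x order_trans[OF dy_nonneg] by (simp only: atLeastLessThan_iff) blast
      moreover have "x < 1" using x less_le_trans[OF _ dy_le_1[of "Suc k" n]] that by (simp only: atLeastLessThan_iff Suc_le_eq)
      ultimately show False using False by simp
    qed
    then show ?thesis using False by simp
  qed
  have "(\<integral>\<^sup>+x. ennreal (h (nat \<lfloor>x * 2 ^ n\<rfloor>)) * indicator {0..<1::real} x \<partial>lborel)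
      = (\<Sum>k<2 ^ n. \<integral>\<^sup>+x. ennreal (h k) * indicator {dy n k..<dy n (Suc k)} x \<partial>lborel)"
    unfolding pt by (rule nn_integral_sum) auto
  also have "\<dots> = (\<Sum>k<2 ^ n. ennreal (h k / 2 ^ n))"
  proof (rule sum.cong[OF refl])
    fix k
    have "(\<integral>\<^sup>+x. ennreal (h k) * indicator {dy n k..<dy n (Suc k)} x \<partial>lborel) = ennreal (h k) * ennreal (1 / 2 ^ n)"
      by (subst nn_integral_cmult_indicator) (simp_all add: dy_Suc)
    then show "(\<integral>\<^sup>+x. ennreal (h k) * indicator {dy n k..<dy n (Suc k)} x \<partial>lborel) = ennreal (h k / 2 ^ n)"
      using assms by (simp add: ennreal_mult[symmetric])
  qed
  also have "\<dots> = ennreal (\<Sum>k<2 ^ n. h k / 2 ^ n)" using assms by (simp add: sum_ennreal)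
  finally show ?thesis .
qed

lemma nat_floor_dyadic_div:
  fixes x :: real
  assumes "0 \<le> x"
  shows "nat \<lfloor>x * 2 ^ (n + d)\<rfloor> div 2 ^ d = nat \<lfloor>x * 2 ^ n\<rfloor>"
proof -
  let ?j = "nat \<lfloor>x * 2 ^ (n + d)\<rfloor>"
  let ?k = "?j div 2 ^ d"
  have "dy n ?k \<le> x"
  proof -
    have "dy n ?k = dy (n + d) (?k * 2 ^ d)" by (simp add: dy_refine)
    also have "\<dots> \<le> dy (n + d) ?j" by (simp add: div_times_less_eq_dividend)
    also have "\<dots> \<le> x" by (rule dyadic_floor_bounds[OF assms])
    finally show ?thesis .
  qed
  moreover have "x < dy n (Suc ?k)"
  proof -
    have "Suc ?j \<le> Suc ?k * 2 ^ d" using dividend_less_div_times[of "2 ^ d" ?j] by simp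
    then have "dy (n + d) (Suc ?j) \<le> dy (n + d) (Suc ?k * 2 ^ d)" by (simp only: dy_le_iff)
    also have "\<dots> = dy n (Suc ?k)" by (rule dy_refine)
    finally show ?thesis using dyadic_floor_bounds(2)[OF assms, of "n + d"] by linarith
  qed
  ultimately show ?thesis by (simp add: nat_floor_dyadic)
qed

definition dyadic_energy :: "(real \<Rightarrow> real) \<Rightarrow> nat \<Rightarrow> real" where
  "dyadic_energy f n = 2 ^ n * (\<Sum>k<2 ^ n. (f (dy n (Suc k)) - f (dy n k))\<^sup>2)"

lemma dyadic_energy_slope: "dyadic_energy f n = (\<Sum>k<2 ^ n. (slope f n k)\<^sup>2 / 2 ^ n)"
  by (simp add: dyadic_energy_def slope_def sum_distrib_left power2_eq_square mult_ac)

text \<open>The approximation is Fatou's lemma for the squares of the step functions of slopes. The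
  upper bound needs the fundamental theorem of calculus on each cell, which follows from convergence
  of the slopes in L^1, and then the Cauchy-Schwarz inequality.\<close>

lemma
  assumes "f \<in> energy_space"
  shows dyadic_energy_le: "dyadic_energy f n \<le> (energy_norm f)\<^sup>2"
    and dyadic_energy_approx: "0 < \<kappa> \<Longrightarrow> \<exists>n. (energy_norm f)\<^sup>2 - \<kappa> < dyadic_energy f n"
proof -
  have ac: "abs_continuous_on 0 1 f" and int: "set_integrable lebesgue {0..1} (\<lambda>s. (deriv f s)\<^sup>2)"
    using assms by (auto simp: energy_space_def)
  define g where "g n x = slope f n (nat \<lfloor>x * 2 ^ n\<rfloor>)" for n and x :: real
  \<comment> \<open>A Borel version of the derivative, so that all further integrals can be taken
    over \<open>lborel\<close>.\<close>
  define G where "G x = lim (\<lambda>n. g n x)" for x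
  have gm[measurable]: "g n \<in> borel_measurable borel" for n
    unfolding g_def[abs_def] by measurable
  have Gm[measurable]: "G \<in> borel_measurable borel"
    unfolding G_def[abs_def] by (rule borel_measurable_lim_metric) (rule gm)
  have conv: "AE x in lborel. x \<in> {0..<1} \<longrightarrow> (\<lambda>n. g n x) \<longlonglongrightarrow> deriv f x \<and> G x = deriv f x"
    using abs_continuous_on_differentiable_AE[OF ac]
  proof eventually_elim
    case (elim x)
    show ?case
    proof
      assume x: "x \<in> {0..<1}"
      then obtain D where D: "(f has_real_derivative D) (at x)" using elim by blast
      have "(\<lambda>n. g n x) \<longlonglongrightarrow> D" unfolding g_def using slope_tendsto_derivative[OF D] x by simp
      moreover from this have "G x = D" unfolding G_def by (rule limI)
      moreover have "deriv f x = D" using D by (rule DERIV_imp_deriv)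
      ultimately show "(\<lambda>n. g n x) \<longlonglongrightarrow> deriv f x \<and> G x = deriv f x" by simp
    qed
  qed
  have norm: "(\<integral>\<^sup>+x. ennreal ((G x)\<^sup>2) * indicator {0..<1} x \<partial>lborel) = ennreal ((energy_norm f)\<^sup>2)"
  proof -
    have nn: "0 \<le> (LINT s:{0..1}|lebesgue. (deriv f s)\<^sup>2)"
      unfolding set_lebesgue_integral_def by (rule integral_nonneg_AE) auto
    have "AE x in lborel. x \<notin> {1::real}" by (rule AE_not_in) (simp add: countable_imp_null_set_lborel)
    then have "AE x in lborel. ennreal ((G x)\<^sup>2) * indicator {0..<1} x = ennreal (indicat_real {0..1} x *\<^sub>R (deriv f x)\<^sup>2)"
      using conv by eventually_elim (auto simp: indicator_def)
    then have "(\<integral>\<^sup>+x. ennreal ((G x)\<^sup>2) * indicator {0..<1} x \<partial>lborel) = (\<integral>\<^sup>+x. ennreal (indicat_real {0..1} x *\<^sub>R (deriv f x)\<^sup>2) \<partial>lborel)"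
      by (rule nn_integral_cong_AE)
    also have "\<dots> = (\<integral>\<^sup>+x. ennreal (indicat_real {0..1} x *\<^sub>R (deriv f x)\<^sup>2) \<partial>lebesgue)"
      by (rule nn_integral_completion[symmetric])
    also have "\<dots> = ennreal (LINT s:{0..1}|lebesgue. (deriv f s)\<^sup>2)"
      unfolding set_lebesgue_integral_def
      by (rule nn_integral_eq_integral) (use int in \<open>auto simp: set_integrable_def\<close>)
    also have "\<dots> = ennreal ((energy_norm f)\<^sup>2)" using nn by (simp add: energy_norm_def)
    finally show ?thesis .
  qed
  have g2: "(\<integral>\<^sup>+x. ennreal ((g n x)\<^sup>2) * indicator {0..<1} x \<partial>lborel) = ennreal (dyadic_energy f n)" for n
    unfolding g_def dyadic_energy_slope by (rule nn_integral_step_function[of "\<lambda>k. (slope f n k)\<^sup>2"]) simp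
  show "\<exists>n. (energy_norm f)\<^sup>2 - \<kappa> < dyadic_energy f n" if "0 < \<kappa>"
  proof (rule ccontr)
    assume "\<not> ?thesis"
    then have le: "dyadic_energy f n \<le> (energy_norm f)\<^sup>2 - \<kappa>" for n by (auto simp: not_less)
    have "ennreal ((energy_norm f)\<^sup>2) = (\<integral>\<^sup>+x. liminf (\<lambda>n. ennreal ((g n x)\<^sup>2) * indicator {0..<1} x) \<partial>lborel)"
      unfolding norm[symmetric]
    proof (rule nn_integral_cong_AE)
      show "AE x in lborel. ennreal ((G x)\<^sup>2) * indicator {0..<1} x = liminf (\<lambda>n. ennreal ((g n x)\<^sup>2) * indicator {0..<1} x)"
        using conv
      proof eventually_elim
        case (elim x)
        show ?case
        proof (cases "x \<in> {0..<1}")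
          case True
          then have "(\<lambda>n. g n x) \<longlonglongrightarrow> G x" using elim by auto
          then have "(\<lambda>n. ennreal ((g n x)\<^sup>2)) \<longlonglongrightarrow> ennreal ((G x)\<^sup>2)" by (intro tendsto_ennrealI tendsto_intros)
          then have "liminf (\<lambda>n. ennreal ((g n x)\<^sup>2)) = ennreal ((G x)\<^sup>2)" by (rule lim_imp_Liminf[rotated]) simp
          then show ?thesis using True by simp
        qed (simp add: Liminf_const)
      qed
    qed
    also have "\<dots> \<le> liminf (\<lambda>n. \<integral>\<^sup>+x. ennreal ((g n x)\<^sup>2) * indicator {0..<1} x \<partial>lborel)"
      by (rule nn_integral_liminf) measurable
    also have "\<dots> \<le> liminf (\<lambda>n::nat. ennreal ((energy_norm f)\<^sup>2 - \<kappa>))"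
      unfolding g2 by (intro Liminf_mono always_eventually allI ennreal_leI le)
    also have "\<dots> = ennreal ((energy_norm f)\<^sup>2 - \<kappa>)" by (simp add: Liminf_const)
    \<comment> \<open>The conversion to \<open>ennreal\<close> truncates a negative right-hand side
      to 0, hence the second alternative; it is excluded because dyadic energies are nonnegative and
      \<kappa> > 0.\<close>
    finally have "(energy_norm f)\<^sup>2 \<le> (energy_norm f)\<^sup>2 - \<kappa> \<or> (energy_norm f)\<^sup>2 \<le> 0"
      by (auto simp: ennreal_le_iff2)
    moreover have "0 \<le> dyadic_energy f 0" by (simp add: dyadic_energy_def)
    ultimately show False using le[of 0] that by linarith
  qed
  \<comment> \<open>Fatou's lemma turns the L^1 Cauchy property of the slopes into L^1 convergence
    to \<open>G\<close>. Only levels of the form n + d are produced, so that they refine the level n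
    cells.\<close>
  have L1: "\<exists>d. (\<integral>\<^sup>+x. ennreal \<bar>G x - g (n + d) x\<bar> * indicator {0..<1} x \<partial>lborel) \<le> ennreal \<epsilon>" if \<epsilon>: "0 < \<epsilon>" for \<epsilon> n
  proof -
    obtain m where m: "\<And>d. (\<Sum>k<2 ^ m. \<Sum>i<2 ^ d. \<bar>slope f (m + d) (k * 2 ^ d + i) - slope f m k\<bar> / 2 ^ (m + d)) \<le> \<epsilon> / 2"
      using dyadic_slopes_Cauchy[OF ac, of "\<epsilon> / 2"] \<epsilon> by auto
    have diff: "(\<integral>\<^sup>+x. ennreal \<bar>g (m + d) x - g m x\<bar> * indicator {0..<1} x \<partial>lborel) \<le> ennreal (\<epsilon> / 2)" for d
    proof -
      have "(\<integral>\<^sup>+x. ennreal \<bar>g (m + d) x - g m x\<bar> * indicator {0..<1} x \<partial>lborel)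
        = (\<integral>\<^sup>+x. ennreal ((\<lambda>j. \<bar>slope f (m + d) j - slope f m (j div 2 ^ d)\<bar>) (nat \<lfloor>x * 2 ^ (m + d)\<rfloor>)) * indicator {0..<1::real} x \<partial>lborel)"
        by (intro nn_integral_cong) (auto simp: g_def nat_floor_dyadic_div indicator_def)
      also have "\<dots> = ennreal (\<Sum>j<2 ^ (m + d). \<bar>slope f (m + d) j - slope f m (j div 2 ^ d)\<bar> / 2 ^ (m + d))"
        by (rule nn_integral_step_function) simp
      also have "(\<Sum>j<2 ^ (m + d). \<bar>slope f (m + d) j - slope f m (j div 2 ^ d)\<bar> / 2 ^ (m + d))
        = (\<Sum>k<2 ^ m. \<Sum>i<2 ^ d. \<bar>slope f (m + d) (k * 2 ^ d + i) - slope f m k\<bar> / 2 ^ (m + d))"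
        unfolding sum_dyadic_refine by (intro sum.cong refl) simp
      finally show ?thesis using m[of d] by (simp add: ennreal_leI)
    qed
    have lim: "(\<integral>\<^sup>+x. ennreal \<bar>G x - g m x\<bar> * indicator {0..<1} x \<partial>lborel) \<le> ennreal (\<epsilon> / 2)"
    proof -
      have "(\<integral>\<^sup>+x. ennreal \<bar>G x - g m x\<bar> * indicator {0..<1} x \<partial>lborel)
         = (\<integral>\<^sup>+x. liminf (\<lambda>d. ennreal \<bar>g (m + d) x - g m x\<bar> * indicator {0..<1} x) \<partial>lborel)"
      proof (rule nn_integral_cong_AE)
        show "AE x in lborel. ennreal \<bar>G x - g m x\<bar> * indicator {0..<1} x = liminf (\<lambda>d. ennreal \<bar>g (m + d) x - g m x\<bar> * indicator {0..<1} x)"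
          using conv
        proof eventually_elim
          case (elim x)
          show ?case
          proof (cases "x \<in> {0..<1}")
            case True
            then have "(\<lambda>n. g n x) \<longlonglongrightarrow> G x" using elim by auto
            then have "(\<lambda>d. g (d + m) x) \<longlonglongrightarrow> G x" by (rule LIMSEQ_ignore_initial_segment)
            then have "(\<lambda>d. g (m + d) x) \<longlonglongrightarrow> G x" by (simp add: add.commute)
            then have "(\<lambda>d. ennreal \<bar>g (m + d) x - g m x\<bar>) \<longlonglongrightarrow> ennreal \<bar>G x - g m x\<bar>" by (intro tendsto_ennrealI tendsto_intros)
            then have "liminf (\<lambda>d. ennreal \<bar>g (m + d) x - g m x\<bar>) = ennreal \<bar>G x - g m x\<bar>" by (rule lim_imp_Liminf[rotated]) simp
            then show ?thesis using True by simp
          qed (simp add: Liminf_const)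
        qed
      qed
      also have "\<dots> \<le> liminf (\<lambda>d. \<integral>\<^sup>+x. ennreal \<bar>g (m + d) x - g m x\<bar> * indicator {0..<1} x \<partial>lborel)"
        by (rule nn_integral_liminf) measurable
      also have "\<dots> \<le> liminf (\<lambda>d::nat. ennreal (\<epsilon> / 2))"
        by (intro Liminf_mono always_eventually allI diff)
      also have "\<dots> = ennreal (\<epsilon> / 2)" by (simp add: Liminf_const)
      finally show ?thesis .
    qed
    have "(\<integral>\<^sup>+x. ennreal \<bar>G x - g (n + m) x\<bar> * indicator {0..<1} x \<partial>lborel)
      \<le> (\<integral>\<^sup>+x. ennreal \<bar>G x - g m x\<bar> * indicator {0..<1} x + ennreal \<bar>g (m + n) x - g m x\<bar> * indicator {0..<1} x \<partial>lborel)"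
      by (intro nn_integral_mono) (auto simp: indicator_def ennreal_plus[symmetric] add.commute simp del: ennreal_plus intro!: ennreal_leI)
    also have "\<dots> = (\<integral>\<^sup>+x. ennreal \<bar>G x - g m x\<bar> * indicator {0..<1} x \<partial>lborel) + (\<integral>\<^sup>+x. ennreal \<bar>g (m + n) x - g m x\<bar> * indicator {0..<1} x \<partial>lborel)"
      by (rule nn_integral_add) measurable
    also have "\<dots> \<le> ennreal (\<epsilon> / 2) + ennreal (\<epsilon> / 2)" by (intro add_mono lim diff)
    also have "\<dots> = ennreal \<epsilon>" using \<epsilon> by (simp add: ennreal_plus[symmetric] del: ennreal_plus)
    finally show ?thesis by blast
  qed
  define J where "J k x = (if nat \<lfloor>x * 2 ^ n\<rfloor> = k then indicator {0..<1::real} x else 0 :: ennreal)" for k :: nat and x :: real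
  have Jm[measurable]: "J k \<in> borel_measurable borel" for k
    unfolding J_def[abs_def] by measurable
  have Jint: "(\<integral>\<^sup>+x. J k x \<partial>lborel) = ennreal (1 / 2 ^ n)" if "k < 2 ^ n" for k
  proof -
    have "(\<integral>\<^sup>+x. J k x \<partial>lborel) = (\<integral>\<^sup>+x. ennreal ((\<lambda>j. if j = k then 1 else 0) (nat \<lfloor>x * 2 ^ n\<rfloor>)) * indicator {0..<1::real} x \<partial>lborel)"
      by (intro nn_integral_cong) (auto simp: J_def)
    also have "\<dots> = ennreal (\<Sum>j<2 ^ n. (if j = k then 1 else 0) / 2 ^ n)"
      by (rule nn_integral_step_function) simp
    also have "(\<Sum>j<2 ^ n. (if j = k then 1 else 0 :: real) / 2 ^ n) = (\<Sum>j<2 ^ n. if j = k then 1 / 2 ^ n else 0)"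
      by (intro sum.cong) auto
    also have "\<dots> = 1 / 2 ^ n" using that by simp
    finally show ?thesis .
  qed
  \<comment> \<open>The half of the fundamental theorem that is needed: an increment is at most the
    integral of the absolute derivative over the cell.\<close>
  have incr: "ennreal \<bar>slope f n k / 2 ^ n\<bar> \<le> (\<integral>\<^sup>+x. ennreal \<bar>G x\<bar> * J k x \<partial>lborel)" if k: "k < 2 ^ n" for k
  proof (rule ennreal_le_epsilon)
    fix \<epsilon> :: real assume \<epsilon>: "0 < \<epsilon>"
    obtain d where d: "(\<integral>\<^sup>+x. ennreal \<bar>G x - g (n + d) x\<bar> * indicator {0..<1} x \<partial>lborel) \<le> ennreal \<epsilon>"
      using L1[OF \<epsilon>] by blast
    have "\<bar>slope f n k / 2 ^ n\<bar> \<le> (\<Sum>i<2 ^ d. \<bar>slope f (n + d) (k * 2 ^ d + i)\<bar> / 2 ^ (n + d))"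
    proof -
      have "slope f n k / 2 ^ n = (\<Sum>i<2 ^ d. slope f (n + d) (k * 2 ^ d + i)) / 2 ^ (n + d)"
        unfolding sum_slope_refine by (simp add: power_add)
      also have "\<bar>\<dots>\<bar> \<le> (\<Sum>i<2 ^ d. \<bar>slope f (n + d) (k * 2 ^ d + i)\<bar> / 2 ^ (n + d))"
        unfolding sum_divide_distrib by (rule order_trans[OF sum_abs]) simp
      finally show ?thesis .
    qed
    also have "\<dots> = (\<Sum>k'<2 ^ n. if k' = k then \<Sum>i<2 ^ d. \<bar>slope f (n + d) (k' * 2 ^ d + i)\<bar> / 2 ^ (n + d) else 0)"
      using k by simp
    also have "\<dots> = (\<Sum>k'<2 ^ n. \<Sum>i<2 ^ d. (\<lambda>j. if j div 2 ^ d = k then \<bar>slope f (n + d) j\<bar> else 0) (k' * 2 ^ d + i) / 2 ^ (n + d))"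
      by (intro sum.cong refl) auto
    also have "\<dots> = (\<Sum>j<2 ^ (n + d). (\<lambda>j. if j div 2 ^ d = k then \<bar>slope f (n + d) j\<bar> else 0) j / 2 ^ (n + d))"
      by (rule sum_dyadic_refine[symmetric])
    finally have "ennreal \<bar>slope f n k / 2 ^ n\<bar> \<le> ennreal \<dots>" by (rule ennreal_leI)
    also have "\<dots> = (\<integral>\<^sup>+x. ennreal ((\<lambda>j. if j div 2 ^ d = k then \<bar>slope f (n + d) j\<bar> else 0) (nat \<lfloor>x * 2 ^ (n + d)\<rfloor>)) * indicator {0..<1::real} x \<partial>lborel)"
      by (rule nn_integral_step_function[symmetric]) simp
    also have "\<dots> = (\<integral>\<^sup>+x. ennreal \<bar>g (n + d) x\<bar> * J k x \<partial>lborel)"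
      by (intro nn_integral_cong) (auto simp: g_def J_def nat_floor_dyadic_div indicator_def)
    also have "\<dots> \<le> (\<integral>\<^sup>+x. ennreal \<bar>G x\<bar> * J k x + ennreal \<bar>G x - g (n + d) x\<bar> * indicator {0..<1} x \<partial>lborel)"
      by (intro nn_integral_mono) (auto simp: indicator_def J_def ennreal_plus[symmetric] simp del: ennreal_plus intro!: ennreal_leI)
    also have "\<dots> = (\<integral>\<^sup>+x. ennreal \<bar>G x\<bar> * J k x \<partial>lborel) + (\<integral>\<^sup>+x. ennreal \<bar>G x - g (n + d) x\<bar> * indicator {0..<1} x \<partial>lborel)"
      by (rule nn_integral_add) measurable
    also have "\<dots> \<le> (\<integral>\<^sup>+x. ennreal \<bar>G x\<bar> * J k x \<partial>lborel) + ennreal \<epsilon>" by (intro add_left_mono d)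
    finally show "ennreal \<bar>slope f n k / 2 ^ n\<bar> \<le> (\<integral>\<^sup>+x. ennreal \<bar>G x\<bar> * J k x \<partial>lborel) + ennreal \<epsilon>" .
  qed
  have sq: "ennreal ((slope f n k)\<^sup>2 / 2 ^ n) \<le> (\<integral>\<^sup>+x. ennreal ((G x)\<^sup>2) * J k x \<partial>lborel)" if k: "k < 2 ^ n" for k
  proof -
    \<comment> \<open>Idempotence of the cell indicator \<open>J\<close> splits the integrand into
      two factors for the Cauchy-Schwarz inequality.\<close>
    have JJ: "J k x * J k x = J k x" for x by (auto simp: J_def indicator_def)
    have "(ennreal \<bar>slope f n k / 2 ^ n\<bar>)\<^sup>2 \<le> (\<integral>\<^sup>+x. ennreal \<bar>G x\<bar> * J k x \<partial>lborel)\<^sup>2"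
      by (intro power_mono incr[OF k]) simp
    also have "\<dots> = (\<integral>\<^sup>+x. (ennreal \<bar>G x\<bar> * J k x) * J k x \<partial>lborel)\<^sup>2"
      by (simp add: mult.assoc JJ)
    also have "\<dots> \<le> (\<integral>\<^sup>+x. (ennreal \<bar>G x\<bar> * J k x)\<^sup>2 \<partial>lborel) * (\<integral>\<^sup>+x. (J k x)\<^sup>2 \<partial>lborel)"
      by (rule Cauchy_Schwarz_nn_integral) measurable
    also have "(\<integral>\<^sup>+x. (J k x)\<^sup>2 \<partial>lborel) = ennreal (1 / 2 ^ n)"
      using Jint[OF k] by (simp add: power2_eq_square JJ)
    also have "(\<integral>\<^sup>+x. (ennreal \<bar>G x\<bar> * J k x)\<^sup>2 \<partial>lborel) = (\<integral>\<^sup>+x. ennreal ((G x)\<^sup>2) * J k x \<partial>lborel)"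
      by (intro nn_integral_cong) (auto simp: J_def indicator_def power2_eq_square ennreal_mult[symmetric])
    finally have "(ennreal \<bar>slope f n k / 2 ^ n\<bar>)\<^sup>2 * ennreal (2 ^ n) \<le> (\<integral>\<^sup>+x. ennreal ((G x)\<^sup>2) * J k x \<partial>lborel) * ennreal (1 / 2 ^ n) * ennreal (2 ^ n)"
      by (intro mult_right_mono) auto
    also have "\<dots> = (\<integral>\<^sup>+x. ennreal ((G x)\<^sup>2) * J k x \<partial>lborel)"
      by (simp add: mult.assoc ennreal_mult[symmetric])
    also have "(ennreal \<bar>slope f n k / 2 ^ n\<bar>)\<^sup>2 * ennreal (2 ^ n) = ennreal ((slope f n k)\<^sup>2 / 2 ^ n)"
      by (simp add: power2_eq_square ennreal_mult[symmetric] abs_mult_self_eq flip: abs_mult)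
    finally show ?thesis .
  qed
  have "ennreal (dyadic_energy f n) = (\<Sum>k<2 ^ n. ennreal ((slope f n k)\<^sup>2 / 2 ^ n))"
    unfolding dyadic_energy_slope by (simp add: sum_ennreal)
  also have "\<dots> \<le> (\<Sum>k<2 ^ n. \<integral>\<^sup>+x. ennreal ((G x)\<^sup>2) * J k x \<partial>lborel)"
    by (intro sum_mono sq) simp
  also have "\<dots> = (\<integral>\<^sup>+x. (\<Sum>k<2 ^ n. ennreal ((G x)\<^sup>2) * J k x) \<partial>lborel)"
    by (rule nn_integral_sum[symmetric]) measurable
  also have "\<dots> = (\<integral>\<^sup>+x. ennreal ((G x)\<^sup>2) * indicator {0..<1} x \<partial>lborel)"
  proof (intro nn_integral_cong)
    fix x :: real
    show "(\<Sum>k<2 ^ n. ennreal ((G x)\<^sup>2) * J k x) = ennreal ((G x)\<^sup>2) * indicator {0..<1} x"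
    proof (cases "x \<in> {0..<1}")
      case True
      then have "nat \<lfloor>x * 2 ^ n\<rfloor> < 2 ^ n" by (intro dyadic_floor_less) auto
      then have "(\<Sum>k<2 ^ n. J k x) = 1" using True by (simp add: J_def)
      then show ?thesis using True by (simp add: sum_distrib_left[symmetric])
    qed (simp add: J_def)
  qed
  also have "\<dots> = ennreal ((energy_norm f)\<^sup>2)" by (rule norm)
  finally show "dyadic_energy f n \<le> (energy_norm f)\<^sup>2" by simp
qed

section \<open>Fourier and Hausdorff dimension\<close>

text \<open>Write the squared modulus of the transform as a double integral over M and integrate out
  the Gaussian frequency first: its characteristic function gives a Gaussian kernel at scale 1 / T.
  Boundedness of all integrands justifies Fubini. The identity takes the place of the Fourier
  formula for Riesz energies.\<close>

lemma gaussian_average_char: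
  fixes M :: "real measure"
  assumes fm: "finite_measure M" and sets_M: "sets M = sets borel"
  shows "(\<integral>z. (cmod (char M (T * z)))\<^sup>2 \<partial>std_normal_distribution)
       = (\<integral>x. \<integral>y. exp (- (T * (x - y))\<^sup>2 / 2) \<partial>M \<partial>M)"
proof -
  interpret finite_measure M by (rule fm)
  note [measurable_cong] = sets_M
  interpret N: real_distribution std_normal_distribution by (rule real_dist_normal_dist)
  interpret P: pair_sigma_finite M std_normal_distribution ..
  have fin: "finite_measure (M \<Otimes>\<^sub>M std_normal_distribution)"
    by (intro finite_measure_pair_measure finite_measure_axioms N.finite_measure_axioms)
  have spM: "space M = UNIV" using sets_eq_imp_space_eq[OF sets_M] by simp
  have [measurable]: "char M \<in> borel_measurable borel"
    unfolding char_def[abs_def] by measurable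
  have [measurable]: "cnj \<in> borel_measurable borel"
    by (intro borel_measurable_continuous_onI continuous_intros)
  have bd: "cmod (char M t) \<le> measure M (space M)" for t
  proof -
    have "cmod (char M t) \<le> (\<integral>x. cmod (iexp (t * x)) \<partial>M)"
      unfolding char_def by (rule integral_norm_bound)
    then show ?thesis by simp
  qed
  have norm_sq: "complex_of_real ((cmod (char M t))\<^sup>2) = char M t * cnj (char M t)" for t
    by (rule complex_norm_square)
  have conj: "cnj (char M (T * z)) * iexp (T * z * x) = (\<integral>y. iexp (z * (T * (x - y))) \<partial>M)" for x z
  proof -
    have "cnj (char M (T * z)) * iexp (T * z * x) = (\<integral>y. iexp (T * z * x) * cnj (iexp (T * z * y)) \<partial>M)"
      unfolding char_def by (simp add: mult.commute integral_cnj)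
    also have "\<dots> = (\<integral>y. iexp (z * (T * (x - y))) \<partial>M)"
      by (intro Bochner_Integration.integral_cong refl) (simp add: exp_cnj exp_add[symmetric] algebra_simps)
    finally show ?thesis .
  qed
  have "complex_of_real (\<integral>z. (cmod (char M (T * z)))\<^sup>2 \<partial>std_normal_distribution)
      = (\<integral>z. char M (T * z) * cnj (char M (T * z)) \<partial>std_normal_distribution)"
    by (simp only: norm_sq[symmetric] integral_complex_of_real)
  also have "\<dots> = (\<integral>z. \<integral>x. cnj (char M (T * z)) * iexp (T * z * x) \<partial>M \<partial>std_normal_distribution)"
    by (simp add: char_def mult.commute)
  also have "\<dots> = (\<integral>x. \<integral>z. cnj (char M (T * z)) * iexp (T * z * x) \<partial>std_normal_distribution \<partial>M)"
  proof (rule P.Fubini_integral)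
    show "integrable (M \<Otimes>\<^sub>M std_normal_distribution) (\<lambda>(x, z). cnj (char M (T * z)) * iexp (T * z * x))"
    proof (rule finite_measure.integrable_const_bound[OF fin])
      show "AE p in M \<Otimes>\<^sub>M std_normal_distribution. norm (case p of (x, z) \<Rightarrow> cnj (char M (T * z)) * iexp (T * z * x)) \<le> measure M (space M)"
        using bd by (auto simp: norm_mult)
    qed measurable
  qed
  also have "\<dots> = (\<integral>x. \<integral>z. \<integral>y. iexp (z * (T * (x - y))) \<partial>M \<partial>std_normal_distribution \<partial>M)"
    by (simp only: conj)
  also have "\<dots> = (\<integral>x. \<integral>y. \<integral>z. iexp (z * (T * (x - y))) \<partial>std_normal_distribution \<partial>M \<partial>M)"
  proof (rule Bochner_Integration.integral_cong[OF refl], rule P.Fubini_integral)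
    fix x
    show "integrable (M \<Otimes>\<^sub>M std_normal_distribution) (\<lambda>(y, z). iexp (z * (T * (x - y))))"
      by (rule finite_measure.integrable_const_bound[OF fin, of _ 1]) auto
  qed
  also have "\<dots> = (\<integral>x. \<integral>y. complex_of_real (exp (- (T * (x - y))\<^sup>2 / 2)) \<partial>M \<partial>M)"
  proof (rule Bochner_Integration.integral_cong[OF refl], rule Bochner_Integration.integral_cong[OF refl])
    fix x y
    have "(\<integral>z. iexp (z * (T * (x - y))) \<partial>std_normal_distribution) = char std_normal_distribution (T * (x - y))"
      by (simp add: char_def mult.commute)
    then show "(\<integral>z. iexp (z * (T * (x - y))) \<partial>std_normal_distribution) = complex_of_real (exp (- (T * (x - y))\<^sup>2 / 2))"
      by (simp add: char_std_normal_distribution)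
  qed
  also have "\<dots> = complex_of_real (\<integral>x. \<integral>y. exp (- (T * (x - y))\<^sup>2 / 2) \<partial>M \<partial>M)"
    by simp
  finally show ?thesis by (simp only: of_real_eq_iff)
qed

lemma std_normal_negative_moment_finite:
  assumes "0 < a" "a < 1"
  shows "(\<integral>\<^sup>+z. ennreal (\<bar>z\<bar> powr (- a)) \<partial>std_normal_distribution) < \<infinity>"
proof -
  have pos: "(\<integral>\<^sup>+z. ennreal (indicator {0..1} z * (z powr (- a))) \<partial>lborel) < \<infinity>"
  proof -
    have "((\<lambda>x. x powr (- a)) has_integral (1 powr (- a + 1) / (- a + 1))) {0..1}"
      by (rule has_integral_powr_from_0) (use assms in auto)
    then have "(\<integral>\<^sup>+z. ennreal (z powr (- a)) * indicator {0..1} z \<partial>lborel) = ennreal (1 powr (- a + 1) / (- a + 1))"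
      by (intro nn_integral_has_integral_lebesgue') auto
    moreover have "ennreal (indicator {0..1} z * (z powr (- a))) = ennreal (z powr (- a)) * indicator {0..1} z" for z :: real
      by (auto simp: indicator_def)
    ultimately show ?thesis by simp
  qed
  have neg: "(\<integral>\<^sup>+z. ennreal (indicator {0..1} (- z) * ((- z) powr (- a))) \<partial>lborel) = (\<integral>\<^sup>+z. ennreal (indicator {0..1} z * (z powr (- a))) \<partial>lborel)"
    using nn_integral_real_affine[of "\<lambda>z. ennreal (indicator {0..1} z * (z powr (- a)))" "-1" 0] by simp
  have e2: "(\<integral>\<^sup>+z. ennreal (indicator {0..1} z * (z powr (- a))) + ennreal (indicator {0..1} (- z) * ((- z) powr (- a))) \<partial>lborel) = (\<integral>\<^sup>+z. ennreal (indicator {0..1} z * (z powr (- a))) \<partial>lborel) + (\<integral>\<^sup>+z. ennreal (indicator {0..1} (- z) * ((- z) powr (- a))) \<partial>lborel)"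
    by (rule nn_integral_add) measurable
  have d1: "std_normal_density z \<le> 1" for z
  proof -
    have "1 \<le> sqrt (2 * pi)" using pi_gt3 by simp
    then have "1 / sqrt (2 * pi) * exp (- z\<^sup>2 / 2) \<le> 1 * 1" by (intro mult_mono) auto
    then show ?thesis by (simp add: std_normal_density_def)
  qed
  have "(\<integral>\<^sup>+z. ennreal (\<bar>z\<bar> powr (- a)) \<partial>std_normal_distribution) = (\<integral>\<^sup>+z. ennreal (std_normal_density z) * ennreal (\<bar>z\<bar> powr (- a)) \<partial>lborel)"
    by (rule nn_integral_density) auto
  also have "\<dots> \<le> (\<integral>\<^sup>+z. ennreal (std_normal_density z) + (ennreal (indicator {0..1} z * (z powr (- a))) + ennreal (indicator {0..1} (- z) * ((- z) powr (- a)))) \<partial>lborel)"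
  proof (rule nn_integral_mono)
    fix z :: real
    have "std_normal_density z * \<bar>z\<bar> powr (- a) \<le> std_normal_density z + (indicator {0..1} z * (z powr (- a)) + indicator {0..1} (- z) * ((- z) powr (- a)))"
    proof (cases "\<bar>z\<bar> \<le> 1")
      case True
      have "std_normal_density z * \<bar>z\<bar> powr (- a) \<le> 1 * \<bar>z\<bar> powr (- a)"
        by (intro mult_right_mono d1) simp
      moreover have "\<bar>z\<bar> powr (- a) \<le> indicator {0..1} z * (z powr (- a)) + indicator {0..1} (- z) * ((- z) powr (- a))"
        using True by (cases "0 \<le> z") (auto simp: indicator_def)
      ultimately show ?thesis using normal_density_nonneg[of 0 1 z] by linarith
    next
      case False
      then have "\<bar>z\<bar> powr (- a) \<le> \<bar>z\<bar> powr 0" using assms by (intro powr_mono) auto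
      then have "\<bar>z\<bar> powr (- a) \<le> 1" using False by (auto split: if_splits)
      then have "std_normal_density z * \<bar>z\<bar> powr (- a) \<le> std_normal_density z * 1"
        by (intro mult_left_mono) auto
      moreover have "0 \<le> indicator {0..1} z * (z powr (- a)) + indicator {0..1} (- z) * ((- z) powr (- a))" by simp
      ultimately show ?thesis by linarith
    qed
    then have "ennreal (std_normal_density z * \<bar>z\<bar> powr (- a)) \<le> ennreal (std_normal_density z + (indicator {0..1} z * (z powr (- a)) + indicator {0..1} (- z) * ((- z) powr (- a))))"
      by (rule ennreal_leI)
    then show "ennreal (std_normal_density z) * ennreal (\<bar>z\<bar> powr (- a)) \<le> ennreal (std_normal_density z) + (ennreal (indicator {0..1} z * (z powr (- a))) + ennreal (indicator {0..1} (- z) * ((- z) powr (- a))))"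
      by (simp add: ennreal_mult[symmetric] ennreal_plus[symmetric] del: ennreal_plus)
  qed
  also have "\<dots> = (\<integral>\<^sup>+z. ennreal (std_normal_density z) \<partial>lborel) + ((\<integral>\<^sup>+z. ennreal (indicator {0..1} z * (z powr (- a))) \<partial>lborel) + (\<integral>\<^sup>+z. ennreal (indicator {0..1} (- z) * ((- z) powr (- a))) \<partial>lborel))"
    unfolding e2[symmetric] by (rule nn_integral_add) measurable
  also have "\<dots> < \<infinity>"
  proof -
    have "(\<integral>\<^sup>+z. ennreal (std_normal_density z) \<partial>lborel) = 1"
      by (subst nn_integral_eq_integral) auto
    then show ?thesis unfolding neg using pos by simp
  qed
  finally show ?thesis .
qed

text \<open>Squaring the decay gives C^2 T^(-a) |z|^(-a) at frequency T z, and the negative moment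
  of order a of a Gaussian is finite because a < 1.\<close>

lemma gaussian_energy_bound:
  fixes M :: "real measure"
  assumes fm: "finite_measure M" and sets_M: "sets M = sets borel"
    and a: "0 < a" "a < 1"
    and decay: "\<And>u. u \<noteq> 0 \<Longrightarrow> cmod (char M u) \<le> C * \<bar>u\<bar> powr (- a / 2)"
  obtains B where "0 \<le> B"
    "\<And>T. 0 < T \<Longrightarrow> (\<integral>x. \<integral>y. exp (- (T * (x - y))\<^sup>2 / 2) \<partial>M \<partial>M) \<le> B * T powr (- a)"
proof -
  interpret finite_measure M by (rule fm)
  note [measurable_cong] = sets_M
  have [measurable]: "char M \<in> borel_measurable borel"
    unfolding char_def[abs_def] by measurable
  define A where "A = enn2real (\<integral>\<^sup>+z. ennreal (\<bar>z\<bar> powr (- a)) \<partial>std_normal_distribution)"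
  have A: "(\<integral>\<^sup>+z. ennreal (\<bar>z\<bar> powr (- a)) \<partial>std_normal_distribution) = ennreal A"
    unfolding A_def using std_normal_negative_moment_finite[OF a] by simp
  have C0: "0 \<le> C" using order_trans[OF norm_ge_zero decay[of 1]] by simp
  show thesis
  proof (rule that[of "C\<^sup>2 * A"])
    show "0 \<le> C\<^sup>2 * A" by (simp add: A_def)
    fix T :: real assume T: "0 < T"
    have "AE z in lborel. z \<noteq> (0::real)" by (rule AE_lborel_singleton)
    then have ne: "AE z in std_normal_distribution. z \<noteq> 0"
      by (subst AE_density) (auto elim: eventually_mono)
    have "(\<integral>x. \<integral>y. exp (- (T * (x - y))\<^sup>2 / 2) \<partial>M \<partial>M) = (\<integral>z. (cmod (char M (T * z)))\<^sup>2 \<partial>std_normal_distribution)"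
      by (rule gaussian_average_char[OF fm sets_M, symmetric])
    also have "\<dots> = enn2real (\<integral>\<^sup>+z. ennreal ((cmod (char M (T * z)))\<^sup>2) \<partial>std_normal_distribution)"
      by (rule integral_eq_nn_integral) auto
    also have "\<dots> \<le> enn2real (ennreal (C\<^sup>2 * T powr (- a) * A))"
    proof (rule enn2real_mono)
      have "(\<integral>\<^sup>+z. ennreal ((cmod (char M (T * z)))\<^sup>2) \<partial>std_normal_distribution)
         \<le> (\<integral>\<^sup>+z. ennreal (C\<^sup>2 * T powr (- a)) * ennreal (\<bar>z\<bar> powr (- a)) \<partial>std_normal_distribution)"
      proof (rule nn_integral_mono_AE)
        show "AE z in std_normal_distribution. ennreal ((cmod (char M (T * z)))\<^sup>2) \<le> ennreal (C\<^sup>2 * T powr (- a)) * ennreal (\<bar>z\<bar> powr (- a))"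
          using ne
        proof eventually_elim
          case (elim z)
          have "(cmod (char M (T * z)))\<^sup>2 \<le> (C * \<bar>T * z\<bar> powr (- a / 2))\<^sup>2"
            using decay[of "T * z"] elim T by (intro power_mono) auto
          also have "\<dots> = C\<^sup>2 * \<bar>T * z\<bar> powr (- a)"
            by (simp add: power_mult_distrib power2_eq_square powr_add[symmetric])
          also have "\<dots> = C\<^sup>2 * T powr (- a) * \<bar>z\<bar> powr (- a)" using T by (simp add: abs_mult powr_mult)
          finally show ?case by (simp add: ennreal_mult[symmetric] ennreal_leI)
        qed
      qed
      also have "\<dots> = ennreal (C\<^sup>2 * T powr (- a)) * ennreal A"
        by (subst nn_integral_cmult) (auto simp: A)
      also have "\<dots> = ennreal (C\<^sup>2 * T powr (- a) * A)" by (simp add: ennreal_mult A_def)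
      finally show "(\<integral>\<^sup>+z. ennreal ((cmod (char M (T * z)))\<^sup>2) \<partial>std_normal_distribution) \<le> ennreal (C\<^sup>2 * T powr (- a) * A)" .
    qed simp
    also have "\<dots> = C\<^sup>2 * A * T powr (- a)" by (simp add: A_def)
    finally show "(\<integral>x. \<integral>y. exp (- (T * (x - y))\<^sup>2 / 2) \<partial>M \<partial>M) \<le> C\<^sup>2 * A * T powr (- a)" .
  qed
qed

text \<open>The Gaussian kernel dominates the indicator of \<open>\<bar>x - y\<bar> \<le> 2\<^sup>-\<^sup>n\<close>, so the energy bound
  gives \<open>\<Sum>n. 2 powr (n s) \<mu>(B(x, 2\<^sup>-\<^sup>n)) < \<infinity>\<close> for almost every \<open>x\<close>.\<close>

lemma frostman_set:
  fixes M :: "real measure"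
  assumes fm: "finite_measure M" and sets_M: "sets M = sets borel"
    and s: "0 < s" "s < a" "a < 1"
    and decay: "\<And>u. u \<noteq> 0 \<Longrightarrow> cmod (char M u) \<le> C * \<bar>u\<bar> powr (- a / 2)"
    and ne: "emeasure M (space M) \<noteq> 0"
  obtains A m where "A \<in> sets borel" "emeasure M A \<noteq> 0" "0 < m"
    "\<And>x n. x \<in> A \<Longrightarrow> emeasure M (cball x ((1/2) ^ n)) \<le> ennreal (m * 2 powr (- s * real n))"
proof -
  interpret finite_measure M by (rule fm)
  note [measurable_cong] = sets_M
  have spM: "space M = UNIV" using sets_eq_imp_space_eq[OF sets_M] by simp
  obtain B where B0: "0 \<le> B" and B: "\<And>T. 0 < T \<Longrightarrow> (\<integral>x. \<integral>y. exp (- (T * (x - y))\<^sup>2 / 2) \<partial>M \<partial>M) \<le> B * T powr (- a)"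
    using gaussian_energy_bound[OF fm sets_M _ s(3) decay] s by auto
  define F where "F n x = emeasure M (cball x ((1/2) ^ n))" for n x
  have F_eq: "F n x = (\<integral>\<^sup>+y. indicator {p. \<bar>fst p - snd p\<bar> \<le> (1/2) ^ n} (x, y) \<partial>M)" for n x
  proof -
    have "(\<integral>\<^sup>+y. indicator {p. \<bar>fst p - snd p\<bar> \<le> (1/2) ^ n} (x, y) \<partial>M) = (\<integral>\<^sup>+y. indicator (cball x ((1/2) ^ n)) y \<partial>M)"
      by (intro nn_integral_cong) (auto simp: indicator_def dist_real_def)
    then show ?thesis by (simp add: F_def)
  qed
  have Fm[measurable]: "F n \<in> borel_measurable M" for n
    unfolding F_eq[abs_def] by measurable
  have Fint: "(\<integral>\<^sup>+x. F n x \<partial>M) \<le> ennreal (exp (1/2) * B * 2 powr (- a * real n))" for n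
  proof -
    define T :: real where "T = 2 ^ n"
    have T: "0 < T" by (simp add: T_def)
    have bnd: "norm (exp (- (T * (x - y))\<^sup>2 / 2)) \<le> 1" for x y by simp
    have i1: "integrable M (\<lambda>y. exp (- (T * (x - y))\<^sup>2 / 2))" for x
      by (rule integrable_const_bound[of _ 1]) (use bnd in auto)
    have i2: "integrable M (\<lambda>x. \<integral>y. exp (- (T * (x - y))\<^sup>2 / 2) \<partial>M)"
    proof (rule integrable_const_bound[of _ "measure M (space M)"])
      show "AE x in M. norm (\<integral>y. exp (- (T * (x - y))\<^sup>2 / 2) \<partial>M) \<le> measure M (space M)"
      proof (intro AE_I2)
        fix x
        have "norm (\<integral>y. exp (- (T * (x - y))\<^sup>2 / 2) \<partial>M) \<le> (\<integral>y. 1 \<partial>M)"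
          by (rule Bochner_Integration.integral_norm_bound_integral[OF i1]) auto
        then show "norm (\<integral>y. exp (- (T * (x - y))\<^sup>2 / 2) \<partial>M) \<le> measure M (space M)" by simp
      qed
    qed measurable
    have "F n x \<le> ennreal (exp (1/2) * (\<integral>y. exp (- (T * (x - y))\<^sup>2 / 2) \<partial>M))" for x
    proof -
      have "F n x \<le> (\<integral>\<^sup>+y. ennreal (exp (1/2)) * ennreal (exp (- (T * (x - y))\<^sup>2 / 2)) \<partial>M)"
        unfolding F_eq
      proof (rule nn_integral_mono)
        fix y
        \<comment> \<open>For |x - y| at most 1 / T the kernel is at least exp(-1/2), hence the
          constant exp(1/2).\<close>
        have "1 \<le> exp (1/2) * exp (- (T * (x - y))\<^sup>2 / 2)" if "\<bar>x - y\<bar> \<le> (1/2) ^ n"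
        proof -
          have "T * \<bar>x - y\<bar> \<le> T * (1/2) ^ n" using that T by (intro mult_left_mono) auto
          also have "\<dots> = 1" by (simp add: T_def power_one_over)
          finally have "\<bar>T * (x - y)\<bar> \<le> 1" using T by (simp add: abs_mult)
          then have "(T * (x - y))\<^sup>2 \<le> 1" by (simp add: abs_square_le_1)
          then show ?thesis unfolding exp_add[symmetric] by simp
        qed
        then show "indicator {p. \<bar>fst p - snd p\<bar> \<le> (1/2) ^ n} (x, y) \<le> ennreal (exp (1/2)) * ennreal (exp (- (T * (x - y))\<^sup>2 / 2))"
          by (auto simp: indicator_def ennreal_mult[symmetric] simp flip: ennreal_1 intro!: ennreal_leI)
      qed
      also have "\<dots> = ennreal (exp (1/2)) * (\<integral>\<^sup>+y. ennreal (exp (- (T * (x - y))\<^sup>2 / 2)) \<partial>M)"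
        by (rule nn_integral_cmult) measurable
      also have "\<dots> = ennreal (exp (1/2) * (\<integral>y. exp (- (T * (x - y))\<^sup>2 / 2) \<partial>M))"
        by (subst nn_integral_eq_integral[OF i1]) (auto simp: ennreal_mult)
      finally show ?thesis .
    qed
    then have "(\<integral>\<^sup>+x. F n x \<partial>M) \<le> (\<integral>\<^sup>+x. ennreal (exp (1/2) * (\<integral>y. exp (- (T * (x - y))\<^sup>2 / 2) \<partial>M)) \<partial>M)"
      by (intro nn_integral_mono)
    also have "\<dots> = ennreal (\<integral>x. exp (1/2) * (\<integral>y. exp (- (T * (x - y))\<^sup>2 / 2) \<partial>M) \<partial>M)"
      by (rule nn_integral_eq_integral) (use i2 in auto)
    also have "\<dots> \<le> ennreal (exp (1/2) * (B * T powr (- a)))"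
      using B[OF T] by (intro ennreal_leI) simp
    also have "T powr (- a) = 2 powr (- a * real n)"
      by (simp add: T_def powr_realpow[symmetric] powr_powr mult.commute)
    finally show ?thesis by (simp add: mult.assoc)
  qed
  define G where "G x = (\<Sum>n. ennreal (2 powr (s * real n)) * F n x)" for x
  have Gm[measurable]: "G \<in> borel_measurable M" unfolding G_def[abs_def] by measurable
  have "(\<integral>\<^sup>+x. G x \<partial>M) = (\<Sum>n. ennreal (2 powr (s * real n)) * (\<integral>\<^sup>+x. F n x \<partial>M))"
    unfolding G_def by (subst nn_integral_suminf) (auto simp: nn_integral_cmult)
  also have "\<dots> \<le> (\<Sum>n. ennreal (exp (1/2) * B * (2 powr (s - a)) ^ n))"
  proof (intro suminf_le allI)
    fix n
    have "ennreal (2 powr (s * real n)) * (\<integral>\<^sup>+x. F n x \<partial>M) \<le> ennreal (2 powr (s * real n)) * ennreal (exp (1/2) * B * 2 powr (- a * real n))"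
      by (intro mult_left_mono Fint) simp
    also have "\<dots> = ennreal (exp (1/2) * B * (2 powr (s * real n) * 2 powr (- a * real n)))"
      using B0 by (simp add: ennreal_mult[symmetric] mult_ac)
    also have "2 powr (s * real n) * 2 powr (- a * real n) = (2 powr (s - a)) ^ n"
      by (simp add: powr_add[symmetric] powr_realpow[symmetric] powr_powr algebra_simps)
    finally show "ennreal (2 powr (s * real n)) * (\<integral>\<^sup>+x. F n x \<partial>M) \<le> ennreal (exp (1/2) * B * (2 powr (s - a)) ^ n)" .
  qed auto
  also have "\<dots> < \<infinity>"
  proof -
    have "2 powr (s - a) < (2::real) powr 0" using s by (intro powr_less_mono) auto
    then have "summable (\<lambda>n. exp (1/2) * B * (2 powr (s - a)) ^ n)"
      by (intro summable_mult summable_geometric) simp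
    then have "(\<Sum>n. ennreal (exp (1/2) * B * (2 powr (s - a)) ^ n)) = ennreal (\<Sum>n. exp (1/2) * B * (2 powr (s - a)) ^ n)"
      using B0 by (intro suminf_ennreal2) auto
    then show ?thesis by simp
  qed
  finally have "AE x in M. G x \<noteq> \<infinity>"
    by (intro nn_integral_PInf_AE Gm) auto
  then have AE: "AE x in M. x \<in> (\<Union>k::nat. {x \<in> space M. G x \<le> ennreal (real (Suc k))})"
  proof eventually_elim
    case (elim x)
    then obtain r where r: "G x = ennreal r" "0 \<le> r" by (cases "G x") auto
    obtain k where "r \<le> real k" using real_arch_simple by blast
    then have "r \<le> real (Suc k)" by simp
    then have "G x \<le> ennreal (real (Suc k))" unfolding r by (rule ennreal_leI)
    then show ?case unfolding spM by blast
  qed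
  \<comment> \<open>The sublevel sets of G exhaust M up to a null set, so one of them has positive
    mass; on it a single constant serves all radii.\<close>
  have "\<exists>k. emeasure M {x \<in> space M. G x \<le> ennreal (real (Suc k))} \<noteq> 0"
  proof (rule ccontr)
    assume "\<not> ?thesis"
    then have "(\<Union>k::nat. {x \<in> space M. G x \<le> ennreal (real (Suc k))}) \<in> null_sets M"
      by (intro null_sets_UN null_setsI) auto
    then have "AE x in M. x \<notin> (\<Union>k::nat. {x \<in> space M. G x \<le> ennreal (real (Suc k))})" by (rule AE_not_in)
    then have "AE x in M. x \<notin> space M" using AE by eventually_elim simp
    then show False using ne by (subst (asm) AE_iff_measurable[OF _ refl]) auto
  qed
  then obtain k where k: "emeasure M {x \<in> space M. G x \<le> ennreal (real (Suc k))} \<noteq> 0" by blast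
  show thesis
  proof (rule that[OF _ k, of "real (Suc k)"])
    have "{x \<in> space M. G x \<le> ennreal (real (Suc k))} \<in> sets M" by measurable
    then show "{x \<in> space M. G x \<le> ennreal (real (Suc k))} \<in> sets borel" using sets_M by simp
    fix x n assume "x \<in> {x \<in> space M. G x \<le> ennreal (real (Suc k))}"
    then have "G x \<le> ennreal (real (Suc k))" by simp
    moreover have "ennreal (2 powr (s * real n)) * F n x \<le> G x"
      unfolding G_def using sum_le_suminf[OF summableI, of "{n}" "\<lambda>n. ennreal (2 powr (s * real n)) * F n x"] by simp
    ultimately have "ennreal (2 powr (- s * real n)) * (ennreal (2 powr (s * real n)) * F n x) \<le> ennreal (2 powr (- s * real n)) * ennreal (real (Suc k))"
      by (intro mult_left_mono) auto
    moreover have "ennreal (2 powr (- s * real n)) * (ennreal (2 powr (s * real n)) * F n x) = F n x"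
      by (simp add: mult.assoc[symmetric] ennreal_mult[symmetric] powr_add[symmetric])
    ultimately show "emeasure M (cball x ((1/2) ^ n)) \<le> ennreal (real (Suc k) * 2 powr (- s * real n))"
      by (simp add: F_def ennreal_mult[symmetric] mult.commute del: of_nat_Suc)
  qed simp
qed

section \<open>Mass distribution and comparison of the two dimensions\<close>

lemma half_power_bracket:
  assumes "0 < d" "d \<le> (1::real)"
  obtains n where "(1/2) ^ Suc n < d" "d \<le> (1/2) ^ n"
proof -
  have ex: "\<exists>n. (1/2) ^ n < d" using real_arch_pow_inv[OF assms(1), of "1/2"] by auto
  define m where "m = (LEAST n. (1/2) ^ n < d)"
  have m: "(1/2) ^ m < d" unfolding m_def using ex by (rule LeastI_ex)
  then have "m \<noteq> 0" using assms by (cases m) auto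
  then obtain n where n: "m = Suc n" by (cases m) auto
  have "\<not> (1/2) ^ n < d" using n not_less_Least[of n "\<lambda>n. (1/2) ^ n < d"] by (simp add: m_def[symmetric])
  then show thesis using m n that by auto
qed

text \<open>The mass distribution principle: on a set A of positive mass, balls of radius d have
  mass at most a constant times d^s. Any cover of E by sets of diameter at most 1 therefore has
  s-sum at least a fixed multiple of the mass of A.\<close>

lemma M_set_hausdorff_measure_pos:
  assumes "M_set (b / 2) K" "K \<subseteq> E" and s: "0 < s" "s < b" "b \<le> 1"
  shows "hausdorff_measure s E \<noteq> 0"
proof -
  obtain \<mu> :: "real measure" where \<mu>: "finite_measure \<mu>" "sets \<mu> = sets borel" "emeasure \<mu> K \<noteq> 0" "emeasure \<mu> (- K) = 0"
    and o: "(\<lambda>u. norm (char \<mu> u)) \<in> o[at_infinity](\<lambda>u. \<bar>u\<bar> powr (- (b / 2)))" and K: "compact K"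
    using assms(1) unfolding M_set_def by auto
  interpret finite_measure \<mu> by fact
  note [measurable_cong] = \<mu>(2)
  have sp: "space \<mu> = UNIV" using sets_eq_imp_space_eq[OF \<mu>(2)] by simp
  \<comment> \<open>The midpoint lies strictly below 1 even when b = 1, as the Gaussian moment
    requires, and strictly above s, as the summation over radii requires.\<close>
  define a where "a = (s + b) / 2"
  have a: "0 < a" "s < a" "a < 1" "a \<le> b" using s by (auto simp: a_def)
  have bd: "cmod (char \<mu> t) \<le> measure \<mu> (space \<mu>)" for t
  proof -
    have "cmod (char \<mu> t) \<le> (\<integral>x. cmod (iexp (t * x)) \<partial>\<mu>)"
      unfolding char_def by (rule integral_norm_bound)
    then show ?thesis by simp
  qed
  have "eventually (\<lambda>u. norm (norm (char \<mu> u)) \<le> 1 * norm (\<bar>u\<bar> powr (- (b / 2)))) at_infinity"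
    using landau_o.smallD[OF o, of 1] by simp
  then obtain U where U: "\<And>u. U \<le> norm u \<Longrightarrow> cmod (char \<mu> u) \<le> \<bar>u\<bar> powr (- (b / 2))"
    unfolding eventually_at_infinity by auto
  define U' where "U' = max 1 U"
  define C where "C = 1 + measure \<mu> (space \<mu>) * U' powr (a / 2)"
  have decay: "cmod (char \<mu> u) \<le> C * \<bar>u\<bar> powr (- a / 2)" if u: "u \<noteq> 0" for u
  proof (cases "U' \<le> \<bar>u\<bar>")
    case True
    then have "cmod (char \<mu> u) \<le> \<bar>u\<bar> powr (- (b / 2))" using U by (auto simp: U'_def)
    also have "\<dots> \<le> 1 * \<bar>u\<bar> powr (- a / 2)" using True a by (simp add: U'_def powr_mono)
    also have "\<dots> \<le> C * \<bar>u\<bar> powr (- a / 2)" by (intro mult_right_mono) (auto simp: C_def)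
    finally show ?thesis .
  next
    case False
    have "cmod (char \<mu> u) \<le> measure \<mu> (space \<mu>) * 1" using bd by simp
    also have "\<dots> \<le> measure \<mu> (space \<mu>) * (U' powr (a / 2) * \<bar>u\<bar> powr (- a / 2))"
    proof (intro mult_left_mono)
      have "1 = \<bar>u\<bar> powr (a / 2) * \<bar>u\<bar> powr (- a / 2)" using u by (simp add: powr_add[symmetric])
      also have "\<dots> \<le> U' powr (a / 2) * \<bar>u\<bar> powr (- a / 2)"
        using False a by (intro mult_right_mono powr_mono2) auto
      finally show "1 \<le> U' powr (a / 2) * \<bar>u\<bar> powr (- a / 2)" .
    qed simp
    also have "\<dots> \<le> C * \<bar>u\<bar> powr (- a / 2)" by (simp add: C_def algebra_simps)
    finally show ?thesis .
  qed
  have ne: "emeasure \<mu> (space \<mu>) \<noteq> 0"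
    using \<mu>(3) emeasure_space[of \<mu> K] by auto
  obtain A m where A: "A \<in> sets borel" "emeasure \<mu> A \<noteq> 0" "0 < m"
    "\<And>x n. x \<in> A \<Longrightarrow> emeasure \<mu> (cball x ((1/2) ^ n)) \<le> ennreal (m * 2 powr (- s * real n))"
    using frostman_set[OF \<mu>(1,2) s(1) a(2,3) decay ne] by blast
  have Kb: "K \<in> sets borel" using K by (simp add: borel_compact)
  have AK: "emeasure \<mu> (A \<inter> K) = emeasure \<mu> A"
  proof -
    have "AE x in \<mu>. x \<notin> - K" using Kb \<mu>(2,4) by (intro AE_not_in null_setsI) auto
    then show ?thesis by (intro emeasure_eq_AE) (use A(1) Kb \<mu>(2) in auto)
  qed
  have ball: "emeasure \<mu> (cball x d) \<le> ennreal (m * 2 powr s * d powr s)" if x: "x \<in> A" and d: "0 \<le> d" "d \<le> 1" for x d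
  proof (cases "d = 0")
    case True
    \<comment> \<open>Covering sets of diameter 0 contribute \<open>0 powr s = 0\<close>, so single
      points of A must be shown to carry no mass.\<close>
    have lim: "(\<lambda>n. ennreal (m * 2 powr (- s * real n))) \<longlonglongrightarrow> ennreal 0"
    proof (rule tendsto_ennrealI)
      have "(\<lambda>n. (2 powr (- s)) ^ n) \<longlonglongrightarrow> 0"
      proof (rule LIMSEQ_power_zero)
        have "(2::real) powr (- s) < 2 powr 0" using s by (intro powr_less_mono) auto
        then show "norm ((2::real) powr (- s)) < 1" by simp
      qed
      moreover have "(2 powr (- s)) ^ n = 2 powr (- s * real n)" for n
        by (simp add: powr_realpow[symmetric] powr_powr)
      ultimately have "(\<lambda>n. 2 powr (- s * real n)) \<longlonglongrightarrow> 0" by simp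
      from tendsto_mult_left[OF this, of m] show "(\<lambda>n. m * 2 powr (- s * real n)) \<longlonglongrightarrow> 0" by simp
    qed
    have "emeasure \<mu> (cball x d) \<le> ennreal 0"
    proof (rule tendsto_lowerbound[OF lim])
      show "eventually (\<lambda>n. emeasure \<mu> (cball x d) \<le> ennreal (m * 2 powr (- s * real n))) sequentially"
      proof (intro always_eventually allI)
        fix n
        have "emeasure \<mu> (cball x d) \<le> emeasure \<mu> (cball x ((1/2) ^ n))"
          using \<mu>(2) True by (intro emeasure_mono subset_cball) auto
        then show "emeasure \<mu> (cball x d) \<le> ennreal (m * 2 powr (- s * real n))"
          using A(4)[OF x, of n] by (rule order_trans)
      qed
    qed simp
    then show ?thesis by (simp add: True)
  next
    case False
    then obtain n where n: "(1/2) ^ Suc n < d" "d \<le> (1/2) ^ n" using half_power_bracket[of d] d by auto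
    have "emeasure \<mu> (cball x d) \<le> emeasure \<mu> (cball x ((1/2) ^ n))"
      using \<mu>(2) n by (intro emeasure_mono subset_cball) auto
    also have "\<dots> \<le> ennreal (m * 2 powr (- s * real n))" by (rule A(4)[OF x])
    also have "\<dots> \<le> ennreal (m * 2 powr s * d powr s)"
    proof (intro ennreal_leI)
      have "2 powr (- s * real n) = ((1/2) ^ n) powr s"
        by (simp add: powr_realpow[symmetric] powr_powr powr_divide powr_minus inverse_eq_divide mult.commute)
      also have "\<dots> \<le> (2 * d) powr s" using n s by (intro powr_mono2) auto
      also have "\<dots> = 2 powr s * d powr s" using d by (simp add: powr_mult)
      finally show "m * 2 powr (- s * real n) \<le> m * 2 powr s * d powr s" using A(3) by simp
    qed
    finally show ?thesis .
  qed
  define c where "c = m * 2 powr s"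
  have c: "0 < c" using A(3) by (simp add: c_def)
  have pre: "emeasure \<mu> A / ennreal c \<le> hausdorff_premeasure s 1 E"
    unfolding hausdorff_premeasure_def
  proof (rule INF_greatest)
    fix U :: "nat \<Rightarrow> real set"
    assume "U \<in> {U. E \<subseteq> (\<Union>i. U i) \<and> (\<forall>i. bounded (U i) \<and> diameter (U i) \<le> 1)}"
    then have U: "E \<subseteq> (\<Union>i. U i)" "\<And>i. bounded (U i)" "\<And>i. diameter (U i) \<le> 1" by auto
    \<comment> \<open>Covering sets need not be measurable and may miss A. They are replaced by
      closed balls of the same diameter as radius, centred in A, to which the ball estimate
      applies.\<close>
    define W where "W i = (if U i \<inter> A = {} then {} else cball (SOME x. x \<in> U i \<inter> A) (diameter (U i)))" for i
    have W: "W i = cball (SOME x. x \<in> U i \<inter> A) (diameter (U i)) \<and> (SOME x. x \<in> U i \<inter> A) \<in> U i \<inter> A" if "U i \<inter> A \<noteq> {}" for i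
      using that someI_ex[of "\<lambda>x. x \<in> U i \<inter> A"] by (auto simp: W_def)
    have sub: "A \<inter> K \<subseteq> (\<Union>i. W i)"
    proof
      fix y assume y: "y \<in> A \<inter> K"
      then obtain i where i: "y \<in> U i" using U(1) assms(2) by auto
      then have "U i \<inter> A \<noteq> {}" using y by auto
      from W[OF this] have Wi: "W i = cball (SOME x. x \<in> U i \<inter> A) (diameter (U i))" "(SOME x. x \<in> U i \<inter> A) \<in> U i" by auto
      have "dist (SOME x. x \<in> U i \<inter> A) y \<le> diameter (U i)"
        by (rule diameter_bounded_bound[OF U(2) Wi(2) i])
      then show "y \<in> (\<Union>i. W i)" using Wi(1) by auto
    qed
    have Wm: "W i \<in> sets \<mu>" for i unfolding W_def \<mu>(2) by auto
    have Wb: "emeasure \<mu> (W i) \<le> ennreal c * ennreal (diameter (U i) powr s)" for i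
    proof (cases "U i \<inter> A = {}")
      case False
      from W[OF this] show ?thesis
        using ball[of "SOME x. x \<in> U i \<inter> A" "diameter (U i)"] U diameter_ge_0[OF U(2)] c
        by (auto simp: c_def ennreal_mult[symmetric])
    qed (simp add: W_def)
    have "emeasure \<mu> A \<le> emeasure \<mu> (\<Union>i. W i)"
      unfolding AK[symmetric] by (intro emeasure_mono sub) (use Wm in auto)
    also have "\<dots> \<le> (\<Sum>i. emeasure \<mu> (W i))"
      using Wm by (intro emeasure_subadditive_countably) auto
    also have "\<dots> \<le> (\<Sum>i. ennreal c * ennreal (diameter (U i) powr s))"
      by (intro suminf_le Wb) auto
    also have "\<dots> = ennreal c * (\<Sum>i. ennreal (diameter (U i) powr s))" by (rule ennreal_suminf_cmult)
    finally show "emeasure \<mu> A / ennreal c \<le> (\<Sum>i. ennreal (diameter (U i) powr s))"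
      using c by (intro divide_le_posI_ennreal) (auto simp: mult.commute)
  qed
  have "emeasure \<mu> A / ennreal c \<noteq> 0" using A(2) c by (simp add: ennreal_divide_eq_0_iff)
  moreover have "hausdorff_premeasure s 1 E \<le> hausdorff_measure s E"
    unfolding hausdorff_measure_def by (rule SUP_upper) simp
  ultimately show ?thesis using pre by (metis le_zero_eq order_trans)
qed

lemma fourier_dim_compact_le:
  assumes "hausdorff_measure s E = 0" "0 < s" "K \<subseteq> E"
  shows "fourier_dim_compact K \<le> s"
  unfolding fourier_dim_compact_def
proof (rule cSup_least)
  fix a assume "a \<in> insert 0 {a. 0 < a \<and> a \<le> 1 \<and> M_set (a / 2) K}"
  then consider "a = 0" | "0 < a" "a \<le> 1" "M_set (a / 2) K" by auto
  then show "a \<le> s"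
  proof cases
    case 2
    show ?thesis
    proof (rule ccontr)
      assume "\<not> a \<le> s"
      then show False using M_set_hausdorff_measure_pos[OF 2(3) assms(3,2)] 2 assms(1) by simp
    qed
  qed (use assms in simp)
qed simp

lemma fourier_dim_le:
  assumes "hausdorff_measure s E = 0" "0 < s"
  shows "fourier_dim E \<le> s"
proof (cases "compact E")
  case True
  then show ?thesis using fourier_dim_compact_le[OF assms] by (simp add: fourier_dim_def)
next
  case False
  have "(SUP K\<in>{K. compact K \<and> K \<subseteq> E}. fourier_dim_compact K) \<le> s"
    by (rule cSUP_least) (use compact_empty in \<open>auto intro: fourier_dim_compact_le[OF assms]\<close>)
  then show ?thesis using False by (simp add: fourier_dim_def)
qed

text \<open>For compact E the dimension is defined by measures on E itself, not by a supremum over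
  subsets; a measure carried by K is then also one carried by E.\<close>

lemma fourier_dim_ge:
  assumes "0 < a" "a \<le> 1" "M_set (a / 2) K" "K \<subseteq> E"
  shows "a \<le> fourier_dim E"
proof -
  have bdd: "bdd_above (insert 0 {a. 0 < a \<and> a \<le> 1 \<and> M_set (a / 2) K})" for K
    by (rule bdd_aboveI[of _ 1]) auto
  have le1: "fourier_dim_compact K \<le> 1" for K
    unfolding fourier_dim_compact_def by (rule cSup_least) auto
  have ge: "a \<le> fourier_dim_compact K'" if "M_set (a / 2) K'" for K'
    unfolding fourier_dim_compact_def by (rule cSup_upper[OF _ bdd]) (use assms(1,2) that in simp)
  have K: "compact K" using assms(3) by (simp add: M_set_def)
  show ?thesis
  proof (cases "compact E")
    case True
    obtain \<mu> :: "real measure" where \<mu>: "finite_measure \<mu>" "sets \<mu> = sets borel" "emeasure \<mu> K \<noteq> 0" "emeasure \<mu> (- K) = 0"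
      and o: "(\<lambda>u. norm (char \<mu> u)) \<in> o[at_infinity](\<lambda>u. \<bar>u\<bar> powr (- (a / 2)))"
      using assms(3) unfolding M_set_def by auto
    have Kb: "K \<in> sets borel" and Eb: "E \<in> sets borel" using K True by (auto intro: borel_compact)
    have "emeasure \<mu> K \<le> emeasure \<mu> E"
      by (rule emeasure_mono[OF assms(4)]) (simp only: \<mu>(2) Eb)
    then have 1: "emeasure \<mu> E \<noteq> 0" using \<mu>(3) by (metis le_zero_eq)
    have "- K \<in> sets \<mu>" unfolding \<mu>(2) by (rule borel_comp[OF Kb])
    then have "emeasure \<mu> (- E) \<le> emeasure \<mu> (- K)"
      using assms(4) by (intro emeasure_mono) auto
    then have 2: "emeasure \<mu> (- E) = 0" using \<mu>(4) by simp
    have "M_set (a / 2) E" unfolding M_set_def by (intro conjI exI[of _ \<mu>] True \<mu>(1,2) 1 2 o)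
    then show ?thesis using ge True by (simp add: fourier_dim_def)
  next
    case False
    have "a \<le> fourier_dim_compact K" by (rule ge[OF assms(3)])
    also have "\<dots> \<le> (SUP K\<in>{K. compact K \<and> K \<subseteq> E}. fourier_dim_compact K)"
    proof (rule cSUP_upper)
      show "K \<in> {K. compact K \<and> K \<subseteq> E}" using K assms(4) by simp
      show "bdd_above (fourier_dim_compact ` {K. compact K \<and> K \<subseteq> E})"
        using le1 by (intro bdd_aboveI2[of _ _ 1])
    qed
    finally show ?thesis using False by (simp add: fourier_dim_def)
  qed
qed

section \<open>Brownian increments\<close>

text \<open>For |z| at least x, one of the signs gives z^2 >= x^2 + (z -+ x)^2. So the density there
  is at most exp(-x^2 / (2 \<sigma>^2)) times the sum of the normal densities centred at x and at
  -x, whose total mass is 2. This has no factor 1/x and remains valid at x = 0.\<close>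

lemma normal_tail_bound:
  assumes M: "prob_space M" and Y: "distributed M lborel Y (normal_density 0 \<sigma>)" and \<sigma>: "0 < \<sigma>" and x: "0 \<le> x"
  shows "measure M {\<omega>\<in>space M. x \<le> \<bar>Y \<omega>\<bar>} \<le> 2 * exp (- x\<^sup>2 / (2 * \<sigma>\<^sup>2))"
proof -
  interpret prob_space M by fact
  have pt: "normal_density 0 \<sigma> z * indicator {z. x \<le> \<bar>z\<bar>} z \<le> exp (- x\<^sup>2 / (2 * \<sigma>\<^sup>2)) * (normal_density x \<sigma> z + normal_density (- x) \<sigma> z)" for z
  proof -
    have *: "normal_density 0 \<sigma> z \<le> exp (- x\<^sup>2 / (2 * \<sigma>\<^sup>2)) * normal_density m \<sigma> z" if m: "x\<^sup>2 + (z - m)\<^sup>2 \<le> z\<^sup>2" for m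
    proof -
      have "exp (- z\<^sup>2 / (2 * \<sigma>\<^sup>2)) \<le> exp (- x\<^sup>2 / (2 * \<sigma>\<^sup>2) + - (z - m)\<^sup>2 / (2 * \<sigma>\<^sup>2))"
        unfolding exp_le_cancel_iff add_divide_distrib[symmetric] using m \<sigma> by (intro divide_right_mono) auto
      then have "1 / sqrt (2 * pi * \<sigma>\<^sup>2) * exp (- z\<^sup>2 / (2 * \<sigma>\<^sup>2)) \<le> 1 / sqrt (2 * pi * \<sigma>\<^sup>2) * exp (- x\<^sup>2 / (2 * \<sigma>\<^sup>2) + - (z - m)\<^sup>2 / (2 * \<sigma>\<^sup>2))"
        by (intro mult_left_mono) auto
      then show ?thesis unfolding normal_density_def exp_add by (simp add: mult_ac)
    qed
    show ?thesis
    proof (cases "x \<le> \<bar>z\<bar>")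
      case True
      consider "x \<le> z" | "x \<le> - z" using True by linarith
      then show ?thesis
      proof cases
        case 1
        have "0 \<le> x * (z - x)" using 1 x by simp
        then have "x\<^sup>2 + (z - x)\<^sup>2 \<le> z\<^sup>2" by (simp add: power2_eq_square algebra_simps)
        from *[OF this] have "normal_density 0 \<sigma> z \<le> exp (- x\<^sup>2 / (2 * \<sigma>\<^sup>2)) * (normal_density x \<sigma> z + normal_density (- x) \<sigma> z)"
          by (rule order_trans) (intro mult_left_mono; simp)
        then show ?thesis using True by simp
      next
        case 2
        have "0 \<le> x * (- z - x)" using 2 x by (intro mult_nonneg_nonneg) auto
        then have "x\<^sup>2 + (z - (- x))\<^sup>2 \<le> z\<^sup>2" by (simp add: power2_eq_square algebra_simps)
        from *[OF this] have "normal_density 0 \<sigma> z \<le> exp (- x\<^sup>2 / (2 * \<sigma>\<^sup>2)) * (normal_density x \<sigma> z + normal_density (- x) \<sigma> z)"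
          by (rule order_trans) (intro mult_left_mono; simp)
        then show ?thesis using True by simp
      qed
    qed simp
  qed
  have "emeasure M (Y -` {z. x \<le> \<bar>z\<bar>} \<inter> space M) = (\<integral>\<^sup>+z. ennreal (normal_density 0 \<sigma> z) * indicator {z. x \<le> \<bar>z\<bar>} z \<partial>lborel)"
    by (rule distributed_emeasure[OF Y]) measurable
  also have "\<dots> = (\<integral>\<^sup>+z. ennreal (normal_density 0 \<sigma> z * indicator {z. x \<le> \<bar>z\<bar>} z) \<partial>lborel)"
    by (intro nn_integral_cong) (auto simp: indicator_def)
  also have "\<dots> \<le> (\<integral>\<^sup>+z. ennreal (exp (- x\<^sup>2 / (2 * \<sigma>\<^sup>2)) * (normal_density x \<sigma> z + normal_density (- x) \<sigma> z)) \<partial>lborel)"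
    by (intro nn_integral_mono ennreal_leI pt)
  also have "\<dots> = ennreal (\<integral>z. exp (- x\<^sup>2 / (2 * \<sigma>\<^sup>2)) * (normal_density x \<sigma> z + normal_density (- x) \<sigma> z) \<partial>lborel)"
    using \<sigma> by (intro nn_integral_eq_integral) auto
  also have "(\<integral>z. exp (- x\<^sup>2 / (2 * \<sigma>\<^sup>2)) * (normal_density x \<sigma> z + normal_density (- x) \<sigma> z) \<partial>lborel) = 2 * exp (- x\<^sup>2 / (2 * \<sigma>\<^sup>2))"
    using \<sigma> by (simp add: Bochner_Integration.integral_add)
  finally have "emeasure M (Y -` {z. x \<le> \<bar>z\<bar>} \<inter> space M) \<le> ennreal (2 * exp (- x\<^sup>2 / (2 * \<sigma>\<^sup>2)))" .
  moreover have "Y -` {z. x \<le> \<bar>z\<bar>} \<inter> space M = {\<omega>\<in>space M. x \<le> \<bar>Y \<omega>\<bar>}" by auto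
  ultimately show ?thesis by (simp add: emeasure_eq_measure)
qed

text \<open>Every point of the window is within \<sigma> (|x| + 1) of the mean; multiply the
  smallest possible density by the width \<sigma>.\<close>

lemma normal_window_prob:
  assumes M: "prob_space M" and Y: "distributed M lborel Y (normal_density 0 \<sigma>)" and \<sigma>: "0 < \<sigma>"
  shows "exp (- (\<bar>x\<bar> + 1)\<^sup>2 / 2) / sqrt (2 * pi) \<le> measure M {\<omega>\<in>space M. Y \<omega> \<in> {\<sigma> * x .. \<sigma> * x + \<sigma>}}"
proof -
  interpret prob_space M by fact
  define d where "d = exp (- (\<bar>x\<bar> + 1)\<^sup>2 / 2) / sqrt (2 * pi)"
  have d0: "0 \<le> d" by (simp add: d_def)
  have low: "d / \<sigma> \<le> normal_density 0 \<sigma> z" if z: "z \<in> {\<sigma> * x .. \<sigma> * x + \<sigma>}" for z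
  proof -
    have "\<bar>z\<bar> \<le> \<bar>\<sigma> * x\<bar> + \<sigma>" using z \<sigma> by auto
    then have "\<bar>z\<bar> \<le> \<sigma> * (\<bar>x\<bar> + 1)" using \<sigma> by (simp add: abs_mult algebra_simps)
    then have "z\<^sup>2 \<le> (\<sigma> * (\<bar>x\<bar> + 1))\<^sup>2"
      using \<sigma> by (subst abs_le_square_iff[symmetric]) auto
    then have "z\<^sup>2 / (2 * \<sigma>\<^sup>2) \<le> (\<bar>x\<bar> + 1)\<^sup>2 / 2"
      using \<sigma> by (simp add: power_mult_distrib divide_le_eq mult_ac)
    then have "exp (- (\<bar>x\<bar> + 1)\<^sup>2 / 2) \<le> exp (- z\<^sup>2 / (2 * \<sigma>\<^sup>2))" by simp
    then have "exp (- (\<bar>x\<bar> + 1)\<^sup>2 / 2) / sqrt (2 * pi * \<sigma>\<^sup>2) \<le> exp (- z\<^sup>2 / (2 * \<sigma>\<^sup>2)) / sqrt (2 * pi * \<sigma>\<^sup>2)"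
      by (intro divide_right_mono) auto
    moreover have "sqrt (2 * pi * \<sigma>\<^sup>2) = sqrt (2 * pi) * \<sigma>" using \<sigma> by (simp add: real_sqrt_mult)
    ultimately show ?thesis by (simp add: normal_density_def d_def)
  qed
  have "ennreal d = ennreal (d / \<sigma>) * ennreal \<sigma>" using \<sigma> d0 by (simp add: ennreal_mult[symmetric])
  also have "\<dots> = (\<integral>\<^sup>+z. ennreal (d / \<sigma>) * indicator {\<sigma> * x .. \<sigma> * x + \<sigma>} z \<partial>lborel)"
    using \<sigma> by (subst nn_integral_cmult_indicator) auto
  also have "\<dots> \<le> (\<integral>\<^sup>+z. ennreal (normal_density 0 \<sigma> z) * indicator {\<sigma> * x .. \<sigma> * x + \<sigma>} z \<partial>lborel)"
    using low by (intro nn_integral_mono) (auto simp: indicator_def intro: ennreal_leI)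
  also have "\<dots> = emeasure M (Y -` {\<sigma> * x .. \<sigma> * x + \<sigma>} \<inter> space M)"
    by (rule distributed_emeasure[OF Y, symmetric]) simp
  also have "Y -` {\<sigma> * x .. \<sigma> * x + \<sigma>} \<inter> space M = {\<omega>\<in>space M. Y \<omega> \<in> {\<sigma> * x .. \<sigma> * x + \<sigma>}}" by auto
  finally show ?thesis unfolding d_def by (simp only: emeasure_eq_measure ennreal_le_iff measure_nonneg)
qed

locale brownian =
  fixes M :: "'w measure" and X :: "'w \<Rightarrow> real \<Rightarrow> real"
  assumes bm: "brownian_motion M X"
begin

sublocale prob_space M
  using bm by (simp add: brownian_motion_def)

lemma X_measurable: "0 \<le> t \<Longrightarrow> t \<le> 1 \<Longrightarrow> (\<lambda>\<omega>. X \<omega> t) \<in> borel_measurable M"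
  using bm by (simp add: brownian_motion_def)

lemma AE_continuous: "AE \<omega> in M. continuous_on {0..1} (X \<omega>)"
  using bm by (simp add: brownian_motion_def)

lemma increments_indep:
  assumes "0 \<le> \<tau> 0" "\<tau> n \<le> 1" "\<And>i. i < n \<Longrightarrow> \<tau> i < \<tau> (Suc i)"
  shows "indep_vars (\<lambda>_. borel) (\<lambda>i \<omega>. X \<omega> (\<tau> (Suc i)) - X \<omega> (\<tau> i)) {..<n}"
proof -
  have "\<forall>(n::nat) (\<tau>::nat \<Rightarrow> real).
        0 \<le> \<tau> 0 \<and> \<tau> n \<le> 1 \<and> (\<forall>i<n. \<tau> i < \<tau> (Suc i)) \<longrightarrow>
        indep_vars (\<lambda>_. borel) (\<lambda>i \<omega>. X \<omega> (\<tau> (Suc i)) - X \<omega> (\<tau> i)) {..<n}"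
    using bm unfolding brownian_motion_def by (elim conjE)
  then show ?thesis using assms by simp
qed

lemma increment_distributed:
  "0 \<le> s \<Longrightarrow> s < t \<Longrightarrow> t \<le> 1 \<Longrightarrow> distributed M lborel (\<lambda>\<omega>. X \<omega> t - X \<omega> s) (normal_density 0 (sqrt (t - s)))"
  using bm unfolding brownian_motion_def by blast

lemma increment_tail:
  assumes "0 \<le> s" "s < t" "t \<le> 1" "0 \<le> x"
  shows "prob {\<omega>\<in>space M. x \<le> \<bar>X \<omega> t - X \<omega> s\<bar>} \<le> 2 * exp (- x\<^sup>2 / (2 * (t - s)))"
  using normal_tail_bound[OF prob_space_axioms increment_distributed[OF assms(1-3)] _ assms(4)] assms by simp

end

section \<open>Modulus of continuity of the path at dyadic scales\<close>

definition dyadic_modulus :: "(real \<Rightarrow> real) \<Rightarrow> nat \<Rightarrow> bool" where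
  "dyadic_modulus x q \<longleftrightarrow>
     (\<forall>k<2 ^ q. \<forall>t\<in>{dy q k..dy q (Suc k)}. \<bar>x t - x (dy q k)\<bar> \<le> 16 * sqrt (real q / 2 ^ q))"

text \<open>The linear factor is absorbed at the price of the ratio 3/4 in place of 1/2; 7/8 is a
  convenient upper bound for its square root, as 49/64 > 3/4.\<close>

lemma chaining_series_bound: "sqrt (real (q + j + 1) / 2 ^ (q + j + 1)) \<le> sqrt (real q / 2 ^ q) * (7 / 8) ^ j" if "1 \<le> q"
proof -
  have g: "real (j + 2) / 2 ^ (j + 1) \<le> (3 / 4) ^ j"
  proof (induction j)
    case (Suc j)
    have "real (Suc j + 2) / 2 ^ (Suc j + 1) \<le> 3 / 4 * (real (j + 2) / 2 ^ (j + 1))"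
      by (simp add: field_simps)
    also have "\<dots> \<le> 3 / 4 * (3 / 4) ^ j" using Suc by (intro mult_left_mono) auto
    finally show ?case by simp
  qed simp
  have "real (q + j + 1) \<le> real q * real (j + 2)"
  proof -
    have "q + j + 1 \<le> q * (j + 2)" using that by (cases q) auto
    then show ?thesis by (metis of_nat_le_iff of_nat_mult)
  qed
  then have "real (q + j + 1) / 2 ^ (q + j + 1) \<le> real q * real (j + 2) / 2 ^ (q + j + 1)"
    by (intro divide_right_mono) auto
  also have "\<dots> = real q / 2 ^ q * (real (j + 2) / 2 ^ (j + 1))" by (simp add: power_add)
  also have "\<dots> \<le> real q / 2 ^ q * (3 / 4) ^ j" by (intro mult_left_mono g) auto
  also have "\<dots> \<le> real q / 2 ^ q * ((7 / 8)\<^sup>2) ^ j"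
    by (intro mult_left_mono power_mono) (auto simp: power2_eq_square)
  also have "\<dots> = real q / 2 ^ q * ((7 / 8) ^ j)\<^sup>2" by (simp add: power_mult[symmetric] mult.commute)
  finally have "sqrt (real (q + j + 1) / 2 ^ (q + j + 1)) \<le> sqrt (real q / 2 ^ q * ((7 / 8) ^ j)\<^sup>2)"
    by (rule real_sqrt_le_mono)
  then show ?thesis by (simp only: real_sqrt_mult real_sqrt_abs) simp
qed

text \<open>Reach t through its lower dyadic approximations: one level adds at most one grid
  increment, of size at most 2 (7/8)^j times sqrt(q / 2^q). The series sums to 2 / (1 - 7/8) = 16,
  the constant in \<open>dyadic_modulus\<close>.\<close>

lemma dyadic_modulus_chaining:
  assumes cont: "continuous_on {0..1} x"
    and inc: "\<And>m k. q \<le> m \<Longrightarrow> k < 2 ^ m \<Longrightarrow> \<bar>x (dy m (Suc k)) - x (dy m k)\<bar> \<le> 2 * sqrt (real m / 2 ^ m)"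
    and q: "1 \<le> q"
  shows "dyadic_modulus x q"
  unfolding dyadic_modulus_def
proof (intro allI impI ballI)
  fix k t assume k: "k < 2 ^ q" and t: "t \<in> {dy q k..dy q (Suc k)}"
  let ?S = "sqrt (real q / 2 ^ q)"
  have S0: "0 \<le> ?S" by simp
  have k1: "dy q (Suc k) \<le> 1" using k by (intro dy_le_1) auto
  show "\<bar>x t - x (dy q k)\<bar> \<le> 16 * ?S"
  proof (cases "t = dy q (Suc k)")
    case True
    then have "\<bar>x t - x (dy q k)\<bar> \<le> 2 * ?S" using inc[OF order_refl k] by simp
    then show ?thesis using S0 by linarith
  next
    case False
    then have t1: "dy q k \<le> t" "t < dy q (Suc k)" using t by auto
    have t0: "0 \<le> t" by (rule order_trans[OF dy_nonneg t1(1)])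
    have tlt: "t < 1" by (rule less_le_trans[OF t1(2) k1])
    define a where "a m = nat \<lfloor>t * 2 ^ m\<rfloor>" for m
    have aq: "a q = k" unfolding a_def by (rule nat_floor_dyadic[OF t1])
    have step: "\<bar>x (dy (Suc m) (a (Suc m))) - x (dy m (a m))\<bar> \<le> 2 * sqrt (real (Suc m) / 2 ^ Suc m)" if "q \<le> m" for m
    proof -
      have d: "a (Suc m) div 2 = a m" unfolding a_def using nat_floor_dyadic_div[OF t0, of m 1] by simp
      have e: "dy m (a m) = dy (Suc m) (a m * 2)" using dy_refine[of m 1 "a m"] by simp
      have lt: "a (Suc m) < 2 ^ Suc m" unfolding a_def by (rule dyadic_floor_less[OF t0 tlt])
      consider "a (Suc m) = a m * 2" | "a (Suc m) = Suc (a m * 2)" using d by linarith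
      then show ?thesis
      proof cases
        case 1 then show ?thesis by (simp add: e)
      next
        case 2 then show ?thesis using inc[of "Suc m" "a m * 2"] lt that by (simp add: e)
      qed
    qed
    have "\<bar>x (dy (q + n) (a (q + n))) - x (dy q k)\<bar> \<le> 16 * ?S * (1 - (7 / 8) ^ n)" for n
    proof (induction n)
      case (Suc n)
      have "\<bar>x (dy (q + Suc n) (a (q + Suc n))) - x (dy (q + n) (a (q + n)))\<bar> \<le> 2 * sqrt (real (q + n + 1) / 2 ^ (q + n + 1))"
        using step[of "q + n"] by simp
      also have "\<dots> \<le> 2 * (?S * (7 / 8) ^ n)" using chaining_series_bound[OF q, of n] by simp
      finally have "\<bar>x (dy (q + Suc n) (a (q + Suc n))) - x (dy q k)\<bar> \<le> 2 * (?S * (7 / 8) ^ n) + 16 * ?S * (1 - (7 / 8) ^ n)"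
        using Suc by linarith
      also have "\<dots> = 16 * ?S * (1 - (7 / 8) ^ Suc n)" by (simp add: algebra_simps)
      finally show ?case .
    qed (simp add: aq)
    moreover have "16 * ?S * (1 - (7 / 8) ^ n) \<le> 16 * ?S * 1" for n
      by (rule mult_left_mono) auto
    ultimately have bd: "\<bar>x (dy (q + n) (a (q + n))) - x (dy q k)\<bar> \<le> 16 * ?S" for n
      by (simp only: mult_1_right) (rule order_trans)
    have "(\<lambda>m. dy m (a m)) \<longlonglongrightarrow> t" unfolding a_def by (rule dyadic_floor_tendsto[OF t0])
    then have "(\<lambda>n. dy (n + q) (a (n + q))) \<longlonglongrightarrow> t" by (rule LIMSEQ_ignore_initial_segment)
    then have "(\<lambda>n. dy (q + n) (a (q + n))) \<longlonglongrightarrow> t" by (simp add: add.commute)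
    moreover have "dy m (a m) \<in> {0..1}" for m
      using dyadic_floor_less[OF t0 tlt, of m] by (auto simp: a_def intro: dy_le_1)
    ultimately have "(\<lambda>n. x (dy (q + n) (a (q + n)))) \<longlonglongrightarrow> x t"
      using t0 tlt by (intro continuous_on_tendsto_compose[OF cont]) auto
    then have "(\<lambda>n. \<bar>x (dy (q + n) (a (q + n))) - x (dy q k)\<bar>) \<longlonglongrightarrow> \<bar>x t - x (dy q k)\<bar>"
      by (intro tendsto_intros)
    then show ?thesis by (rule LIMSEQ_le_const2) (use bd in auto)
  qed
qed

lemma dyadic_modulus_grid:
  assumes "dyadic_modulus x q" "i \<le> j" "j \<le> 2 ^ q"
  shows "\<bar>x (dy q j) - x (dy q i)\<bar> \<le> 16 * real (j - i) * sqrt (real q / 2 ^ q)"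
  using assms(2,3)
proof (induction j rule: dec_induct)
  case (step n)
  have "\<bar>x (dy q (Suc n)) - x (dy q n)\<bar> \<le> 16 * sqrt (real q / 2 ^ q)"
    using assms(1)[unfolded dyadic_modulus_def, rule_format, of n "dy q (Suc n)"] step.prems by simp
  moreover have "16 * real (Suc n - i) * sqrt (real q / 2 ^ q) = 16 * real (n - i) * sqrt (real q / 2 ^ q) + 16 * sqrt (real q / 2 ^ q)"
    using step.hyps by (simp add: Suc_diff_le algebra_simps)
  moreover have "\<bar>x (dy q n) - x (dy q i)\<bar> \<le> 16 * real (n - i) * sqrt (real q / 2 ^ q)"
    using step by simp
  ultimately show ?case by linarith
qed simp

lemma dyadic_modulus_near:
  assumes mod: "dyadic_modulus x q" and "dy q i \<le> t" "t \<le> dy q (i + m)" "t \<le> 1" and i: "i \<le> 2 ^ q"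
  shows "\<bar>x t - x (dy q i)\<bar> \<le> 16 * real (m + 1) * sqrt (real q / 2 ^ q)"
proof -
  have t0: "0 \<le> t" by (rule order_trans[OF dy_nonneg assms(2)])
  define l where "l = nat \<lfloor>t * 2 ^ q\<rfloor>"
  have l: "dy q l \<le> t" "t < dy q (Suc l)" unfolding l_def using dyadic_floor_bounds[OF t0] by auto
  have il: "i \<le> l" "l \<le> i + m"
    using le_less_trans[OF assms(2) l(2)] order_trans[OF l(1) assms(3)] by simp_all
  have "dy q l \<le> 1" using l(1) assms(4) by (rule order_trans)
  then have lq: "l \<le> 2 ^ q" by (simp add: dy_def divide_le_eq)
  have 1: "\<bar>x t - x (dy q l)\<bar> \<le> 16 * sqrt (real q / 2 ^ q)"
  proof (cases "l < 2 ^ q")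
    case True
    then show ?thesis using mod l unfolding dyadic_modulus_def by auto
  next
    case False
    then have "l = 2 ^ q" using lq by simp
    then have "dy q l = 1" by (simp add: dy_def)
    then have "t = dy q l" using l(1) assms(4) by simp
    then show ?thesis by simp
  qed
  have "\<bar>x (dy q l) - x (dy q i)\<bar> \<le> 16 * real (l - i) * sqrt (real q / 2 ^ q)"
    by (rule dyadic_modulus_grid[OF mod il(1) lq])
  also have "\<dots> \<le> 16 * real m * sqrt (real q / 2 ^ q)" using il by (intro mult_right_mono) auto
  finally have "\<bar>x t - x (dy q i)\<bar> \<le> 16 * real m * sqrt (real q / 2 ^ q) + 16 * sqrt (real q / 2 ^ q)"
    using 1 by linarith
  then show ?thesis by (simp add: algebra_simps)
qed

text \<open>An increment over a cell of level m exceeds 2 sqrt(m / 2^m) with probability at most 2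
  exp(-2 m). Over 2^m cells this is a geometric series, because 2 exp(-2) < 1, and the
  Borel-Cantelli lemma applies.\<close>

lemma (in brownian) AE_dyadic_modulus:
  "AE \<omega> in M. \<exists>q0. \<forall>q\<ge>q0. dyadic_modulus (X \<omega>) q"
proof -
  define A where "A m = (\<Union>k<(2::nat) ^ m. {\<omega>\<in>space M. 2 * sqrt (real m / 2 ^ m) \<le> \<bar>X \<omega> (dy m (Suc k)) - X \<omega> (dy m k)\<bar>})" for m
  have Xm: "(\<lambda>\<omega>. X \<omega> (dy m k)) \<in> borel_measurable M" if "k \<le> 2 ^ m" for m k
    using that by (intro X_measurable) (auto intro: dy_le_1)
  have ev: "{\<omega>\<in>space M. 2 * sqrt (real m / 2 ^ m) \<le> \<bar>X \<omega> (dy m (Suc k)) - X \<omega> (dy m k)\<bar>} \<in> events" if "k < 2 ^ m" for m k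
  proof -
    have [measurable]: "(\<lambda>\<omega>. X \<omega> (dy m (Suc k))) \<in> borel_measurable M" "(\<lambda>\<omega>. X \<omega> (dy m k)) \<in> borel_measurable M"
      using that by (auto intro!: Xm)
    show ?thesis by measurable
  qed
  have Am[measurable]: "A m \<in> events" for m unfolding A_def using ev by (intro sets.finite_UN) auto
  have bound: "prob (A m) \<le> 2 * (2 * exp (- 2)) ^ m" for m
  proof -
    have "prob (A m) \<le> (\<Sum>k<(2::nat) ^ m. prob {\<omega>\<in>space M. 2 * sqrt (real m / 2 ^ m) \<le> \<bar>X \<omega> (dy m (Suc k)) - X \<omega> (dy m k)\<bar>})"
      unfolding A_def by (rule measure_UNION_le) (use ev in auto)
    also have "\<dots> \<le> (\<Sum>k<(2::nat) ^ m. 2 * exp (- 2 * real m))"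
    proof (rule sum_mono)
      fix k assume k: "k \<in> {..<(2::nat) ^ m}"
      have "prob {\<omega>\<in>space M. 2 * sqrt (real m / 2 ^ m) \<le> \<bar>X \<omega> (dy m (Suc k)) - X \<omega> (dy m k)\<bar>}
        \<le> 2 * exp (- (2 * sqrt (real m / 2 ^ m))\<^sup>2 / (2 * (dy m (Suc k) - dy m k)))"
        using k by (intro increment_tail) (auto intro!: dy_le_1)
      also have "- (2 * sqrt (real m / 2 ^ m))\<^sup>2 / (2 * (dy m (Suc k) - dy m k)) = - 2 * real m"
        by (simp add: dy_Suc power_mult_distrib)
      finally show "prob {\<omega>\<in>space M. 2 * sqrt (real m / 2 ^ m) \<le> \<bar>X \<omega> (dy m (Suc k)) - X \<omega> (dy m k)\<bar>} \<le> 2 * exp (- 2 * real m)" .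
    qed
    also have "\<dots> = 2 * (2 * exp (- 2)) ^ m"
      by (simp add: power_mult_distrib exp_of_nat_mult[symmetric] mult.commute)
    finally show ?thesis .
  qed
  have "summable (\<lambda>m. 2 * (2 * exp (- 2 :: real)) ^ m)"
  proof (intro summable_mult summable_geometric)
    have "(3::real) \<le> exp 2" using exp_ge_add_one_self[of "2::real"] by simp
    then have "exp (- 2 :: real) \<le> 1 / 3" by (simp add: exp_minus field_simps)
    then show "norm (2 * exp (- 2 :: real)) < 1" by simp
  qed
  then have "summable (\<lambda>m. prob (A m))"
    by (rule summable_comparison_test_ev[rotated]) (use bound in auto)
  then have "AE \<omega> in M. eventually (\<lambda>m. \<omega> \<in> space M - A m) sequentially"
    by (intro borel_cantelli_AE1) (auto simp: emeasure_eq_measure)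
  then show ?thesis using AE_continuous
  proof eventually_elim
    case (elim \<omega>)
    then obtain m0 where m0: "\<And>m. m0 \<le> m \<Longrightarrow> \<omega> \<in> space M - A m" by (auto simp: eventually_sequentially)
    show ?case
    proof (intro exI allI impI)
      fix q assume q: "max 1 m0 \<le> q"
      show "dyadic_modulus (X \<omega>) q"
      proof (rule dyadic_modulus_chaining[OF elim(2)])
        fix m k assume "q \<le> m" "k < (2::nat) ^ m"
        then show "\<bar>X \<omega> (dy m (Suc k)) - X \<omega> (dy m k)\<bar> \<le> 2 * sqrt (real m / 2 ^ m)"
          using m0[of m] q by (auto simp: A_def not_le less_imp_le)
      qed (use q in simp)
    qed
  qed
qed

section \<open>Upper bound for the Hausdorff dimension\<close>

text \<open>The levels from Q on already cover E, and they cost a tail of the convergent series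
  while their diameters tend to 0.\<close>

lemma hausdorff_measure_zero_dyadic_cover:
  assumes s: "0 < s"
    and cover: "\<And>Q. E \<subseteq> (\<Union>q\<in>{Q..}. \<Union>i\<in>F q. {dy q i..dy q (Suc i)})"
    and fin: "\<And>q. finite (F q)"
    and sum: "summable (\<lambda>q. real (card (F q)) * 2 powr (- s * real q))"
  shows "hausdorff_measure s E = 0"
proof -
  have pre0: "hausdorff_premeasure s \<delta> E \<le> ennreal \<epsilon>" if \<delta>: "0 < \<delta>" and \<epsilon>: "0 < \<epsilon>" for \<delta> \<epsilon>
  proof -
    define g where "g q = real (card (F q)) * 2 powr (- s * real q)" for q
    have g0: "0 \<le> g q" for q by (simp add: g_def)
    have sg: "summable g" using sum by (simp add: g_def[abs_def])
    obtain n0 where n0: "(1/2::real) ^ n0 < \<delta>" using real_arch_pow_inv[OF \<delta>, of "1/2"] by auto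
    obtain N where N: "\<And>n. N \<le> n \<Longrightarrow> norm (\<Sum>i. g (i + n)) < \<epsilon>"
      using suminf_exist_split[OF \<epsilon> sg] by blast
    define Q where "Q = max N n0"
    define U where "U n = (case prod_decode n of (q, i) \<Rightarrow> if Q \<le> q \<and> i \<in> F q then {dy q i..dy q (Suc i)} else {})" for n
    have Ue: "U (prod_encode (q, i)) = (if Q \<le> q \<and> i \<in> F q then {dy q i..dy q (Suc i)} else {})" for q i
      by (simp add: U_def)
    have diamU: "diameter (U n) \<le> \<delta> \<and> bounded (U n)" for n
    proof -
      obtain q i where n: "n = prod_encode (q, i)" by (metis prod_decode_inverse surj_pair)
      have "1 / 2 ^ q \<le> \<delta>" if "Q \<le> q"
      proof -
        have "(1/2::real) ^ q \<le> (1/2) ^ n0" using that by (intro power_decreasing) (auto simp: Q_def)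
        then show ?thesis using n0 by (simp add: power_one_over)
      qed
      then show ?thesis using \<delta> by (simp add: n Ue dy_Suc)
    qed
    have "E \<subseteq> (\<Union>n. U n)"
    proof
      fix x assume "x \<in> E"
      then obtain q i where "Q \<le> q" "i \<in> F q" "x \<in> {dy q i..dy q (Suc i)}" using cover[of Q] by auto
      then have "x \<in> U (prod_encode (q, i))" by (simp add: Ue)
      then show "x \<in> (\<Union>n. U n)" by blast
    qed
    then have "hausdorff_premeasure s \<delta> E \<le> (\<Sum>n. ennreal (diameter (U n) powr s))"
      unfolding hausdorff_premeasure_def using diamU by (intro INF_lower) auto
    also have "\<dots> = (\<Sum>n. (\<lambda>(q, i). if Q \<le> q \<and> i \<in> F q then ennreal (2 powr (- s * real q)) else 0) (prod_decode n))"
    proof (intro suminf_cong)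
      fix n
      obtain q i where n: "n = prod_encode (q, i)" by (metis prod_decode_inverse surj_pair)
      have "(1 / 2 ^ q) powr s = 2 powr (- s * real q)"
        by (simp add: powr_realpow[symmetric] powr_minus_divide[symmetric] powr_powr mult.commute)
      then show "ennreal (diameter (U n) powr s) = (\<lambda>(q, i). if Q \<le> q \<and> i \<in> F q then ennreal (2 powr (- s * real q)) else 0) (prod_decode n)"
        by (simp add: n Ue dy_Suc)
    qed
    also have "\<dots> = (\<Sum>q. if Q \<le> q then ennreal (g q) else 0)"
    proof (rule suminf_ennreal_2dimen)
      fix q
      have "(\<Sum>i. if Q \<le> q \<and> i \<in> F q then ennreal (2 powr (- s * real q)) else 0)
          = (\<Sum>i\<in>F q. if Q \<le> q \<and> i \<in> F q then ennreal (2 powr (- s * real q)) else 0)"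
        by (rule suminf_finite[OF fin]) auto
      also have "\<dots> = (if Q \<le> q then ennreal (g q) else 0)"
        by (simp add: g_def ennreal_mult ennreal_of_nat_eq_real_of_nat)
      finally show "(if Q \<le> q then ennreal (g q) else 0) = (\<Sum>i. (\<lambda>(q, i). if Q \<le> q \<and> i \<in> F q then ennreal (2 powr (- s * real q)) else 0) (q, i))"
        by simp
    qed
    also have "\<dots> = (\<Sum>q. if Q \<le> q + Q then ennreal (g (q + Q)) else 0)"
      using suminf_offset[of "\<lambda>q. if Q \<le> q then ennreal (g q) else 0" Q] by (simp add: summableI)
    also have "\<dots> = ennreal (\<Sum>q. g (q + Q))"
      using sg g0 by (simp add: suminf_ennreal2 summable_iff_shift)
    also have "\<dots> \<le> ennreal \<epsilon>" using N[of Q] by (intro ennreal_leI) (auto simp: Q_def abs_less_iff)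
    finally show ?thesis .
  qed
  have "hausdorff_premeasure s \<delta> E = 0" if "0 < \<delta>" for \<delta>
  proof -
    have "hausdorff_premeasure s \<delta> E \<le> 0"
      by (rule ennreal_le_epsilon) (use pre0[OF that] in auto)
    then show ?thesis by simp
  qed
  then show ?thesis unfolding hausdorff_measure_def by simp
qed

text \<open>The expected number of flagged cells of level q is at most C 2^((1 - \<beta>) q), so the
  expectation of the series beyond q0 is a convergent geometric series.\<close>

lemma (in prob_space) AE_summable_flags:
  fixes F :: "nat \<Rightarrow> nat \<Rightarrow> 'a set"
  assumes F: "\<And>q i. i < 2 ^ q \<Longrightarrow> F q i \<in> events"
    and P: "\<And>q i. q0 \<le> q \<Longrightarrow> i < 2 ^ q \<Longrightarrow> prob (F q i) \<le> C * 2 powr (- \<beta> * real q)"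
    and s: "1 < s + \<beta>"
  shows "AE \<omega> in M. summable (\<lambda>q. real (card {i. i < 2 ^ q \<and> \<omega> \<in> F q i}) * 2 powr (- s * real q))"
proof -
  define Z where "Z q \<omega> = (\<Sum>i<2 ^ q. indicator (F q i) \<omega> :: real) * 2 powr (- s * real q)" for q :: nat and \<omega>
  have Zm[measurable]: "Z q \<in> borel_measurable M" for q
    unfolding Z_def[abs_def] using F by (intro borel_measurable_times borel_measurable_sum borel_measurable_indicator) auto
  have Z0: "0 \<le> Z q \<omega>" for q \<omega> by (simp add: Z_def sum_nonneg)
  have Zint: "(\<integral>\<^sup>+\<omega>. ennreal (Z q \<omega>) \<partial>M) = ennreal ((\<Sum>i<2 ^ q. prob (F q i)) * 2 powr (- s * real q))" for q
  proof -
    have "(\<integral>\<^sup>+\<omega>. ennreal (Z q \<omega>) \<partial>M) = ennreal (\<integral>\<omega>. Z q \<omega> \<partial>M)"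
      unfolding Z_def using F by (intro nn_integral_eq_integral) (auto simp: sum_nonneg emeasure_eq_measure)
    also have "(\<integral>\<omega>. Z q \<omega> \<partial>M) = (\<Sum>i<2 ^ q. prob (F q i)) * 2 powr (- s * real q)"
      unfolding Z_def using F by (simp add: emeasure_eq_measure)
    finally show ?thesis .
  qed
  have "(\<integral>\<^sup>+\<omega>. (\<Sum>q. ennreal (Z (q + q0) \<omega>)) \<partial>M) = (\<Sum>q. \<integral>\<^sup>+\<omega>. ennreal (Z (q + q0) \<omega>) \<partial>M)"
    by (rule nn_integral_suminf) measurable
  also have "\<dots> \<le> (\<Sum>q. ennreal (C * 2 powr ((1 - s - \<beta>) * real (q + q0))))"
    unfolding Zint
  proof (intro suminf_le allI ennreal_leI)
    fix q
    have "(\<Sum>i<(2::nat) ^ (q + q0). prob (F (q + q0) i)) \<le> (\<Sum>i<(2::nat) ^ (q + q0). C * 2 powr (- \<beta> * real (q + q0)))"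
      by (intro sum_mono P) auto
    also have "\<dots> = C * (2 powr real (q + q0) * 2 powr (- \<beta> * real (q + q0)))" by (simp add: powr_realpow flip: of_nat_add)
    finally have "(\<Sum>i<(2::nat) ^ (q + q0). prob (F (q + q0) i)) * 2 powr (- s * real (q + q0))
       \<le> C * (2 powr real (q + q0) * 2 powr (- \<beta> * real (q + q0))) * 2 powr (- s * real (q + q0))"
      by (intro mult_right_mono) auto
    also have "\<dots> = C * 2 powr ((1 - s - \<beta>) * real (q + q0))"
      by (simp add: mult.assoc powr_add[symmetric] algebra_simps)
    finally show "(\<Sum>i<2 ^ (q + q0). prob (F (q + q0) i)) * 2 powr (- s * real (q + q0)) \<le> C * 2 powr ((1 - s - \<beta>) * real (q + q0))" .
  qed auto
  also have "\<dots> < \<infinity>"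
  proof -
    have "prob (F q0 0) \<le> C * 2 powr (- \<beta> * real q0)" by (rule P) auto
    then have "0 \<le> C * 2 powr (- \<beta> * real q0)" using measure_nonneg order_trans by blast
    then have C0: "0 \<le> C" by (simp add: zero_le_mult_iff)
    have "(2::real) powr (1 - s - \<beta>) < 2 powr 0" using s by (intro powr_less_mono) auto
    then have "summable (\<lambda>q. C * ((2 powr (1 - s - \<beta>)) ^ (q + q0)))"
      by (subst summable_iff_shift[of "\<lambda>q. C * (2 powr (1 - s - \<beta>)) ^ q" q0]) (intro summable_mult summable_geometric, simp)
    then have "summable (\<lambda>q. C * 2 powr ((1 - s - \<beta>) * real (q + q0)))"
      by (simp only: powr_powr[symmetric] powr_realpow powr_gt_zero)
    then have "(\<Sum>q. ennreal (C * 2 powr ((1 - s - \<beta>) * real (q + q0)))) = ennreal (\<Sum>q. C * 2 powr ((1 - s - \<beta>) * real (q + q0)))"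
      using C0 by (intro suminf_ennreal2) auto
    then show ?thesis by simp
  qed
  finally have "AE \<omega> in M. (\<Sum>q. ennreal (Z (q + q0) \<omega>)) \<noteq> \<infinity>"
    by (intro nn_integral_PInf_AE) auto
  then show ?thesis
  proof eventually_elim
    case (elim \<omega>)
    have "summable (\<lambda>q. Z (q + q0) \<omega>)"
      by (rule summable_suminf_not_top) (use elim Z0 in auto)
    then have "summable (\<lambda>q. Z q \<omega>)" by (subst (asm) summable_iff_shift)
    moreover have "Z q \<omega> = real (card {i. i < 2 ^ q \<and> \<omega> \<in> F q i}) * 2 powr (- s * real q)" for q
    proof -
      have "(\<Sum>i<2 ^ q. indicator (F q i) \<omega> :: real) = (\<Sum>i\<in>{i. i < 2 ^ q \<and> \<omega> \<in> F q i}. 1)"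
        by (rule sum.mono_neutral_cong_right) (auto simp: indicator_def)
      then show ?thesis by (simp add: Z_def)
    qed
    ultimately show ?case by simp
  qed
qed

section \<open>Rapid points force large grid increments\<close>

lemma rapid_points_frequently:
  assumes t: "t \<in> rapid_points f x" and \<epsilon>: "0 < \<epsilon>" and h0: "0 < h0"
  obtains h where "0 < h" "h < h0" "h \<le> 1 - t"
    "\<And>s. s \<in> {0..1} \<Longrightarrow> \<bar>(x (t + s * h) - x t) / sqrt (2 * h * ln (inverse h)) - f s\<bar> < \<epsilon>"
proof -
  define g where "g h = (SUP s\<in>{0..1}. ereal \<bar>(x (t + s * h) - x t) / sqrt (2 * h * ln (inverse h)) - f s\<bar>)" for h
  have L: "Liminf (at 0 within {0<..1 - t}) g = 0"
    using t by (simp add: rapid_points_def g_def[abs_def])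
  have "\<not> eventually (\<lambda>h. ereal \<epsilon> \<le> g h) (at 0 within {0<..1 - t})"
  proof
    assume "eventually (\<lambda>h. ereal \<epsilon> \<le> g h) (at 0 within {0<..1 - t})"
    then have "ereal \<epsilon> \<le> Liminf (at 0 within {0<..1 - t}) g" by (rule Liminf_bounded)
    then show False using L \<epsilon> by simp
  qed
  then obtain h where h: "h \<in> {0<..1 - t}" "dist h 0 < h0" "\<not> ereal \<epsilon> \<le> g h"
    using h0 unfolding eventually_at by auto
  show thesis
  proof (rule that[of h])
    fix s :: real assume s: "s \<in> {0..1}"
    have "ereal \<bar>(x (t + s * h) - x t) / sqrt (2 * h * ln (inverse h)) - f s\<bar> \<le> g h"
      unfolding g_def by (rule SUP_upper[OF s])
    also have "\<dots> < ereal \<epsilon>" using h(3) by simp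
    finally show "\<bar>(x (t + s * h) - x t) / sqrt (2 * h * ln (inverse h)) - f s\<bar> < \<epsilon>" by simp
  qed (use h in auto)
qed

text \<open>The function u ln(1/u) increases on (0, 1/e], and the last hypothesis says that h is at
  most 1/e. It allows the window length to be rounded down: the threshold for the increments only
  becomes smaller.\<close>

lemma mult_ln_inverse_mono:
  fixes g h :: real
  assumes "0 < g" "g \<le> h" "1 \<le> ln (1 / h)"
  shows "g * ln (1 / g) \<le> h * ln (1 / h)"
proof -
  have h: "0 < h" using assms by linarith
  have "ln (h / g) \<le> h / g - 1" using assms h by (intro ln_le_minus_one) simp
  then have "g * ln (h / g) \<le> g * (h / g - 1)" using assms by (intro mult_left_mono) auto
  also have "\<dots> = h - g" using assms by (simp add: field_simps)
  also have "\<dots> \<le> (h - g) * ln (1 / h)" using assms mult_left_mono[of 1 "ln (1 / h)" "h - g"] by simp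
  finally have "g * ln (h / g) \<le> (h - g) * ln (1 / h)" .
  moreover have "ln (1 / g) = ln (1 / h) + ln (h / g)" using assms h by (simp add: ln_div)
  ultimately show ?thesis by (simp add: algebra_simps)
qed

text \<open>\<open>q\<close> is the resolution, \<open>i\<close> the cell containing the point and \<open>n j / 2\<^sup>q\<close> the time
  window rounded down to a multiple of \<open>n\<close> grid steps.\<close>

lemma rapid_point_flag:
  fixes n R :: nat
  assumes n: "1 \<le> n" and \<epsilon>: "0 < \<epsilon>" and R: "2 * (32 * (real n + 2) / \<epsilon>)\<^sup>2 \<le> real R" "1 \<le> R"
    and mod: "\<forall>q\<ge>q0. dyadic_modulus x q"
    and t: "t \<in> rapid_points f x"
  obtains q i j where "Q \<le> q" "i < 2 ^ q" "R \<le> j" "j < 2 * R" "i + n * j \<le> 2 ^ q" "t \<in> {dy q i..dy q (Suc i)}"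
    "\<forall>k<n. sqrt (2 * dy q (n * j) * ln (1 / dy q (n * j))) * max 0 (\<bar>f (real (Suc k) / n) - f (real k / n)\<bar> - 3 * \<epsilon>)
       \<le> \<bar>x (dy q (i + Suc k * j)) - x (dy q (i + k * j))\<bar>"
proof -
  have t01: "0 \<le> t" "t < 1" using t by (auto simp: rapid_points_def)
  define N where "N = real R * real n"
  have N: "1 \<le> N" unfolding N_def using n R(2) mult_mono[of 1 "real R" 1 "real n"] by simp
  \<comment> \<open>For q >= c the logarithm ln(1/h) >= q ln 2 - ln(2 N) is at least q / 4.\<close>
  obtain c :: nat where c: "4 * ln (2 * N) \<le> real c" using real_arch_simple by blast
  define q1 where "q1 = max (max Q q0) (max 4 c)"
  have q1: "Q \<le> q1" "q0 \<le> q1" "4 \<le> q1" "c \<le> q1"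
    by (simp_all add: q1_def)
  have q1': "4 * ln (2 * N) \<le> real q1" using c q1(4) by linarith
  obtain h where h: "0 < h" "h < N / 2 ^ q1" "h \<le> 1 - t"
    and hs: "\<And>s. s \<in> {0..1} \<Longrightarrow> \<bar>(x (t + s * h) - x t) / sqrt (2 * h * ln (inverse h)) - f s\<bar> < \<epsilon>"
    using rapid_points_frequently[OF t \<epsilon>, of "N / 2 ^ q1"] N by auto
  define d where "d = h / N"
  have d: "0 < d" "d < (1/2) ^ q1" using h N by (auto simp: d_def power_one_over field_simps)
  have ex: "\<exists>q. (1/2) ^ q \<le> d" using real_arch_pow_inv[OF d(1), of "1/2"] by (auto intro: less_imp_le)
  \<comment> \<open>Minimality gives N <= h 2^q < 2 N with N = R n. Hence the step h 2^q / n,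
    measured in grid cells, lies in [R, 2 R), and its integer part j takes only R values whatever h
    is.\<close>
  define q where "q = (LEAST q. (1/2) ^ q \<le> d)"
  have qd: "(1/2) ^ q \<le> d" unfolding q_def using ex by (rule LeastI_ex)
  have "q1 < q"
  proof (rule ccontr)
    assume "\<not> q1 < q"
    then have "(1/2::real) ^ q1 \<le> (1/2) ^ q" by (intro power_decreasing) auto
    then show False using qd d by linarith
  qed
  then obtain q' where q': "q = Suc q'" by (cases q) auto
  have "\<not> (1/2) ^ q' \<le> d" using not_less_Least[of q' "\<lambda>q. (1/2) ^ q \<le> d"] q' by (simp add: q_def[symmetric])
  then have dq: "d < 2 * (1/2) ^ q" by (simp add: q')
  have q: "Q \<le> q" "q0 \<le> q" "4 \<le> q" "4 * ln (2 * N) \<le> real q" using q1(1-3) q1' \<open>q1 < q\<close> by auto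
  have hq: "N / 2 ^ q \<le> h" "h < 2 * N / 2 ^ q"
    using qd dq N by (auto simp: d_def power_one_over field_simps)
  define y where "y = h * 2 ^ q / real n"
  have nR: "0 < real n" using n by simp
  have y: "real R \<le> y" "y < 2 * real R"
    using hq nR by (auto simp: y_def N_def field_simps)
  define j where "j = nat \<lfloor>y\<rfloor>"
  have j: "real j \<le> y" "y < real j + 1" using y unfolding j_def by linarith+
  have jR: "R \<le> j" "j < 2 * R" using y j by linarith+
  have j0: "0 < j" using jR R by linarith
  define i where "i = nat \<lfloor>t * 2 ^ q\<rfloor>"
  have i: "dy q i \<le> t" "t < dy q (Suc i)" "i < 2 ^ q"
    unfolding i_def using dyadic_floor_bounds[OF t01(1)] dyadic_floor_less[OF t01] by auto
  define L where "L = ln (1 / h)"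
  have Lq: "real q / 4 \<le> L"
  proof -
    have "2 ^ q / (2 * N) \<le> 1 / h" using hq(2) h(1) N by (simp add: field_simps)
    then have "ln (2 ^ q / (2 * N)) \<le> L" unfolding L_def using N h by (subst ln_le_cancel_iff) auto
    moreover have "ln (2 ^ q / (2 * N)) = real q * ln 2 - ln (2 * N)" using N by (simp add: ln_div ln_realpow)
    moreover have "real q * (1 / 2) \<le> real q * ln 2" using ln2_ge_two_thirds by (intro mult_left_mono) auto
    ultimately show ?thesis using q by linarith
  qed
  have L1: "1 \<le> L" using Lq q by linarith
  define D where "D = sqrt (2 * h * L)"
  have D: "0 < D" unfolding D_def using h L1 by simp
  have D2: "D\<^sup>2 = 2 * h * L" unfolding D_def using h L1 by simp
  \<comment> \<open>Moving both ends of an increment to the grid costs 16 (n + 2) sqrt(q / 2^q)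
    each. The size of R makes the sum at most \<epsilon> D, since D^2 is at least (N / 2) (q /
    2^q).\<close>
  have err: "32 * (real n + 2) * sqrt (real q / 2 ^ q) \<le> \<epsilon> * D"
  proof (rule power2_le_imp_le)
    have "real q / 2 ^ q \<le> 2 / N * D\<^sup>2"
    proof -
      have "N / 2 ^ q * (real q / 4) \<le> h * L" using hq Lq h N by (intro mult_mono) auto
      then show ?thesis using N unfolding D2 by (simp add: field_simps)
    qed
    then have "(32 * (real n + 2))\<^sup>2 * (real q / 2 ^ q) \<le> (32 * (real n + 2))\<^sup>2 * (2 / N * D\<^sup>2)"
      by (rule mult_left_mono) simp
    also have "\<dots> = (2 * (32 * (real n + 2))\<^sup>2 / N) * D\<^sup>2" by (simp add: mult_ac)
    also have "\<dots> \<le> \<epsilon>\<^sup>2 * D\<^sup>2"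
    proof (rule mult_right_mono)
      have "2 * (32 * (real n + 2))\<^sup>2 \<le> \<epsilon>\<^sup>2 * real R"
        using R(1) \<epsilon> by (simp add: power_divide field_simps)
      also have "\<dots> \<le> \<epsilon>\<^sup>2 * N" unfolding N_def using n mult_left_mono[of 1 "real n" "real R"] by (intro mult_left_mono) auto
      finally show "2 * (32 * (real n + 2))\<^sup>2 / N \<le> \<epsilon>\<^sup>2" using N by (simp add: field_simps)
    qed simp
    finally show "(32 * (real n + 2) * sqrt (real q / 2 ^ q))\<^sup>2 \<le> (\<epsilon> * D)\<^sup>2"
      by (simp add: power_mult_distrib)
  qed (use \<epsilon> D in simp)
  have scal: "\<bar>(x (t + s * h) - x t) - D * f s\<bar> \<le> \<epsilon> * D" if "s \<in> {0..1}" for s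
  proof -
    have "\<bar>(x (t + s * h) - x t) / D - f s\<bar> < \<epsilon>" using hs[OF that] by (simp add: D_def L_def inverse_eq_divide)
    moreover have "(x (t + s * h) - x t) / D - f s = ((x (t + s * h) - x t) - D * f s) / D" using D by (simp add: field_simps)
    ultimately show ?thesis using D by (simp add: divide_less_eq)
  qed
  have in_le: "i + k * j \<le> 2 ^ q" if k: "k \<le> n" for k
  proof -
    have "real j * real n \<le> h * 2 ^ q" using j(1) nR by (simp add: y_def field_simps)
    have "real (i + k * j) \<le> real i + real j * real n" using k mult_left_mono[of "real k" "real n" "real j"] by (simp add: mult.commute)
    also have "\<dots> \<le> t * 2 ^ q + h * 2 ^ q" using \<open>real j * real n \<le> h * 2 ^ q\<close> i(1) by (intro add_mono) (auto simp: dy_def field_simps)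
    also have "\<dots> = (t + h) * 2 ^ q" by (simp add: algebra_simps)
    also have "\<dots> \<le> 1 * 2 ^ q" using h(3) by (intro mult_right_mono) auto
    finally have "real (i + k * j) \<le> real (2 ^ q)" by simp
    then show ?thesis by (simp only: of_nat_le_iff)
  qed
  have near: "\<bar>x (t + real k / real n * h) - x (dy q (i + k * j))\<bar> \<le> 16 * real (n + 2) * sqrt (real q / 2 ^ q)" if k: "k \<le> n" for k
  proof -
    have kn: "real k / real n \<le> 1" "0 \<le> real k / real n" using k nR by auto
    have e: "real k / real n * h = real k * y / 2 ^ q" using nR by (simp add: y_def)
    have "real k * real j / 2 ^ q \<le> real k * y / 2 ^ q" using j by (intro divide_right_mono mult_left_mono) auto
    then have 1: "dy q (i + k * j) \<le> t + real k / real n * h"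
      unfolding e using i(1) by (simp add: dy_def add_divide_distrib)
    have "real k * y \<le> real k * (real j + 1)" using j by (intro mult_left_mono) auto
    also have "\<dots> \<le> real k * real j + real n" using k by (simp add: algebra_simps)
    finally have "real k * y / 2 ^ q \<le> (real k * real j + real n) / 2 ^ q" by (rule divide_right_mono) simp
    then have 2: "t + real k / real n * h \<le> dy q (i + k * j + (n + 1))"
      unfolding e using i(2) by (simp add: dy_def add_divide_distrib)
    have 3: "t + real k / real n * h \<le> 1" using kn h mult_right_mono[of "real k / real n" 1 h] by simp
    show ?thesis using dyadic_modulus_near[OF mod[rule_format, OF q(2)] 1 2 3 in_le[OF k]] by (simp add: add.commute)
  qed
  show thesis
  proof (rule that[OF q(1) i(3) jR])
    show "i + n * j \<le> 2 ^ q" using in_le[of n] by simp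
    show "t \<in> {dy q i..dy q (Suc i)}" using i by simp
  next
    show "\<forall>k<n. sqrt (2 * dy q (n * j) * ln (1 / dy q (n * j))) * max 0 (\<bar>f (real (Suc k) / n) - f (real k / n)\<bar> - 3 * \<epsilon>)
       \<le> \<bar>x (dy q (i + Suc k * j)) - x (dy q (i + k * j))\<bar>"
    proof (intro allI impI)
    fix k assume k: "k < n"
    let ?\<Delta> = "f (real (Suc k) / n) - f (real k / n)"
    let ?m = "max 0 (\<bar>?\<Delta>\<bar> - 3 * \<epsilon>)"
    have s: "real (Suc k) / n \<in> {0..1}" "real k / n \<in> {0..1}" using k by (auto simp: field_simps)
    have "D * ?\<Delta> = D * f (real (Suc k) / n) - D * f (real k / n)" by (simp add: algebra_simps)
    then have "D * \<bar>?\<Delta>\<bar> = \<bar>D * f (real (Suc k) / n) - D * f (real k / n)\<bar>" using D by (metis abs_mult abs_of_pos)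
    also have "\<dots> \<le> \<bar>x (t + real (Suc k) / n * h) - x (t + real k / n * h)\<bar> + 2 * (\<epsilon> * D)"
      using scal[OF s(1)] scal[OF s(2)] by linarith
    also have "\<bar>x (t + real (Suc k) / n * h) - x (t + real k / n * h)\<bar>
       \<le> \<bar>x (dy q (i + Suc k * j)) - x (dy q (i + k * j))\<bar> + 32 * (real n + 2) * sqrt (real q / 2 ^ q)"
    proof -
      have "\<bar>v' - v\<bar> \<le> \<bar>u' - u\<bar> + 2 * b" if "\<bar>v - u\<bar> \<le> b" "\<bar>v' - u'\<bar> \<le> b" for u v u' v' b :: real
        using that by linarith
      from this[OF near[of k] near[of "Suc k"]] show ?thesis using k by (simp add: algebra_simps)
    qed
    \<comment> \<open>The loss 3 \<epsilon> in the statement: \<epsilon> from the approximation at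
      each end of the step and \<epsilon> from the discretisation.\<close>
    finally have "D * \<bar>?\<Delta>\<bar> \<le> \<bar>x (dy q (i + Suc k * j)) - x (dy q (i + k * j))\<bar> + \<epsilon> * D + 2 * (\<epsilon> * D)"
      using err by linarith
    then have "D * (\<bar>?\<Delta>\<bar> - 3 * \<epsilon>) \<le> \<bar>x (dy q (i + Suc k * j)) - x (dy q (i + k * j))\<bar>"
      by (simp add: algebra_simps)
    then have main: "D * ?m \<le> \<bar>x (dy q (i + Suc k * j)) - x (dy q (i + k * j))\<bar>"
      by (cases "\<bar>?\<Delta>\<bar> - 3 * \<epsilon> \<le> 0") (auto simp: max_def)
    define g where "g = dy q (n * j)"
    have g0: "0 < g" using n j0 by (simp add: g_def dy_def)
    have gh: "g \<le> h" using j(1) nR by (simp add: g_def dy_def y_def field_simps)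
    have "g * ln (1 / g) \<le> h * ln (1 / h)"
      by (rule mult_ln_inverse_mono[OF g0 gh]) (use L1 in \<open>simp add: L_def\<close>)
    then have "sqrt (2 * g * ln (1 / g)) \<le> D" unfolding D_def L_def by (intro real_sqrt_le_mono) simp
    then have "sqrt (2 * g * ln (1 / g)) * ?m \<le> D * ?m" by (intro mult_right_mono) auto
    then show "sqrt (2 * dy q (n * j) * ln (1 / dy q (n * j))) * ?m \<le> \<bar>x (dy q (i + Suc k * j)) - x (dy q (i + k * j))\<bar>"
      using main unfolding g_def by (rule order_trans)
    qed
  qed
qed

context brownian
begin

definition large_increments :: "nat \<Rightarrow> (nat \<Rightarrow> real) \<Rightarrow> nat \<Rightarrow> nat \<Rightarrow> nat \<Rightarrow> 'w set" where
  "large_increments n c q i j = {\<omega>\<in>space M. \<forall>k<n.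
     sqrt (2 * dy q (n * j) * ln (1 / dy q (n * j))) * c k \<le> \<bar>X \<omega> (dy q (i + Suc k * j)) - X \<omega> (dy q (i + k * j))\<bar>}"

text \<open>The n steps are disjoint, hence independent, and each has variance g / n, where g is the
  window length. The tail exponent of step k is therefore ln(1/g) n (c k)^2, the two-sided tails
  give 2^n, and the product is a power of g whose exponent is the n-step energy.\<close>

lemma
  assumes n: "1 \<le> n" and j: "1 \<le> j" and le: "i + n * j \<le> 2 ^ q" and c: "\<And>k. k < n \<Longrightarrow> 0 \<le> c k"
  shows large_increments_events: "large_increments n c q i j \<in> events"
    and large_increments_prob: "prob (large_increments n c q i j) \<le> 2 ^ n * dy q (n * j) powr (real n * (\<Sum>k<n. (c k)\<^sup>2))"
proof -
  define g where "g = dy q (n * j)"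
  define L where "L = ln (1 / g)"
  define Y where "Y k \<omega> = X \<omega> (dy q (i + Suc k * j)) - X \<omega> (dy q (i + k * j))" for k \<omega>
  have g0: "0 < g" using n j by (simp add: g_def dy_def)
  have g1: "g \<le> 1" unfolding g_def using le by (intro dy_le_1) simp
  have L0: "0 \<le> L" unfolding L_def using g0 g1 by simp
  have bnd: "i + k * j \<le> 2 ^ q" if "k \<le> n" for k
    using that le by (meson add_le_cancel_left mult_le_mono1 order_trans)
  have ind: "indep_vars (\<lambda>_. borel) Y {..<n}"
    unfolding Y_def[abs_def] using increments_indep[of "\<lambda>k. dy q (i + k * j)" n] bnd[of n] j
    by (simp add: dy_le_1)
  have Ym: "Y k \<in> borel_measurable M" if "k < n" for k
    using ind that by (auto simp: indep_vars_def)
  define T where "T k = {z::real. sqrt (2 * g * L) * c k \<le> \<bar>z\<bar>}" for k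
  have Tm: "T k \<in> sets borel" for k unfolding T_def by measurable
  have Eeq: "large_increments n c q i j = (\<Inter>k\<in>{..<n}. Y k -` T k \<inter> space M)"
    using n by (auto simp: large_increments_def T_def Y_def g_def L_def lessThan_empty_iff)
  have ne: "{..<n} \<noteq> {}" using n by (auto simp: lessThan_empty_iff)
  show "large_increments n c q i j \<in> events"
    unfolding Eeq by (rule sets.finite_INT) (use ne Ym Tm in \<open>auto intro!: measurable_sets\<close>)
  have "prob (large_increments n c q i j) = (\<Prod>k\<in>{..<n}. prob (Y k -` T k \<inter> space M))"
    unfolding Eeq by (rule indep_varsD[OF ind ne]) (use Tm in auto)
  also have "\<dots> \<le> (\<Prod>k\<in>{..<n}. 2 * exp (- (L * (real n * (c k)\<^sup>2))))"
  proof (rule prod_mono, intro conjI)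
    fix k assume k: "k \<in> {..<n}"
    have lt: "i + k * j < i + Suc k * j" using j by simp
    have v: "dy q (i + Suc k * j) - dy q (i + k * j) = real j / 2 ^ q"
      by (simp add: dy_def add_divide_distrib distrib_right)
    have "Y k -` T k \<inter> space M = {\<omega>\<in>space M. sqrt (2 * g * L) * c k \<le> \<bar>X \<omega> (dy q (i + Suc k * j)) - X \<omega> (dy q (i + k * j))\<bar>}"
      by (auto simp: T_def Y_def)
    also have "prob \<dots> \<le> 2 * exp (- (sqrt (2 * g * L) * c k)\<^sup>2 / (2 * (dy q (i + Suc k * j) - dy q (i + k * j))))"
    proof (rule increment_tail)
      show "dy q (i + k * j) < dy q (i + Suc k * j)" using lt by (simp only: dy_less_iff)
      show "dy q (i + Suc k * j) \<le> 1" using bnd[of "Suc k"] k by (intro dy_le_1) auto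
    qed (use c k g0 L0 in auto)
    also have "- (sqrt (2 * g * L) * c k)\<^sup>2 / (2 * (dy q (i + Suc k * j) - dy q (i + k * j))) = - (L * (real n * (c k)\<^sup>2))"
      unfolding v using g0 L0 j by (simp add: power_mult_distrib g_def dy_def field_simps)
    finally show "prob (Y k -` T k \<inter> space M) \<le> 2 * exp (- (L * (real n * (c k)\<^sup>2)))" .
  qed simp
  also have "\<dots> = 2 ^ n * exp (- (L * (real n * (\<Sum>k<n. (c k)\<^sup>2))))"
    by (simp add: prod.distrib exp_sum[symmetric] sum_negf sum_distrib_left)
  also have "exp (- (L * (real n * (\<Sum>k<n. (c k)\<^sup>2)))) = g powr (real n * (\<Sum>k<n. (c k)\<^sup>2))"
    using g0 by (simp add: powr_def L_def ln_div)
  finally show "prob (large_increments n c q i j) \<le> 2 ^ n * dy q (n * j) powr (real n * (\<Sum>k<n. (c k)\<^sup>2))" by (simp add: g_def)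
qed

text \<open>Only at most R step lengths j have to be tried for a cell, so the union over them
  changes the probability 2^(-b q) by a constant factor. Flagged cells then cover all rapid points
  at arbitrarily high levels.\<close>

lemma AE_hausdorff_measure_rapid_points_aux:
  assumes n: "1 \<le> n" and \<epsilon>: "0 < \<epsilon>" and s: "0 < s"
    and \<beta>: "1 < s + real n * (\<Sum>k<n. (max 0 (\<bar>f (real (Suc k) / n) - f (real k / n)\<bar> - 3 * \<epsilon>))\<^sup>2)"
  shows "AE \<omega> in M. hausdorff_measure s (rapid_points f (X \<omega>)) = 0"
proof -
  define c where "c k = max 0 (\<bar>f (real (Suc k) / n) - f (real k / n)\<bar> - 3 * \<epsilon>)" for k
  define b where "b = real n * (\<Sum>k<n. (c k)\<^sup>2)"
  have b0: "0 \<le> b" by (simp add: b_def sum_nonneg)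
  define R where "R = max 1 (nat \<lceil>2 * (32 * (real n + 2) / \<epsilon>)\<^sup>2\<rceil>)"
  have R: "2 * (32 * (real n + 2) / \<epsilon>)\<^sup>2 \<le> real R" "1 \<le> R"
    unfolding R_def using real_nat_ceiling_ge[of "2 * (32 * (real n + 2) / \<epsilon>)\<^sup>2"] by linarith+
  define E where "E = large_increments n c"
  define J where "J q i = {j. R \<le> j \<and> j < 2 * R \<and> i + n * j \<le> 2 ^ q}" for q i
  define F where "F q i = (\<Union>j\<in>J q i. E q i j)" for q i
  have Jfin: "finite (J q i)" and Jcard: "card (J q i) \<le> R" for q i
  proof -
    have "J q i \<subseteq> {R..<2 * R}" by (auto simp: J_def)
    then show "finite (J q i)" "card (J q i) \<le> R"
      using finite_subset card_mono[of "{R..<2 * R}" "J q i"] by auto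
  qed
  have Ee: "E q i j \<in> events" "prob (E q i j) \<le> 2 ^ n * dy q (n * j) powr b" if "j \<in> J q i" for q i j
  proof -
    have jj: "1 \<le> j" "i + n * j \<le> 2 ^ q" using that R(2) by (auto simp: J_def)
    have c0: "0 \<le> c k" if "k < n" for k by (simp add: c_def)
    show "E q i j \<in> events" "prob (E q i j) \<le> 2 ^ n * dy q (n * j) powr b"
      unfolding E_def b_def by (rule large_increments_events[OF n jj c0], assumption) (rule large_increments_prob[OF n jj c0], assumption)
  qed
  have Fe: "F q i \<in> events" for q i
    unfolding F_def using Jfin Ee by (intro sets.finite_UN) auto
  have Fp: "prob (F q i) \<le> (real R * 2 ^ n * (2 * real R * real n) powr b) * 2 powr (- b * real q)" for q i
  proof -
    have "prob (F q i) \<le> (\<Sum>j\<in>J q i. prob (E q i j))"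
      unfolding F_def by (rule measure_UNION_le[OF Jfin]) (use Ee in auto)
    also have "\<dots> \<le> (\<Sum>j\<in>J q i. 2 ^ n * ((2 * real R * real n) powr b * 2 powr (- b * real q)))"
    proof (rule sum_mono)
      fix j assume j: "j \<in> J q i"
      have "dy q (n * j) powr b \<le> (2 * real R * real n / 2 ^ q) powr b"
      proof (rule powr_mono2[OF b0])
        have "real n * real j \<le> real n * (2 * real R)" using j by (intro mult_left_mono) (auto simp: J_def)
        then show "dy q (n * j) \<le> 2 * real R * real n / 2 ^ q"
          unfolding dy_def by (intro divide_right_mono) (auto simp: mult_ac)
      qed simp
      also have "\<dots> = (2 * real R * real n) powr b * 2 powr (- b * real q)"
        by (simp add: powr_divide powr_realpow[symmetric] powr_powr powr_minus_divide mult.commute)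
      finally have "2 ^ n * dy q (n * j) powr b \<le> 2 ^ n * ((2 * real R * real n) powr b * 2 powr (- b * real q))"
        by (intro mult_left_mono) auto
      with Ee(2)[OF j] show "prob (E q i j) \<le> 2 ^ n * ((2 * real R * real n) powr b * 2 powr (- b * real q))"
        by (rule order_trans)
    qed
    also have "\<dots> = real (card (J q i)) * (2 ^ n * ((2 * real R * real n) powr b * 2 powr (- b * real q)))" by simp
    also have "\<dots> \<le> real R * (2 ^ n * ((2 * real R * real n) powr b * 2 powr (- b * real q)))"
      using Jcard by (intro mult_right_mono) auto
    finally show ?thesis by (simp add: mult_ac)
  qed
  have "AE \<omega> in M. summable (\<lambda>q. real (card {i. i < 2 ^ q \<and> \<omega> \<in> F q i}) * 2 powr (- s * real q))"
    by (rule AE_summable_flags[where \<beta>=b, OF Fe Fp]) (use \<beta> in \<open>simp add: b_def c_def\<close>)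
  then show ?thesis using AE_dyadic_modulus AE_space
  proof eventually_elim
    case (elim \<omega>)
    obtain q0 where q0: "\<forall>q\<ge>q0. dyadic_modulus (X \<omega>) q" using elim(2) by blast
    show ?case
    proof (rule hausdorff_measure_zero_dyadic_cover[OF s _ _ elim(1)])
      fix Q
      show "rapid_points f (X \<omega>) \<subseteq> (\<Union>q\<in>{Q..}. \<Union>i\<in>{i. i < 2 ^ q \<and> \<omega> \<in> F q i}. {dy q i..dy q (Suc i)})"
      proof
        fix t assume t: "t \<in> rapid_points f (X \<omega>)"
        obtain q i j where *: "Q \<le> q" "i < 2 ^ q" "R \<le> j" "j < 2 * R" "i + n * j \<le> 2 ^ q" "t \<in> {dy q i..dy q (Suc i)}"
          "\<forall>k<n. sqrt (2 * dy q (n * j) * ln (1 / dy q (n * j))) * max 0 (\<bar>f (real (Suc k) / n) - f (real k / n)\<bar> - 3 * \<epsilon>)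
            \<le> \<bar>X \<omega> (dy q (i + Suc k * j)) - X \<omega> (dy q (i + k * j))\<bar>"
          using rapid_point_flag[OF n \<epsilon> R q0 t, of Q] by blast
        have "\<omega> \<in> E q i j" unfolding E_def large_increments_def c_def using *(7) elim(3) by blast
        then have "\<omega> \<in> F q i" unfolding F_def J_def using * by blast
        then show "t \<in> (\<Union>q\<in>{Q..}. \<Union>i\<in>{i. i < 2 ^ q \<and> \<omega> \<in> F q i}. {dy q i..dy q (Suc i)})"
          using *(1,2,6) by blast
      qed
    qed simp
  qed
qed

text \<open>Some dyadic energy of f already brings the exponent above 1, and by continuity in
  \<epsilon> the truncated increments keep it there for small \<epsilon>.\<close>

lemma AE_hausdorff_measure_rapid_points:
  assumes f: "f \<in> energy_space" and s: "0 < s" "1 - (energy_norm f)\<^sup>2 < s"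
  shows "AE \<omega> in M. hausdorff_measure s (rapid_points f (X \<omega>)) = 0"
proof -
  obtain \<nu> where "(energy_norm f)\<^sup>2 - ((energy_norm f)\<^sup>2 + s - 1) < dyadic_energy f \<nu>"
    using dyadic_energy_approx[OF f, of "(energy_norm f)\<^sup>2 + s - 1"] s by auto
  then have \<nu>: "1 < s + dyadic_energy f \<nu>" by linarith
  define n :: nat where "n = 2 ^ \<nu>"
  define S where "S \<epsilon> = s + real n * (\<Sum>k<n. (max 0 (\<bar>f (real (Suc k) / n) - f (real k / n)\<bar> - 3 * \<epsilon>))\<^sup>2)" for \<epsilon> :: real
  have "(S \<longlongrightarrow> S 0) (at_right 0)"
    unfolding S_def[abs_def] by (intro tendsto_intros)
  moreover have "S 0 = s + dyadic_energy f \<nu>"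
    by (simp add: S_def dyadic_energy_def dy_def n_def)
  ultimately have "eventually (\<lambda>\<epsilon>. 1 < S \<epsilon>) (at_right 0)"
    using \<nu> by (intro order_tendstoD(1)) auto
  then obtain b where b: "0 < b" "\<And>\<epsilon>. 0 < \<epsilon> \<Longrightarrow> \<epsilon> < b \<Longrightarrow> 1 < S \<epsilon>"
    unfolding eventually_at_right_field by blast
  then have "1 < S (b / 2)" by simp
  then show ?thesis
    unfolding S_def using b(1) by (intro AE_hausdorff_measure_rapid_points_aux[of n "b / 2"] s) (auto simp: n_def)
qed

end

section \<open>Concentration for good cells\<close>

lemma exp_le_quadratic: "\<bar>x\<bar> \<le> 1 \<Longrightarrow> exp x \<le> 1 + x + x\<^sup>2" for x :: real
proof (cases "0 \<le> x")
  case False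
  assume "\<bar>x\<bar> \<le> 1"
  define y where "y = - x"
  have y: "0 < y" using False by (simp add: y_def)
  have "1 + y \<le> exp y" by (rule exp_ge_add_one_self)
  then have "exp x \<le> 1 / (1 + y)" using y by (simp add: y_def exp_minus field_simps)
  also have "\<dots> \<le> 1 - y + y\<^sup>2"
  proof -
    have "1 \<le> (1 - y + y\<^sup>2) * (1 + y)" using y by (simp add: algebra_simps power2_eq_square)
    then show ?thesis using y by (simp add: divide_le_eq)
  qed
  finally show ?thesis by (simp add: y_def)
qed (simp add: exp_bound)

text \<open>Markov's inequality for the exponential moment, with exp(x) <= 1 + x + x^2 for |x| <= 1.
  The parameter s stays free; it is later chosen so that the variance term is at most 1.\<close>

lemma (in prob_space) bernstein_upper_tail:
  fixes Y :: "'i \<Rightarrow> 'a \<Rightarrow> real"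
  assumes I: "finite I" "indep_vars (\<lambda>_. borel) Y I"
    and B: "\<And>i \<omega>. i \<in> I \<Longrightarrow> \<bar>Y i \<omega>\<bar> \<le> B"
    and E: "\<And>i. i \<in> I \<Longrightarrow> expectation (Y i) = 0"
    and V: "\<And>i. i \<in> I \<Longrightarrow> expectation (\<lambda>\<omega>. (Y i \<omega>)\<^sup>2) \<le> v"
    and s: "0 < s" "s * B \<le> 1"
  shows "prob {\<omega>\<in>space M. c \<le> (\<Sum>i\<in>I. Y i \<omega>)} \<le> exp (- s * c + s\<^sup>2 * v * real (card I))"
proof -
  have Ym[measurable]: "Y i \<in> borel_measurable M" if "i \<in> I" for i
    using I(2) that by (auto simp: indep_vars_def)
  have bd: "\<bar>s * Y i \<omega>\<bar> \<le> 1" if "i \<in> I" for i \<omega>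
  proof -
    have "s * \<bar>Y i \<omega>\<bar> \<le> s * B" using s by (intro mult_left_mono B[OF that]) auto
    then have "s * \<bar>Y i \<omega>\<bar> \<le> 1" using s by linarith
    then show ?thesis using s by (simp add: abs_mult)
  qed
  have iY: "integrable M (Y i)" if "i \<in> I" for i
    by (rule integrable_const_bound[of _ B]) (use B that in auto)
  have iY2: "integrable M (\<lambda>\<omega>. (Y i \<omega>)\<^sup>2)" if "i \<in> I" for i
  proof (rule integrable_const_bound[of _ "B\<^sup>2"])
    show "AE \<omega> in M. norm ((Y i \<omega>)\<^sup>2) \<le> B\<^sup>2"
      using B[OF that] by (intro AE_I2) (simp add: power_mono[of "\<bar>_\<bar>", simplified] abs_le_square_iff[symmetric] order_trans[OF _ abs_ge_self])
  qed (use that in measurable)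
  have iE: "integrable M (\<lambda>\<omega>. exp (s * Y i \<omega>))" if "i \<in> I" for i
  proof (rule integrable_const_bound[of _ "exp 1"])
    show "AE \<omega> in M. norm (exp (s * Y i \<omega>)) \<le> exp 1"
      using bd[OF that] by (intro AE_I2) (simp add: abs_le_iff)
  qed (use that in measurable)
  have mgf: "expectation (\<lambda>\<omega>. exp (s * Y i \<omega>)) \<le> exp (s\<^sup>2 * v)" if i: "i \<in> I" for i
  proof -
    have "expectation (\<lambda>\<omega>. exp (s * Y i \<omega>)) \<le> expectation (\<lambda>\<omega>. 1 + s * Y i \<omega> + s\<^sup>2 * (Y i \<omega>)\<^sup>2)"
    proof (rule integral_mono[OF iE[OF i]])
      show "integrable M (\<lambda>\<omega>. 1 + s * Y i \<omega> + s\<^sup>2 * (Y i \<omega>)\<^sup>2)" using iY[OF i] iY2[OF i] by simp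
      show "exp (s * Y i \<omega>) \<le> 1 + s * Y i \<omega> + s\<^sup>2 * (Y i \<omega>)\<^sup>2" for \<omega>
        using exp_le_quadratic[OF bd[OF i, of \<omega>]] by (simp add: power_mult_distrib)
    qed
    also have "\<dots> = 1 + s\<^sup>2 * expectation (\<lambda>\<omega>. (Y i \<omega>)\<^sup>2)"
      using iY[OF i] iY2[OF i] E[OF i] by (simp add: prob_space)
    also have "\<dots> \<le> 1 + s\<^sup>2 * v" using V[OF i] by (simp add: mult_left_mono)
    also have "\<dots> \<le> exp (s\<^sup>2 * v)" by (rule exp_ge_add_one_self)
    finally show ?thesis .
  qed
  have ind: "indep_vars (\<lambda>_. borel) (\<lambda>i \<omega>. exp (s * Y i \<omega>)) I"
    by (rule indep_vars_compose2[OF I(2)]) measurable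
  have prodeq: "(\<Prod>i\<in>I. exp (s * Y i \<omega>)) = exp (s * (\<Sum>i\<in>I. Y i \<omega>))" for \<omega>
    using I(1) by (simp add: exp_sum sum_distrib_left)
  have int: "integrable M (\<lambda>\<omega>. exp (s * (\<Sum>i\<in>I. Y i \<omega>)))"
    using indep_vars_integrable[OF I(1) ind iE] by (simp add: prodeq)
  have "expectation (\<lambda>\<omega>. exp (s * (\<Sum>i\<in>I. Y i \<omega>))) = (\<Prod>i\<in>I. expectation (\<lambda>\<omega>. exp (s * Y i \<omega>)))"
    using indep_vars_lebesgue_integral[OF I(1) ind iE] by (simp add: prodeq)
  also have "\<dots> \<le> (\<Prod>i\<in>I. exp (s\<^sup>2 * v))"
    by (intro prod_mono conjI mgf) (auto intro!: integral_nonneg_AE)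
  also have "\<dots> = exp (s\<^sup>2 * v * real (card I))" by (simp add: exp_of_nat_mult[symmetric] mult_ac)
  finally have EE: "expectation (\<lambda>\<omega>. exp (s * (\<Sum>i\<in>I. Y i \<omega>))) \<le> exp (s\<^sup>2 * v * real (card I))" .
  have "prob {\<omega>\<in>space M. c \<le> (\<Sum>i\<in>I. Y i \<omega>)} = prob {\<omega>\<in>space M. exp (s * c) \<le> exp (s * (\<Sum>i\<in>I. Y i \<omega>))}"
    using s by simp
  also have "\<dots> \<le> expectation (\<lambda>\<omega>. exp (s * (\<Sum>i\<in>I. Y i \<omega>))) / exp (s * c)"
    by (rule integral_Markov_inequality_measure[OF int, of "space M"]) auto
  also have "\<dots> \<le> exp (s\<^sup>2 * v * real (card I)) / exp (s * c)"
    by (intro divide_right_mono EE) simp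
  also have "\<dots> = exp (- s * c + s\<^sup>2 * v * real (card I))"
    by (simp add: exp_diff[symmetric])
  finally show ?thesis .
qed

lemma (in prob_space) bernstein_tail:
  fixes Y :: "'i \<Rightarrow> 'a \<Rightarrow> real"
  assumes I: "finite I" "indep_vars (\<lambda>_. borel) Y I"
    and B: "\<And>i \<omega>. i \<in> I \<Longrightarrow> \<bar>Y i \<omega>\<bar> \<le> B"
    and E: "\<And>i. i \<in> I \<Longrightarrow> expectation (Y i) = 0"
    and V: "\<And>i. i \<in> I \<Longrightarrow> expectation (\<lambda>\<omega>. (Y i \<omega>)\<^sup>2) \<le> v"
    and s: "0 < s" "s * B \<le> 1"
  shows "prob {\<omega>\<in>space M. c \<le> \<bar>\<Sum>i\<in>I. Y i \<omega>\<bar>} \<le> 2 * exp (- s * c + s\<^sup>2 * v * real (card I))"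
proof -
  have Ym[measurable]: "Y i \<in> borel_measurable M" if "i \<in> I" for i
    using I(2) that by (auto simp: indep_vars_def)
  have Sm[measurable]: "(\<lambda>\<omega>. \<Sum>i\<in>I. Y i \<omega>) \<in> borel_measurable M" by (rule borel_measurable_sum) (rule Ym)
  have ind: "indep_vars (\<lambda>_. borel) (\<lambda>i \<omega>. - Y i \<omega>) I"
    by (rule indep_vars_compose2[OF I(2)]) measurable
  have 1: "prob {\<omega>\<in>space M. c \<le> (\<Sum>i\<in>I. Y i \<omega>)} \<le> exp (- s * c + s\<^sup>2 * v * real (card I))"
    by (rule bernstein_upper_tail[OF I B E V s])
  have 2: "prob {\<omega>\<in>space M. c \<le> (\<Sum>i\<in>I. - Y i \<omega>)} \<le> exp (- s * c + s\<^sup>2 * v * real (card I))"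
    by (rule bernstein_upper_tail[OF I(1) ind _ _ _ s]) (use B E V in auto)
  have "prob {\<omega>\<in>space M. c \<le> \<bar>\<Sum>i\<in>I. Y i \<omega>\<bar>}
      \<le> prob ({\<omega>\<in>space M. c \<le> (\<Sum>i\<in>I. Y i \<omega>)} \<union> {\<omega>\<in>space M. c \<le> - (\<Sum>i\<in>I. Y i \<omega>)})"
    by (rule finite_measure_mono) (auto simp: abs_if split: if_splits)
  also have "\<dots> \<le> prob {\<omega>\<in>space M. c \<le> (\<Sum>i\<in>I. Y i \<omega>)} + prob {\<omega>\<in>space M. c \<le> - (\<Sum>i\<in>I. Y i \<omega>)}"
    by (rule measure_Un_le) measurable
  also have "\<dots> \<le> 2 * exp (- s * c + s\<^sup>2 * v * real (card I))"
    using 1 2 by (simp add: sum_negf)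
  finally show ?thesis .
qed

text \<open>With \<open>\<eta> = 2\<^sup>-\<^sup>q\<close>, the window of length \<open>h = 2\<^sup>\<rho> \<eta>\<close> is split into \<open>2\<^sup>\<rho>\<close> grid steps, and the
  increments of the path are required to follow those of \<open>sqrt (2 h ln (1/h)) f\<close> up to \<open>sqrt \<eta>\<close>.\<close>

definition increment_window :: "(real \<Rightarrow> real) \<Rightarrow> nat \<Rightarrow> nat \<Rightarrow> nat \<Rightarrow> real set" where
  "increment_window f \<rho> q k =
     (let \<sigma> = sqrt (1 / 2 ^ q); b = \<sigma> * (sqrt (2 * 2 ^ \<rho> * ln (2 ^ q / 2 ^ \<rho>)) * (f (dy \<rho> (Suc k)) - f (dy \<rho> k)))
      in {b..b + \<sigma>})"

definition good_cell :: "(real \<Rightarrow> real) \<Rightarrow> nat \<Rightarrow> (real \<Rightarrow> real) \<Rightarrow> nat \<Rightarrow> nat \<Rightarrow> bool" where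
  "good_cell f \<rho> x q i \<longleftrightarrow> (\<forall>k<2 ^ \<rho>. x (dy q (Suc (i + k))) - x (dy q (i + k)) \<in> increment_window f \<rho> q k)"

text \<open>Expressed through the normal law, independently of any cell: by stationarity of
  increments all cells with room for their window are good with the same probability, so one
  constant centres all weights.\<close>

definition good_prob :: "(real \<Rightarrow> real) \<Rightarrow> nat \<Rightarrow> nat \<Rightarrow> real" where
  "good_prob f \<rho> q = (\<Prod>k<2 ^ \<rho>. measure (density lborel (normal_density 0 (sqrt (1 / 2 ^ q)))) (increment_window f \<rho> q k))"

context brownian
begin

lemma dyadic_increments_indep:
  "indep_vars (\<lambda>_. borel) (\<lambda>i \<omega>. X \<omega> (dy q (Suc i)) - X \<omega> (dy q i)) {..<2 ^ q}"
  by (rule increments_indep) (auto simp: dy_le_1)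

lemma dyadic_increment_measurable:
  "i < 2 ^ q \<Longrightarrow> (\<lambda>\<omega>. X \<omega> (dy q (Suc i)) - X \<omega> (dy q i)) \<in> borel_measurable M"
  using dyadic_increments_indep[of q] by (auto simp: indep_vars_def)

lemma dyadic_increment_distributed:
  "i < 2 ^ q \<Longrightarrow> distributed M lborel (\<lambda>\<omega>. X \<omega> (dy q (Suc i)) - X \<omega> (dy q i)) (normal_density 0 (sqrt (1 / 2 ^ q)))"
  using increment_distributed[of "dy q i" "dy q (Suc i)"] dy_le_1[of "Suc i" q] by (simp add: dy_Suc)

lemma dyadic_increment_prob:
  assumes "i < 2 ^ q" and A: "A \<in> sets borel"
  shows "prob ((\<lambda>\<omega>. X \<omega> (dy q (Suc i)) - X \<omega> (dy q i)) -` A \<inter> space M) = measure (density lborel (normal_density 0 (sqrt (1 / 2 ^ q)))) A"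
proof -
  have "measure (distr M lborel (\<lambda>\<omega>. X \<omega> (dy q (Suc i)) - X \<omega> (dy q i))) A
      = prob ((\<lambda>\<omega>. X \<omega> (dy q (Suc i)) - X \<omega> (dy q i)) -` A \<inter> space M)"
    using dyadic_increment_measurable[OF assms(1)] A by (intro measure_distr) auto
  then show ?thesis
    using distributed_distr_eq_density[OF dyadic_increment_distributed[OF assms(1)]] by simp
qed

lemma
  assumes "i + 2 ^ \<rho> \<le> 2 ^ q"
  shows good_cell_events: "{\<omega>\<in>space M. good_cell f \<rho> (X \<omega>) q i} \<in> events"
    and good_cell_prob: "prob {\<omega>\<in>space M. good_cell f \<rho> (X \<omega>) q i} = good_prob f \<rho> q"
proof -
  define Z where "Z k \<omega> = X \<omega> (dy q (Suc k)) - X \<omega> (dy q k)" for k \<omega>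
  define T where "T k = increment_window f \<rho> q (k - i)" for k
  define J where "J = {i..<i + 2 ^ \<rho>}"
  have J: "J \<noteq> {}" "finite J" "J \<subseteq> {..<2 ^ q}" using assms by (auto simp: J_def)
  have Tm: "T k \<in> sets borel" for k by (simp add: T_def increment_window_def Let_def)
  have eq: "{\<omega>\<in>space M. good_cell f \<rho> (X \<omega>) q i} = (\<Inter>k\<in>J. Z k -` T k \<inter> space M)"
  proof -
    have "(\<forall>k<2 ^ \<rho>. Z (i + k) \<omega> \<in> increment_window f \<rho> q k) \<longleftrightarrow> (\<forall>k\<in>J. Z k \<omega> \<in> T k)" for \<omega>
    proof
      assume *: "\<forall>k<2 ^ \<rho>. Z (i + k) \<omega> \<in> increment_window f \<rho> q k"
      show "\<forall>k\<in>J. Z k \<omega> \<in> T k"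
      proof
        fix k assume "k \<in> J"
        then show "Z k \<omega> \<in> T k" using *[rule_format, of "k - i"] by (auto simp: J_def T_def)
      qed
    next
      assume *: "\<forall>k\<in>J. Z k \<omega> \<in> T k"
      show "\<forall>k<2 ^ \<rho>. Z (i + k) \<omega> \<in> increment_window f \<rho> q k"
      proof (intro allI impI)
        fix k :: nat assume "k < 2 ^ \<rho>"
        then show "Z (i + k) \<omega> \<in> increment_window f \<rho> q k" using *[rule_format, of "i + k"] by (auto simp: J_def T_def)
      qed
    qed
    then show ?thesis using J(1) by (auto simp: good_cell_def Z_def)
  qed
  have Zm: "Z k \<in> borel_measurable M" if "k \<in> J" for k
    unfolding Z_def using that J(3) by (intro dyadic_increment_measurable) auto
  show "{\<omega>\<in>space M. good_cell f \<rho> (X \<omega>) q i} \<in> events"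
    unfolding eq using J Zm Tm by (intro sets.finite_INT) (auto intro: measurable_sets)
  have "prob {\<omega>\<in>space M. good_cell f \<rho> (X \<omega>) q i} = (\<Prod>k\<in>J. prob (Z k -` T k \<inter> space M))"
    unfolding eq by (rule indep_varsD[OF dyadic_increments_indep[of q, folded Z_def] J]) (use Tm in auto)
  also have "\<dots> = (\<Prod>k\<in>J. measure (density lborel (normal_density 0 (sqrt (1 / 2 ^ q)))) (T k))"
    unfolding Z_def using J Tm by (intro prod.cong refl dyadic_increment_prob) auto
  also have "\<dots> = good_prob f \<rho> q"
    unfolding good_prob_def T_def J_def
    by (rule prod.reindex_bij_witness[of _ "\<lambda>k. i + k" "\<lambda>k. k - i"]) auto
  finally show "prob {\<omega>\<in>space M. good_cell f \<rho> (X \<omega>) q i} = good_prob f \<rho> q" .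
qed

text \<open>A window around z standard deviations has probability at least a constant times
  exp(-(|z| + 1)^2 / 2). The squares of the z sum to 2 L times a dyadic energy, with L at most q ln
  2. The summand 1 is absorbed by enlarging the energy by a factor 1 + \<kappa>, which the gap below
  \<alpha> permits; the constant c depends on \<rho> but not on q.\<close>

lemma good_prob_lower_bound:
  assumes f: "f \<in> energy_space" and \<alpha>: "(energy_norm f)\<^sup>2 < \<alpha>"
  obtains c where "0 < c" "\<And>q. \<rho> \<le> q \<Longrightarrow> c * 2 powr (- \<alpha> * real q) \<le> good_prob f \<rho> q"
proof -
  define e where "e = (energy_norm f)\<^sup>2"
  have e0: "0 \<le> e" by (simp add: e_def)
  \<comment> \<open>The largest enlargement with (1 + \<kappa>) e <= \<alpha>; for zero energy any
    positive value will do.\<close>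
  define \<kappa> where "\<kappa> = (if e = 0 then 1 else \<alpha> / e - 1)"
  have \<kappa>: "0 < \<kappa>" "(1 + \<kappa>) * e \<le> \<alpha>" using \<alpha> e0 by (auto simp: \<kappa>_def e_def field_simps)
  define c where "c = (1 / sqrt (2 * pi)) ^ (2 ^ \<rho>) * exp (- (2 ^ \<rho> * (1 + 1 / \<kappa>)) / 2)"
  show thesis
  proof (rule that[of c])
    show "0 < c" by (simp add: c_def)
    fix q assume q: "\<rho> \<le> q"
    define L where "L = ln (2 ^ q / 2 ^ \<rho> :: real)"
    have L0: "0 \<le> L" unfolding L_def using q by (intro ln_ge_zero) (simp add: power_increasing)
    define \<sigma> where "\<sigma> = sqrt (1 / 2 ^ q)"
    have \<sigma>: "0 < \<sigma>" by (simp add: \<sigma>_def)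
    define z where "z k = sqrt (2 * 2 ^ \<rho> * L) * (f (dy \<rho> (Suc k)) - f (dy \<rho> k))" for k
    have win: "increment_window f \<rho> q k = {\<sigma> * z k .. \<sigma> * z k + \<sigma>}" for k
      by (simp add: increment_window_def Let_def \<sigma>_def z_def L_def)
    have low: "exp (- (\<bar>z k\<bar> + 1)\<^sup>2 / 2) / sqrt (2 * pi) \<le> measure (density lborel (normal_density 0 \<sigma>)) (increment_window f \<rho> q k)" for k
    proof -
      \<comment> \<open>The increment over the first grid cell serves as a sample of the normal law,
        so that \<open>normal_window_prob\<close> applies.\<close>
      have "exp (- (\<bar>z k\<bar> + 1)\<^sup>2 / 2) / sqrt (2 * pi) \<le> prob {\<omega>\<in>space M. X \<omega> (dy q (Suc 0)) - X \<omega> (dy q 0) \<in> {\<sigma> * z k .. \<sigma> * z k + \<sigma>}}"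
        unfolding \<sigma>_def by (rule normal_window_prob[OF prob_space_axioms dyadic_increment_distributed]) auto
      also have "{\<omega>\<in>space M. X \<omega> (dy q (Suc 0)) - X \<omega> (dy q 0) \<in> {\<sigma> * z k .. \<sigma> * z k + \<sigma>}}
          = (\<lambda>\<omega>. X \<omega> (dy q (Suc 0)) - X \<omega> (dy q 0)) -` increment_window f \<rho> q k \<inter> space M"
        unfolding win by auto
      also have "prob \<dots> = measure (density lborel (normal_density 0 \<sigma>)) (increment_window f \<rho> q k)"
        unfolding \<sigma>_def by (rule dyadic_increment_prob) (auto simp: increment_window_def Let_def)
      finally show ?thesis .
    qed
    have sumz: "(\<Sum>k<2 ^ \<rho>. (z k)\<^sup>2) \<le> 2 * L * e"
    proof -
      have "(\<Sum>k<2 ^ \<rho>. (z k)\<^sup>2) = 2 * L * dyadic_energy f \<rho>"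
        using L0 by (simp add: z_def power_mult_distrib dyadic_energy_def sum_distrib_left[symmetric] mult_ac)
      also have "\<dots> \<le> 2 * L * e" unfolding e_def using L0 by (intro mult_left_mono dyadic_energy_le f) auto
      finally show ?thesis .
    qed
    \<comment> \<open>Young's inequality 2 |y| <= \<kappa> y^2 + 1/\<kappa>, in the form of a
      square.\<close>
    have young: "(\<bar>y\<bar> + 1)\<^sup>2 \<le> (1 + \<kappa>) * y\<^sup>2 + (1 + 1 / \<kappa>)" for y
    proof -
      have "0 \<le> (\<kappa> * \<bar>y\<bar> - 1)\<^sup>2 / \<kappa>" using \<kappa> by simp
      also have "(\<kappa> * \<bar>y\<bar> - 1)\<^sup>2 / \<kappa> = \<kappa> * y\<^sup>2 - 2 * \<bar>y\<bar> + 1 / \<kappa>"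
        using \<kappa> by (simp add: power2_eq_square field_simps)
      finally show ?thesis by (simp add: power2_eq_square algebra_simps)
    qed
    have "(\<Sum>k<(2::nat) ^ \<rho>. (\<bar>z k\<bar> + 1)\<^sup>2) \<le> (\<Sum>k<(2::nat) ^ \<rho>. (1 + \<kappa>) * (z k)\<^sup>2 + (1 + 1 / \<kappa>))"
      by (intro sum_mono young)
    also have "\<dots> = (1 + \<kappa>) * (\<Sum>k<2 ^ \<rho>. (z k)\<^sup>2) + 2 ^ \<rho> * (1 + 1 / \<kappa>)"
      by (simp add: sum.distrib sum_distrib_left)
    also have "\<dots> \<le> (1 + \<kappa>) * (2 * L * e) + 2 ^ \<rho> * (1 + 1 / \<kappa>)"
      using sumz \<kappa> by (intro add_right_mono mult_left_mono) auto
    also have "(1 + \<kappa>) * (2 * L * e) = 2 * L * ((1 + \<kappa>) * e)" by simp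
    also have "\<dots> \<le> 2 * L * \<alpha>" using L0 \<kappa> by (intro mult_left_mono) auto
    finally have S: "(\<Sum>k<(2::nat) ^ \<rho>. (\<bar>z k\<bar> + 1)\<^sup>2) \<le> 2 * L * \<alpha> + 2 ^ \<rho> * (1 + 1 / \<kappa>)" by simp
    have "c * 2 powr (- \<alpha> * real q) \<le> c * exp (- L * \<alpha>)"
    proof (intro mult_left_mono)
      have "L \<le> real q * ln 2" unfolding L_def by (simp add: ln_div ln_realpow)
      moreover have "0 \<le> \<alpha>" using \<alpha> by (smt (verit) zero_le_power2)
      ultimately have "L * \<alpha> \<le> real q * ln 2 * \<alpha>" by (intro mult_right_mono) auto
      then show "2 powr (- \<alpha> * real q) \<le> exp (- L * \<alpha>)" by (simp add: powr_def mult_ac)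
    qed (simp add: c_def)
    also have "\<dots> = (1 / sqrt (2 * pi)) ^ (2 ^ \<rho>) * exp (- (2 * L * \<alpha> + 2 ^ \<rho> * (1 + 1 / \<kappa>)) / 2)"
    proof -
      have "exp (- w / 2) * exp (- L * \<alpha>) = exp (- (2 * L * \<alpha> + w) / 2)" for w
        by (simp add: exp_add[symmetric] field_simps)
      then show ?thesis by (simp only: c_def mult.assoc)
    qed
    also have "\<dots> \<le> (1 / sqrt (2 * pi)) ^ (2 ^ \<rho>) * exp (- (\<Sum>k<(2::nat) ^ \<rho>. (\<bar>z k\<bar> + 1)\<^sup>2) / 2)"
      using S by (intro mult_left_mono) auto
    also have "\<dots> = (\<Prod>k<(2::nat) ^ \<rho>. exp (- (\<bar>z k\<bar> + 1)\<^sup>2 / 2) / sqrt (2 * pi))"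
      by (simp add: prod_dividef power_one_over exp_sum[symmetric] sum_negf sum_divide_distrib)
    also have "\<dots> \<le> good_prob f \<rho> q"
      unfolding good_prob_def \<sigma>_def[symmetric] by (intro prod_mono conjI low) auto
    finally show "c * 2 powr (- \<alpha> * real q) \<le> good_prob f \<rho> q" .
  qed
qed

lemma good_prob_le_1: "good_prob f \<rho> q \<le> 1"
  unfolding good_prob_def
proof (rule prod_le_1, intro conjI)
  fix k
  interpret N: prob_space "density lborel (normal_density 0 (sqrt (1 / 2 ^ q)))"
    by (rule prob_space_normal_density) simp
  show "measure (density lborel (normal_density 0 (sqrt (1 / 2 ^ q)))) (increment_window f \<rho> q k) \<le> 1"
    by (rule N.prob_le_1)
qed simp

text \<open>Events of cells in the same residue class modulo \<open>2\<^sup>\<rho>\<close> depend on disjoint sets of increments.\<close>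

lemma good_cells_indep:
  assumes I: "\<And>i. i \<in> I \<Longrightarrow> i mod 2 ^ \<rho> = r \<and> i + 2 ^ \<rho> \<le> 2 ^ q"
  shows "indep_vars (\<lambda>_. borel) (\<lambda>i \<omega>. indicator {\<omega>. good_cell f \<rho> (X \<omega>) q i} \<omega> :: real) I"
proof -
  define Z where "Z k \<omega> = X \<omega> (dy q (Suc k)) - X \<omega> (dy q k)" for k \<omega>
  define K where "K i = {i..<i + 2 ^ \<rho>}" for i :: nat
  have ind: "indep_vars (\<lambda>i. PiM (K i) (\<lambda>_. borel :: real measure)) (\<lambda>i \<omega>. restrict (\<lambda>k. Z k \<omega>) (K i)) I"
  proof (rule indep_vars_restrict[OF dyadic_increments_indep[of q, folded Z_def]])
    show "K i \<subseteq> {..<2 ^ q}" if "i \<in> I" for i using I[OF that] by (auto simp: K_def)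
    show "disjoint_family_on K I"
      unfolding disjoint_family_on_def
    proof (intro ballI impI)
      fix i j assume ij: "i \<in> I" "j \<in> I" "i \<noteq> j"
      have *: "a + 2 ^ \<rho> \<le> b" if "a < b" "a mod 2 ^ \<rho> = b mod 2 ^ \<rho>" for a b :: nat
      proof -
        have "2 ^ \<rho> dvd b - a" using that mod_eq_dvd_iff_nat[of a b "2 ^ \<rho>"] by simp
        then have "2 ^ \<rho> \<le> b - a" using that by (intro dvd_imp_le) auto
        then show ?thesis using that by linarith
      qed
      have "i + 2 ^ \<rho> \<le> j \<or> j + 2 ^ \<rho> \<le> i" using *[of i j] *[of j i] I ij by (metis linorder_neqE_nat)
      then show "K i \<inter> K j = {}" by (auto simp: K_def)
    qed
  qed
  have "indep_vars (\<lambda>_. borel) (\<lambda>i \<omega>. (\<lambda>w. indicator {w. \<forall>k<2 ^ \<rho>. w (i + k) \<in> increment_window f \<rho> q k} w :: real) (restrict (\<lambda>k. Z k \<omega>) (K i))) I"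
  proof (rule indep_vars_compose2[OF ind])
    fix i assume "i \<in> I"
    have [measurable]: "increment_window f \<rho> q k \<in> sets borel" for k by (simp add: increment_window_def Let_def)
    have [measurable]: "(\<lambda>w. w (i + k)) \<in> borel_measurable (PiM (K i) (\<lambda>_. borel :: real measure))" if "k < 2 ^ \<rho>" for k
      using that by (intro measurable_component_singleton) (auto simp: K_def)
    have "{w \<in> space (PiM (K i) (\<lambda>_. borel)). \<forall>k\<in>{..<2 ^ \<rho>}. w (i + k) \<in> increment_window f \<rho> q k} \<in> sets (PiM (K i) (\<lambda>_. borel))"
      by measurable
    then show "(\<lambda>w. indicator {w. \<forall>k<2 ^ \<rho>. w (i + k) \<in> increment_window f \<rho> q k} w :: real) \<in> borel_measurable (PiM (K i) (\<lambda>_. borel))"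
      by (subst borel_measurable_indicator_iff) (auto simp: Int_def conj_commute lessThan_def Ball_def)
  qed
  moreover have "(\<lambda>w. indicator {w. \<forall>k<2 ^ \<rho>. w (i + k) \<in> increment_window f \<rho> q k} w :: real) (restrict (\<lambda>k. Z k \<omega>) (K i))
      = indicator {\<omega>. good_cell f \<rho> (X \<omega>) q i} \<omega>" for i \<omega>
    by (auto simp: indicator_def good_cell_def Z_def K_def)
  ultimately show ?thesis by simp
qed

end

section \<open>Transforms of dyadic cells and trigonometric sums on the grid\<close>

definition cell_transform :: "nat \<Rightarrow> nat \<Rightarrow> real \<Rightarrow> complex" where
  "cell_transform q i u =
     (if u = 0 then complex_of_real (1 / 2 ^ q)
      else (iexp (u * dy q (Suc i)) - iexp (u * dy q i)) / (\<i> * complex_of_real u))"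

text \<open>The target decay, capped at 1: one estimate then covers all frequencies and at u = 0
  also controls total masses.\<close>

definition decay_weight :: "real \<Rightarrow> real \<Rightarrow> real" where
  "decay_weight a u = max 1 \<bar>u\<bar> powr (- a / 2)"

lemma norm_iexp_diff_le: "cmod (iexp a - iexp b) \<le> \<bar>a - b\<bar>"
proof -
  have "iexp a - iexp b = iexp b * (iexp (a - b) - 1)"
    by (simp add: right_diff_distrib exp_add[symmetric] algebra_simps)
  then have "cmod (iexp a - iexp b) = cmod (iexp (a - b) - 1)" by (simp add: norm_mult)
  also have "\<dots> \<le> \<bar>a - b\<bar>" using iexp_approx1[of "a - b" 0] by simp
  finally show ?thesis .
qed

text \<open>Separates position from shape: a weighted sum of cell transforms is a trigonometric sum
  over grid points times one common, explicitly bounded factor.\<close>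

lemma cell_transform_shift: "cell_transform q i u = iexp (u * dy q i) * cell_transform q 0 u"
proof (cases "u = 0")
  case False
  have "iexp (u * (dy q i + dy q 1)) = iexp (u * dy q i) * iexp (u * dy q 1)"
    by (simp only: distrib_left of_real_add exp_add)
  then have "iexp (u * dy q (Suc i)) = iexp (u * dy q i) * iexp (u * dy q 1)"
    using dy_add[of q i 1] by simp
  then show ?thesis using False by (simp add: cell_transform_def right_diff_distrib)
qed (simp add: cell_transform_def)

lemma cell_transform_bounds:
  "cmod (cell_transform q i u) \<le> 1 / 2 ^ q" "u \<noteq> 0 \<Longrightarrow> cmod (cell_transform q i u) \<le> 2 / \<bar>u\<bar>"
proof -
  show "cmod (cell_transform q i u) \<le> 1 / 2 ^ q"
  proof (cases "u = 0")
    case False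
    have "cmod (iexp (u * dy q (Suc i)) - iexp (u * dy q i)) \<le> \<bar>u * dy q (Suc i) - u * dy q i\<bar>"
      by (rule norm_iexp_diff_le)
    also have "\<dots> = \<bar>u\<bar> * (1 / 2 ^ q)" by (simp add: dy_Suc distrib_left abs_mult)
    finally show ?thesis using False by (simp add: cell_transform_def norm_divide norm_mult divide_le_eq)
  qed (simp add: cell_transform_def norm_divide norm_power)
  assume u: "u \<noteq> 0"
  have "cmod (iexp (u * dy q (Suc i)) - iexp (u * dy q i)) \<le> 2"
    by (rule order_trans[OF norm_triangle_ineq4]) simp
  then show "cmod (cell_transform q i u) \<le> 2 / \<bar>u\<bar>"
    using u by (simp add: cell_transform_def norm_divide norm_mult divide_right_mono)
qed

lemma cell_transform_refine:
  "(\<Sum>i<2 ^ d. cell_transform (q + d) (k * 2 ^ d + i) u) = cell_transform q k u"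
proof (cases "u = 0")
  case False
  have "(\<Sum>i<2 ^ d. cell_transform (q + d) (k * 2 ^ d + i) u)
     = (\<Sum>i<2 ^ d. iexp (u * dy (q + d) (k * 2 ^ d + Suc i)) - iexp (u * dy (q + d) (k * 2 ^ d + i))) / (\<i> * complex_of_real u)"
    using False by (simp add: cell_transform_def sum_divide_distrib)
  also have "(\<Sum>i<2 ^ d. iexp (u * dy (q + d) (k * 2 ^ d + Suc i)) - iexp (u * dy (q + d) (k * 2 ^ d + i)))
     = iexp (u * dy (q + d) (k * 2 ^ d + 2 ^ d)) - iexp (u * dy (q + d) (k * 2 ^ d))"
    using sum_lessThan_telescope[of "\<lambda>i. iexp (u * dy (q + d) (k * 2 ^ d + i))" "2 ^ d"] by simp
  finally show ?thesis using False by (simp add: cell_transform_def dy_refine dy_refine_Suc)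
qed (simp add: cell_transform_def power_add)

text \<open>Interpolation between the two elementary bounds: a quantity below both A and 2 / |u| is
  below A^(1 - a/2) (2 / |u|)^(a/2). The first factor supplies the gain in q, the second the decay
  in u.\<close>

lemma cell_transform_decay:
  assumes a: "0 < a" "a \<le> 1"
  shows "cmod (cell_transform q i u) \<le> 2 * 2 powr (- (1 - a / 2) * real q) * decay_weight a u"
proof -
  define A where "A = 1 / (2::real) ^ q"
  have A: "0 < A" by (simp add: A_def)
  have Ap: "A powr b = 2 powr (- b * real q)" for b
    by (simp add: A_def powr_divide powr_realpow[symmetric] powr_powr powr_minus_divide mult.commute)
  show ?thesis
  proof (cases "\<bar>u\<bar> \<le> 1")
    case True
    then have d: "decay_weight a u = 1" by (simp add: decay_weight_def max_def)
    have "cmod (cell_transform q i u) \<le> A powr 1" using cell_transform_bounds(1)[where q=q and i=i and u=u] by (simp add: A_def)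
    also have "\<dots> \<le> A powr (1 - a / 2)"
      using a by (intro powr_mono') (auto simp: A_def)
    also have "\<dots> \<le> 2 * A powr (1 - a / 2)" by simp
    finally show ?thesis unfolding d Ap by simp
  next
    case False
    then have u: "u \<noteq> 0" "1 < \<bar>u\<bar>" by auto
    have d: "decay_weight a u = \<bar>u\<bar> powr (- a / 2)" using u by (simp add: decay_weight_def max_def)
    define c where "c = cmod (cell_transform q i u)"
    have c: "0 \<le> c" "c \<le> A" "c \<le> 2 / \<bar>u\<bar>"
      using cell_transform_bounds[where q=q and i=i and u=u] u by (auto simp: c_def A_def)
    have "c = c powr (1 - a / 2) * c powr (a / 2)"
      using c by (cases "c = 0") (simp_all add: powr_add[symmetric])
    also have "\<dots> \<le> A powr (1 - a / 2) * (2 / \<bar>u\<bar>) powr (a / 2)"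
      using c a by (intro mult_mono powr_mono2) auto
    also have "(2 / \<bar>u\<bar>) powr (a / 2) = 2 powr (a / 2) * \<bar>u\<bar> powr (- a / 2)"
      using u by (simp add: powr_divide powr_minus_divide)
    also have "\<dots> \<le> 2 powr 1 * \<bar>u\<bar> powr (- a / 2)"
      using a by (intro mult_right_mono powr_mono) auto
    finally show ?thesis unfolding d c_def[symmetric] Ap[symmetric] using A by (simp add: mult_ac mult_left_mono)
  qed
qed

lemma iexp_grid_periodic:
  "iexp ((u + 2 * pi * 2 ^ q * of_int z) * dy q i) = iexp (u * dy q i)"
proof -
  have "\<i> * complex_of_real ((u + 2 * pi * 2 ^ q * of_int z) * dy q i)
      = \<i> * complex_of_real (u * dy q i) + complex_of_real (2 * real_of_int (z * int i) * pi) * \<i>"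
    by (simp add: dy_def field_simps)
  then show ?thesis using exp_integer_2pi[OF Ints_of_int, of "z * int i"] by (simp only: exp_add mult_1_right)
qed

text \<open>Periodicity in the frequency reduces u to a period of length 2 \<pi> 2^q < 7 * 2^q,
  which a grid of mesh 4^(-q) covers with frequencies numbered up to 7 * 8^q. With at most 2^q terms
  of weight at most 2^q and grid points in [0,1], the sum has Lipschitz constant 4^q, so it changes
  by at most 1 within a mesh.\<close>

lemma trig_sum_grid_bound:
  assumes J: "J \<subseteq> {..<2 ^ q}" and w: "\<And>i. i \<in> J \<Longrightarrow> \<bar>w i\<bar> \<le> 2 ^ q"
    and grid: "\<And>l. l \<le> 7 * 8 ^ q \<Longrightarrow> cmod (\<Sum>i\<in>J. complex_of_real (w i) * iexp (real l / 4 ^ q * dy q i)) \<le> b"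
  shows "cmod (\<Sum>i\<in>J. complex_of_real (w i) * iexp (u * dy q i)) \<le> b + 1"
proof -
  define P where "P = 2 * pi * 2 ^ q"
  have P: "0 < P" by (simp add: P_def)
  define v where "v = u - P * of_int \<lfloor>u / P\<rfloor>"
  have v: "0 \<le> v" "v < P"
  proof -
    have "of_int \<lfloor>u / P\<rfloor> \<le> u / P" "u / P < of_int \<lfloor>u / P\<rfloor> + 1" by linarith+
    then have "of_int \<lfloor>u / P\<rfloor> * P \<le> u" "u < (of_int \<lfloor>u / P\<rfloor> + 1) * P"
      using P by (simp_all only: pos_le_divide_eq pos_divide_less_eq)
    then show "0 \<le> v" "v < P" by (auto simp: v_def algebra_simps)
  qed
  have uv: "u = v + 2 * pi * 2 ^ q * of_int \<lfloor>u / P\<rfloor>" by (simp add: v_def P_def)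
  define l where "l = nat \<lfloor>v * 4 ^ q\<rfloor>"
  have v4: "0 \<le> v * 4 ^ q" using v by simp
  have l: "real l \<le> v * 4 ^ q" "v * 4 ^ q < real l + 1" unfolding l_def using v4 by linarith+
  have lv: "\<bar>v - real l / 4 ^ q\<bar> \<le> 1 / 4 ^ q"
  proof -
    have "real l / 4 ^ q \<le> v" "v \<le> (real l + 1) / 4 ^ q" using l by (auto simp: field_simps)
    then show ?thesis by (auto simp: add_divide_distrib abs_le_iff)
  qed
  have l7: "l \<le> 7 * 8 ^ q"
  proof -
    have "2 * pi * 2 ^ q \<le> 7 * 2 ^ q" using pi_approx by (intro mult_right_mono) simp_all
    then have "v \<le> 7 * 2 ^ q" using v(2) unfolding P_def by linarith
    then have "v * 4 ^ q \<le> 7 * 2 ^ q * 4 ^ q" by (rule mult_right_mono) simp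
    also have "\<dots> = 7 * 8 ^ q" by (simp flip: power_mult_distrib)
    finally have "real l \<le> real (7 * 8 ^ q)" using l(1) by simp
    then show ?thesis by (simp only: of_nat_le_iff)
  qed
  have fin: "finite J" "card J \<le> 2 ^ q" using J finite_subset card_mono[of "{..<2 ^ q}" J] by auto
  have eq: "(\<Sum>i\<in>J. complex_of_real (w i) * iexp (u * dy q i)) = (\<Sum>i\<in>J. complex_of_real (w i) * iexp (v * dy q i))"
    by (subst uv) (simp only: iexp_grid_periodic)
  have "cmod ((\<Sum>i\<in>J. complex_of_real (w i) * iexp (v * dy q i)) - (\<Sum>i\<in>J. complex_of_real (w i) * iexp (real l / 4 ^ q * dy q i)))
     = cmod (\<Sum>i\<in>J. complex_of_real (w i) * (iexp (v * dy q i) - iexp (real l / 4 ^ q * dy q i)))"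
    by (simp add: sum_subtractf right_diff_distrib)
  also have "\<dots> \<le> (\<Sum>i\<in>J. 2 ^ q * (1 / 4 ^ q))"
  proof (rule order_trans[OF norm_sum sum_mono])
    fix i assume i: "i \<in> J"
    have "cmod (iexp (v * dy q i) - iexp (real l / 4 ^ q * dy q i)) \<le> \<bar>v - real l / 4 ^ q\<bar> * dy q i"
    proof -
      have "\<bar>v * dy q i - real l / 4 ^ q * dy q i\<bar> = \<bar>v - real l / 4 ^ q\<bar> * dy q i"
        unfolding left_diff_distrib[symmetric] abs_mult by simp
      then show ?thesis using norm_iexp_diff_le[of "v * dy q i" "real l / 4 ^ q * dy q i"] by (simp only:)
    qed
    also have "\<dots> \<le> (1 / 4 ^ q) * 1" using i J lv by (intro mult_mono dy_le_1) auto
    finally have "\<bar>w i\<bar> * cmod (iexp (v * dy q i) - iexp (real l / 4 ^ q * dy q i)) \<le> 2 ^ q * (1 / 4 ^ q * 1)"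
      by (intro mult_mono w i) auto
    then show "cmod (complex_of_real (w i) * (iexp (v * dy q i) - iexp (real l / 4 ^ q * dy q i))) \<le> 2 ^ q * (1 / 4 ^ q)"
      by (simp add: norm_mult)
  qed
  also have "\<dots> = real (card J) * (2 ^ q * (1 / 4 ^ q))" by simp
  also have "\<dots> \<le> 2 ^ q * (2 ^ q * (1 / 4 ^ q))"
  proof (rule mult_right_mono)
    have "real (card J) \<le> real (2 ^ q)" using fin(2) by (simp only: of_nat_le_iff)
    then show "real (card J) \<le> 2 ^ q" by simp
  qed simp
  also have "\<dots> = 1" by (simp flip: power_mult_distrib)
  finally have "cmod ((\<Sum>i\<in>J. complex_of_real (w i) * iexp (v * dy q i)) - (\<Sum>i\<in>J. complex_of_real (w i) * iexp (real l / 4 ^ q * dy q i))) \<le> 1" .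
  then show ?thesis
    unfolding eq using grid[OF l7] norm_triangle_sub[of "\<Sum>i\<in>J. complex_of_real (w i) * iexp (v * dy q i)" "\<Sum>i\<in>J. complex_of_real (w i) * iexp (real l / 4 ^ q * dy q i)"]
    by linarith
qed

section \<open>Concentration of the centred weights\<close>

definition good_weight :: "(real \<Rightarrow> real) \<Rightarrow> nat \<Rightarrow> (real \<Rightarrow> real) \<Rightarrow> nat \<Rightarrow> nat \<Rightarrow> real" where
  "good_weight f \<rho> x q i = (if good_cell f \<rho> x q i then 1 / good_prob f \<rho> q else 0) - 1"

context brownian
begin

lemma good_weight_indicator:
  "good_weight f \<rho> (X \<omega>) q i = indicator {\<omega>. good_cell f \<rho> (X \<omega>) q i} \<omega> / good_prob f \<rho> q - 1"
  by (simp add: good_weight_def)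

lemma good_weight_bound:
  assumes "1 / 2 ^ q \<le> good_prob f \<rho> q"
  shows "\<bar>good_weight f \<rho> x q i\<bar> \<le> 1 / good_prob f \<rho> q" "1 / good_prob f \<rho> q \<le> 2 ^ q"
proof -
  have p: "0 < good_prob f \<rho> q" by (rule less_le_trans[OF _ assms]) simp
  have "1 \<le> 1 / good_prob f \<rho> q" using p good_prob_le_1 by simp
  then show "\<bar>good_weight f \<rho> x q i\<bar> \<le> 1 / good_prob f \<rho> q" by (simp add: good_weight_def)
  show "1 / good_prob f \<rho> q \<le> 2 ^ q" using assms p by (simp add: field_simps)
qed

lemma good_weight_measurable:
  assumes "i + 2 ^ \<rho> \<le> 2 ^ q"
  shows "(\<lambda>\<omega>. good_weight f \<rho> (X \<omega>) q i) \<in> borel_measurable M"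
proof -
  have "(\<lambda>\<omega>. indicator {\<omega>. good_cell f \<rho> (X \<omega>) q i} \<omega> :: real) \<in> borel_measurable M"
    using good_cell_events[OF assms, of f] by (subst borel_measurable_indicator_iff) (auto simp: Int_def conj_commute)
  then show ?thesis unfolding good_weight_indicator by measurable
qed

text \<open>Overlapping windows destroy independence, so the sum is split into the 2^\<rho> residue
  classes; if it exceeds 2^\<rho> l, some class exceeds l. In each class s = sqrt(p / 2^q), with
  variances at most 1/p and at most 2^q terms, makes the variance term in Bernstein's bound at most
  1.\<close>

lemma good_weight_sum_tail:
  assumes p: "1 / 2 ^ q \<le> good_prob f \<rho> q"
    and J: "J \<subseteq> {..<2 ^ q}" "\<And>i. i \<in> J \<Longrightarrow> i + 2 ^ \<rho> \<le> 2 ^ q"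
    and b: "\<And>i. \<bar>b i\<bar> \<le> 1"
  shows "prob {\<omega>\<in>space M. 2 ^ \<rho> * l \<le> \<bar>\<Sum>i\<in>J. b i * good_weight f \<rho> (X \<omega>) q i\<bar>}
     \<le> 2 ^ \<rho> * (2 * exp (1 - sqrt (good_prob f \<rho> q / 2 ^ q) * l))"
proof -
  define p' where "p' = good_prob f \<rho> q"
  have p0: "0 < p'" unfolding p'_def by (rule less_le_trans[OF _ p]) simp
  define Y where "Y i \<omega> = b i * good_weight f \<rho> (X \<omega>) q i" for i \<omega>
  define s where "s = sqrt (p' / 2 ^ q)"
  have s0: "0 < s" using p0 by (simp add: s_def)
  have s2: "s\<^sup>2 = p' / 2 ^ q" using p0 by (simp add: s_def)
  have finJ: "finite J" using J(1) finite_subset by auto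
  define I where "I r = {i\<in>J. i mod 2 ^ \<rho> = r}" for r
  have Ym[measurable]: "Y i \<in> borel_measurable M" if "i \<in> J" for i
    unfolding Y_def[abs_def] using good_weight_measurable[OF J(2)[OF that], of f] by measurable
  have res: "prob {\<omega>\<in>space M. l \<le> \<bar>\<Sum>i\<in>I r. Y i \<omega>\<bar>} \<le> 2 * exp (1 - s * l)" for r
  proof -
    have IJ: "I r \<subseteq> J" by (auto simp: I_def)
    have finI: "finite (I r)" using IJ finJ finite_subset by auto
    have ind0: "indep_vars (\<lambda>_. borel) (\<lambda>i \<omega>. indicator {\<omega>. good_cell f \<rho> (X \<omega>) q i} \<omega> :: real) (I r)"
      by (rule good_cells_indep[where r=r]) (use J(2) in \<open>auto simp: I_def\<close>)
    have ind: "indep_vars (\<lambda>_. borel) Y (I r)"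
      unfolding Y_def[abs_def] good_weight_indicator p'_def[symmetric]
      by (rule indep_vars_compose2[OF ind0, of "\<lambda>i z. b i * (z / p' - 1)"]) measurable
    have bnd: "\<bar>Y i \<omega>\<bar> \<le> 1 / p'" for i \<omega>
      using mult_mono[OF b[of i] good_weight_bound(1)[OF p, of "X \<omega>" i]] by (simp add: Y_def abs_mult p'_def)
    have Eind: "expectation (\<lambda>\<omega>. indicator {\<omega>. good_cell f \<rho> (X \<omega>) q i} \<omega>) = p'" if "i \<in> J" for i
    proof -
      have "expectation (\<lambda>\<omega>. indicator {\<omega>. good_cell f \<rho> (X \<omega>) q i} \<omega>) = expectation (indicator {\<omega>\<in>space M. good_cell f \<rho> (X \<omega>) q i})"
        by (intro Bochner_Integration.integral_cong) (auto simp: indicator_def)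
      also have "\<dots> = prob {\<omega>\<in>space M. good_cell f \<rho> (X \<omega>) q i}"
        by simp (rule arg_cong[where f=prob], auto)
      finally show ?thesis using good_cell_prob[OF J(2)[OF that], of f] by (simp add: p'_def)
    qed
    have iind: "integrable M (\<lambda>\<omega>. indicator {\<omega>. good_cell f \<rho> (X \<omega>) q i} \<omega> :: real)" if "i \<in> J" for i
    proof (rule integrable_const_bound[of _ 1])
      show "(\<lambda>\<omega>. indicator {\<omega>. good_cell f \<rho> (X \<omega>) q i} \<omega> :: real) \<in> borel_measurable M"
        using good_cell_events[OF J(2)[OF that], of f] by (subst borel_measurable_indicator_iff) (auto simp: Int_def conj_commute)
    qed (auto simp: indicator_def)
    have E: "expectation (Y i) = 0" if "i \<in> I r" for i
    proof -
      have i: "i \<in> J" using that IJ by auto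
      have "expectation (Y i) = b i * (expectation (\<lambda>\<omega>. indicator {\<omega>. good_cell f \<rho> (X \<omega>) q i} \<omega>) / p' - 1)"
        unfolding Y_def[abs_def] good_weight_indicator p'_def[symmetric] using iind[OF i] by (simp add: prob_space)
      then show ?thesis using Eind[OF i] p0 by simp
    qed
    have V: "expectation (\<lambda>\<omega>. (Y i \<omega>)\<^sup>2) \<le> 1 / p'" if "i \<in> I r" for i
    proof -
      have i: "i \<in> J" using that IJ by auto
      have sq: "(Y i \<omega>)\<^sup>2 = (b i)\<^sup>2 * (indicator {\<omega>. good_cell f \<rho> (X \<omega>) q i} \<omega> * (1 / p'\<^sup>2 - 2 / p') + 1)" for \<omega>
        unfolding Y_def good_weight_indicator p'_def[symmetric] using p0
        by (auto simp: indicator_def power2_eq_square field_simps)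
      have "expectation (\<lambda>\<omega>. (Y i \<omega>)\<^sup>2) = (b i)\<^sup>2 * (p' * (1 / p'\<^sup>2 - 2 / p') + 1)"
        unfolding sq using iind[OF i] Eind[OF i] by (simp add: prob_space)
      also have "\<dots> = (b i)\<^sup>2 * (1 / p' - 1)" using p0 by (simp add: field_simps power2_eq_square)
      also have "\<dots> \<le> 1 * (1 / p')"
        using b[of i] p0 good_prob_le_1[of f \<rho> q] by (intro mult_mono) (auto simp: p'_def abs_square_le_1)
      finally show ?thesis by simp
    qed
    have "prob {\<omega>\<in>space M. l \<le> \<bar>\<Sum>i\<in>I r. Y i \<omega>\<bar>} \<le> 2 * exp (- s * l + s\<^sup>2 * (1 / p') * real (card (I r)))"
    proof (rule bernstein_tail[OF finI ind bnd E V s0])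
      \<comment> \<open>The condition s / p <= 1 for Bernstein's bound is equivalent to p >= 1 /
        2^q.\<close>
      have "1 / 2 ^ q \<le> p'" using p by (simp only: p'_def)
      then have "p' * (1 / 2 ^ q) \<le> p' * p'" by (rule mult_left_mono) (use p0 in linarith)
      then have "s\<^sup>2 \<le> p'\<^sup>2" unfolding s2 by (simp add: power2_eq_square)
      then have "s \<le> p'" by (rule power2_le_imp_le) (use p0 in linarith)
      then show "s * (1 / p') \<le> 1" using p0 by (simp add: field_simps)
    qed
    also have "\<dots> \<le> 2 * exp (1 - s * l)"
    proof -
      have "card (I r) \<le> card {..<(2::nat) ^ q}" using IJ J(1) by (intro card_mono) auto
      then have "real (card (I r)) \<le> real (2 ^ q)" by (simp only: card_lessThan of_nat_le_iff)
      then have "s\<^sup>2 * (1 / p') * real (card (I r)) \<le> 1" unfolding s2 using p0 by (simp add: field_simps)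
      then show ?thesis by simp
    qed
    finally show ?thesis .
  qed
  have split: "(\<Sum>i\<in>J. Y i \<omega>) = (\<Sum>r<2 ^ \<rho>. \<Sum>i\<in>I r. Y i \<omega>)" for \<omega>
    unfolding I_def by (rule sum.group[symmetric, OF finJ]) auto
  have "prob {\<omega>\<in>space M. 2 ^ \<rho> * l \<le> \<bar>\<Sum>i\<in>J. Y i \<omega>\<bar>} \<le> prob (\<Union>r<(2::nat) ^ \<rho>. {\<omega>\<in>space M. l \<le> \<bar>\<Sum>i\<in>I r. Y i \<omega>\<bar>})"
  proof (rule finite_measure_mono)
    show "{\<omega>\<in>space M. 2 ^ \<rho> * l \<le> \<bar>\<Sum>i\<in>J. Y i \<omega>\<bar>} \<subseteq> (\<Union>r<(2::nat) ^ \<rho>. {\<omega>\<in>space M. l \<le> \<bar>\<Sum>i\<in>I r. Y i \<omega>\<bar>})"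
    proof
      fix \<omega> assume \<omega>: "\<omega> \<in> {\<omega>\<in>space M. 2 ^ \<rho> * l \<le> \<bar>\<Sum>i\<in>J. Y i \<omega>\<bar>}"
      show "\<omega> \<in> (\<Union>r<(2::nat) ^ \<rho>. {\<omega>\<in>space M. l \<le> \<bar>\<Sum>i\<in>I r. Y i \<omega>\<bar>})"
      proof (rule ccontr)
        assume "\<omega> \<notin> (\<Union>r<(2::nat) ^ \<rho>. {\<omega>\<in>space M. l \<le> \<bar>\<Sum>i\<in>I r. Y i \<omega>\<bar>})"
        then have lt: "\<forall>r\<in>{..<2 ^ \<rho>}. \<bar>\<Sum>i\<in>I r. Y i \<omega>\<bar> < l" using \<omega> by (simp add: not_le)
        have "\<bar>\<Sum>i\<in>J. Y i \<omega>\<bar> \<le> (\<Sum>r<(2::nat) ^ \<rho>. \<bar>\<Sum>i\<in>I r. Y i \<omega>\<bar>)" unfolding split by (rule sum_abs)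
        also have "\<dots> < (\<Sum>r<(2::nat) ^ \<rho>. l)"
          by (rule sum_strict_mono) (use lt in \<open>auto simp: lessThan_empty_iff\<close>)
        finally show False using \<omega> by simp
      qed
    qed
    show "(\<Union>r<(2::nat) ^ \<rho>. {\<omega>\<in>space M. l \<le> \<bar>\<Sum>i\<in>I r. Y i \<omega>\<bar>}) \<in> events"
    proof (intro sets.finite_UN)
      fix r
      have [measurable]: "(\<lambda>\<omega>. \<Sum>i\<in>I r. Y i \<omega>) \<in> borel_measurable M" by (rule borel_measurable_sum) (auto simp: I_def)
      show "{\<omega>\<in>space M. l \<le> \<bar>\<Sum>i\<in>I r. Y i \<omega>\<bar>} \<in> events" by measurable
    qed simp
  qed
  also have "\<dots> \<le> (\<Sum>r<(2::nat) ^ \<rho>. prob {\<omega>\<in>space M. l \<le> \<bar>\<Sum>i\<in>I r. Y i \<omega>\<bar>})"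
  proof (rule measure_UNION_le)
    fix r
    have [measurable]: "(\<lambda>\<omega>. \<Sum>i\<in>I r. Y i \<omega>) \<in> borel_measurable M" by (rule borel_measurable_sum) (auto simp: I_def)
    show "{\<omega>\<in>space M. l \<le> \<bar>\<Sum>i\<in>I r. Y i \<omega>\<bar>} \<in> events" by measurable
  qed simp
  also have "\<dots> \<le> (\<Sum>r<(2::nat) ^ \<rho>. 2 * exp (1 - s * l))" by (intro sum_mono res)
  also have "\<dots> = 2 ^ \<rho> * (2 * exp (1 - s * l))" by simp
  finally show ?thesis by (simp add: Y_def s_def p'_def)
qed

text \<open>One exceptional event for all frequencies: real and imaginary parts are controlled at
  the grid frequencies only. The constant 32 is 8 for the number of frequencies times 4 for two
  parts with two-sided tails.\<close>

lemma good_weight_trig_sum_tail: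
  assumes p: "1 / 2 ^ q \<le> good_prob f \<rho> q"
    and J: "J \<subseteq> {..<2 ^ q}" "\<And>i. i \<in> J \<Longrightarrow> i + 2 ^ \<rho> \<le> 2 ^ q"
  obtains A where "A \<in> events" "prob A \<le> 32 * 8 ^ q * 2 ^ \<rho> * exp (1 - sqrt (good_prob f \<rho> q / 2 ^ q) * l)"
    "\<And>\<omega> u. \<omega> \<in> space M - A \<Longrightarrow> cmod (\<Sum>i\<in>J. complex_of_real (good_weight f \<rho> (X \<omega>) q i) * iexp (u * dy q i)) \<le> 2 * 2 ^ \<rho> * l + 1"
proof -
  define S where "S b \<omega> = (\<Sum>i\<in>J. b i * good_weight f \<rho> (X \<omega>) q i)" for b :: "nat \<Rightarrow> real" and \<omega>
  define E where "E b = {\<omega>\<in>space M. 2 ^ \<rho> * l \<le> \<bar>S b \<omega>\<bar>}" for b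
  have Sm[measurable]: "S b \<in> borel_measurable M" for b
    unfolding S_def[abs_def] using good_weight_measurable J(2) by (intro borel_measurable_sum borel_measurable_times) auto
  have Ee[measurable]: "E b \<in> events" for b unfolding E_def by measurable
  have Ep: "prob (E b) \<le> 2 ^ \<rho> * (2 * exp (1 - sqrt (good_prob f \<rho> q / 2 ^ q) * l))" if "\<And>i. \<bar>b i\<bar> \<le> 1" for b
    unfolding E_def S_def by (rule good_weight_sum_tail[OF p J that])
  define c where "c l' i = cos (real l' / 4 ^ q * dy q i)" for l' :: nat and i
  define d where "d l' i = sin (real l' / 4 ^ q * dy q i)" for l' :: nat and i
  define A where "A = (\<Union>l'\<in>{..7 * 8 ^ q}. E (c l') \<union> E (d l'))"
  show thesis
  proof (rule that[of A])
    show "A \<in> events" unfolding A_def by (intro sets.finite_UN) auto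
    have "prob A \<le> (\<Sum>l'\<in>{..7 * 8 ^ q}. prob (E (c l') \<union> E (d l')))"
      unfolding A_def by (rule measure_UNION_le) auto
    also have "\<dots> \<le> (\<Sum>l'\<in>{..7 * (8::nat) ^ q}. 4 * (2 ^ \<rho> * exp (1 - sqrt (good_prob f \<rho> q / 2 ^ q) * l)))"
    proof (rule sum_mono)
      fix l'
      have "prob (E (c l') \<union> E (d l')) \<le> prob (E (c l')) + prob (E (d l'))" by (rule measure_Un_le) auto
      moreover have "prob (E (c l')) \<le> 2 ^ \<rho> * (2 * exp (1 - sqrt (good_prob f \<rho> q / 2 ^ q) * l))"
        "prob (E (d l')) \<le> 2 ^ \<rho> * (2 * exp (1 - sqrt (good_prob f \<rho> q / 2 ^ q) * l))"
        by (auto intro!: Ep simp: c_def d_def)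
      ultimately show "prob (E (c l') \<union> E (d l')) \<le> 4 * (2 ^ \<rho> * exp (1 - sqrt (good_prob f \<rho> q / 2 ^ q) * l))" by simp
    qed
    also have "\<dots> = (7 * 8 ^ q + 1) * (4 * (2 ^ \<rho> * exp (1 - sqrt (good_prob f \<rho> q / 2 ^ q) * l)))" by simp
    also have "\<dots> \<le> (8 * 8 ^ q) * (4 * (2 ^ \<rho> * exp (1 - sqrt (good_prob f \<rho> q / 2 ^ q) * l)))"
      by (intro mult_right_mono) auto
    finally show "prob A \<le> 32 * 8 ^ q * 2 ^ \<rho> * exp (1 - sqrt (good_prob f \<rho> q / 2 ^ q) * l)" by simp
    fix \<omega> u assume \<omega>: "\<omega> \<in> space M - A"
    show "cmod (\<Sum>i\<in>J. complex_of_real (good_weight f \<rho> (X \<omega>) q i) * iexp (u * dy q i)) \<le> 2 * 2 ^ \<rho> * l + 1"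
    proof (rule trig_sum_grid_bound[OF J(1)])
      show "\<bar>good_weight f \<rho> (X \<omega>) q i\<bar> \<le> 2 ^ q" for i
        using good_weight_bound(1)[OF p, of "X \<omega>" i] good_weight_bound(2)[OF p] by linarith
      fix l' :: nat assume l': "l' \<le> 7 * 8 ^ q"
      let ?Z = "\<Sum>i\<in>J. complex_of_real (good_weight f \<rho> (X \<omega>) q i) * iexp (real l' / 4 ^ q * dy q i)"
      have "Re ?Z = S (c l') \<omega>" by (simp add: S_def c_def Re_exp mult.commute)
      moreover have "Im ?Z = S (d l') \<omega>" by (simp add: S_def d_def Im_exp mult.commute)
      moreover have "\<omega> \<notin> E (c l')" "\<omega> \<notin> E (d l')" using \<omega> l' by (auto simp: A_def)
      ultimately have "\<bar>Re ?Z\<bar> \<le> 2 ^ \<rho> * l" "\<bar>Im ?Z\<bar> \<le> 2 ^ \<rho> * l" using \<omega> by (auto simp: E_def)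
      then show "cmod ?Z \<le> 2 * 2 ^ \<rho> * l" using cmod_le[of ?Z] by linarith
    qed
  qed
qed

end

text \<open>The doubly exponential tail outweighs the 8^q frequencies: for large q it is at most
  exp(-4 q), and exp(-4) <= 1/16 leaves a geometric series of ratio 1/2.\<close>

lemma summable_stretched_exp:
  assumes \<kappa>: "0 < \<kappa>"
  shows "summable (\<lambda>q. 8 ^ q * exp (- (2 powr (\<kappa> * real q))))"
proof -
  define b where "b = (\<kappa> * ln 2)\<^sup>2 / 2"
  have b: "0 < b" using \<kappa> by (simp add: b_def)
  obtain N :: nat where N: "4 / b \<le> real N" using real_arch_simple by blast
  have "norm (8 ^ q * exp (- (2 powr (\<kappa> * real q)))) \<le> (1 / 2) ^ q" if q: "N \<le> q" for q
  proof -
    have "4 / b \<le> real q" using N q by linarith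
    then have "4 \<le> b * real q" using b by (simp add: field_simps)
    then have "4 * real q \<le> b * real q * real q" by (intro mult_right_mono) auto
    also have "\<dots> = (\<kappa> * ln 2 * real q)\<^sup>2 / 2" by (simp add: b_def power2_eq_square)
    also have "\<dots> \<le> exp (\<kappa> * ln 2 * real q)"
    proof -
      have "0 \<le> \<kappa> * ln 2 * real q" using \<kappa> by simp
      from exp_lower_Taylor_quadratic[OF this] this show ?thesis by linarith
    qed
    also have "\<dots> = 2 powr (\<kappa> * real q)" by (simp add: powr_def mult_ac)
    finally have "exp (- (2 powr (\<kappa> * real q))) \<le> exp (- (4 * real q))" by simp
    also have "\<dots> = exp (- 4) ^ q" by (simp add: exp_of_nat_mult[symmetric] mult.commute)
    also have "\<dots> \<le> (1 / 16) ^ q"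
    proof (rule power_mono)
      have "(2::real) \<le> exp 1" using exp_ge_add_one_self[of "1::real"] by simp
      then have "(2::real) ^ 4 \<le> exp 1 ^ 4" by (intro power_mono) auto
      also have "\<dots> = exp 4" by (simp add: exp_of_nat_mult[symmetric])
      finally show "exp (- 4) \<le> (1 / 16 :: real)" by (simp add: exp_minus field_simps)
    qed simp
    finally have "8 ^ q * exp (- (2 powr (\<kappa> * real q))) \<le> 8 ^ q * (1 / 16) ^ q" by (intro mult_left_mono) auto
    also have "\<dots> = (1 / 2) ^ q" by (simp flip: power_mult_distrib)
    finally show ?thesis by simp
  qed
  then show ?thesis by (intro summable_comparison_test[OF _ summable_geometric[of "1/2"]]) auto
qed

text \<open>The change of the transform on the cell k of level m when uniform density is replaced
  there by the normalised good cells of level q. It refers to one fixed cell, because the set of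
  surviving cells is random.\<close>

definition cell_discrepancy :: "(real \<Rightarrow> real) \<Rightarrow> nat \<Rightarrow> (real \<Rightarrow> real) \<Rightarrow> nat \<Rightarrow> nat \<Rightarrow> nat \<Rightarrow> real \<Rightarrow> complex" where
  "cell_discrepancy f \<rho> x q m k u =
     (\<Sum>i\<in>{k * 2 ^ (q - m)..<Suc k * 2 ^ (q - m)}. complex_of_real (good_weight f \<rho> x q i) * cell_transform q i u)"

context brownian
begin

text \<open>Take the tail bound at l = 2^(\<kappa> q) sqrt(2^q / p), so that the exceptional
  probabilities are summable. The trigonometric sum is then of order 2^(q (\<kappa> + (1 + \<alpha>)
  / 2)), and the common cell factor contributes 2^(-q (1 - a/2)).\<close>

lemma AE_cell_discrepancy_small:
  assumes f: "f \<in> energy_space" and \<alpha>: "(energy_norm f)\<^sup>2 < \<alpha>" and a: "0 < a" "a + \<alpha> < 1"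
    and k: "2 * Suc k \<le> 2 ^ m"
  shows "AE \<omega> in M. \<forall>\<epsilon>>0. \<exists>q0. \<forall>q\<ge>q0. \<forall>u. cmod (cell_discrepancy f \<rho> (X \<omega>) q m k u) \<le> \<epsilon> * decay_weight a u"
proof -
  have \<alpha>0: "0 < \<alpha>" using \<alpha> by (rule le_less_trans[rotated]) simp
  obtain c where c: "0 < c" "\<And>q. \<rho> \<le> q \<Longrightarrow> c * 2 powr (- \<alpha> * real q) \<le> good_prob f \<rho> q"
    using good_prob_lower_bound[OF f \<alpha>] by blast
  \<comment> \<open>The balance of exponents without \<kappa> is -(1 - a - \<alpha>) / 2 = -2
    \<kappa>; half of it pays for the tail bound and -\<kappa> remains.\<close>
  define \<kappa> where "\<kappa> = (1 - a - \<alpha>) / 4"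
  have \<kappa>: "0 < \<kappa>" using a by (simp add: \<kappa>_def)
  define J where "J q = {k * 2 ^ (q - m)..<Suc k * 2 ^ (q - m)}" for q
  define l where "l q = 2 powr (\<kappa> * real q) / sqrt (good_prob f \<rho> q / 2 ^ q)" for q
  \<comment> \<open>Beyond N the bound c 2^(-\<alpha> q) exceeds 2^(-q), which keeps the weights
    below 2^q.\<close>
  obtain N :: nat where N: "1 / c \<le> 2 powr ((1 - \<alpha>) * real N)"
  proof -
    obtain N :: nat where "log 2 (1 / c) / (1 - \<alpha>) \<le> real N" using real_arch_simple by blast
    then have "log 2 (1 / c) \<le> (1 - \<alpha>) * real N" using a by (simp add: field_simps)
    then have "2 powr (log 2 (1 / c)) \<le> 2 powr ((1 - \<alpha>) * real N)" by (intro powr_mono) auto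
    then show thesis using c by (intro that[of N]) simp
  qed
  define q1 where "q1 = Suc (max (max \<rho> m) N)"
  have q1: "\<rho> < q" "m \<le> q" "N \<le> q" if "q1 \<le> q" for q using that by (auto simp: q1_def)
  have p: "1 / 2 ^ q \<le> good_prob f \<rho> q" if "q1 \<le> q" for q
  proof -
    have "1 / c \<le> 2 powr ((1 - \<alpha>) * real q)"
      using N q1[OF that] a by (elim order_trans) (intro powr_mono mult_left_mono; simp)
    then have "1 \<le> c * 2 powr ((1 - \<alpha>) * real q)" using c(1) by (simp add: field_simps)
    then have "2 powr (- real q) * 1 \<le> 2 powr (- real q) * (c * 2 powr ((1 - \<alpha>) * real q))" by (intro mult_left_mono) auto
    also have "\<dots> = c * 2 powr (- \<alpha> * real q)" by (simp add: mult.left_commute powr_add[symmetric] algebra_simps)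
    also have "\<dots> \<le> good_prob f \<rho> q" using c(2) q1[OF that] by simp
    finally show ?thesis by (simp add: powr_minus_divide powr_realpow)
  qed
  have J: "J q \<subseteq> {..<2 ^ q}" "\<And>i. i \<in> J q \<Longrightarrow> i + 2 ^ \<rho> \<le> 2 ^ q" if "q1 \<le> q" for q
  proof -
    have mq: "2 ^ m * 2 ^ (q - m) = (2::nat) ^ q" using q1(2)[OF that] by (simp add: power_add[symmetric])
    \<comment> \<open>The coarse cell lies in the left half of the grid and the window takes at most
      the other half, so every candidate cell has its full window inside [0, 1].\<close>
    have "2 * Suc k * 2 ^ (q - m) \<le> 2 ^ m * 2 ^ (q - m)" using k by (rule mult_right_mono) simp
    then have half: "2 * (Suc k * 2 ^ (q - m)) \<le> 2 ^ q" using mq by simp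
    have "Suc \<rho> \<le> q" using q1(1)[OF that] by simp
    then have "(2::nat) ^ Suc \<rho> \<le> 2 ^ q" by (rule power_increasing) simp
    then have r: "2 * 2 ^ \<rho> \<le> (2::nat) ^ q" by simp
    show 1: "i + 2 ^ \<rho> \<le> 2 ^ q" if "i \<in> J q" for i
    proof -
      have "i < Suc k * 2 ^ (q - m)" using that unfolding J_def by simp
      then show ?thesis using half r by linarith
    qed
    show "J q \<subseteq> {..<2 ^ q}"
    proof
      fix i assume "i \<in> J q"
      then have "i + 2 ^ \<rho> \<le> 2 ^ q" by (rule 1)
      moreover have "i < i + 2 ^ \<rho>" by simp
      ultimately show "i \<in> {..<2 ^ q}" unfolding lessThan_iff by (rule less_le_trans[rotated])
    qed
  qed
  have "\<forall>q. \<exists>A. q1 \<le> q \<longrightarrow> A \<in> events \<and> prob (A) \<le> 32 * 8 ^ q * 2 ^ \<rho> * exp (1 - sqrt (good_prob f \<rho> q / 2 ^ q) * l q) \<and>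
     (\<forall>\<omega> u. \<omega> \<in> space M - A \<longrightarrow> cmod (\<Sum>i\<in>J q. complex_of_real (good_weight f \<rho> (X \<omega>) q i) * iexp (u * dy q i)) \<le> 2 * 2 ^ \<rho> * l q + 1)"
  proof
    fix q
    show "\<exists>A. q1 \<le> q \<longrightarrow> A \<in> events \<and> prob (A) \<le> 32 * 8 ^ q * 2 ^ \<rho> * exp (1 - sqrt (good_prob f \<rho> q / 2 ^ q) * l q) \<and>
     (\<forall>\<omega> u. \<omega> \<in> space M - A \<longrightarrow> cmod (\<Sum>i\<in>J q. complex_of_real (good_weight f \<rho> (X \<omega>) q i) * iexp (u * dy q i)) \<le> 2 * 2 ^ \<rho> * l q + 1)"
    proof (cases "q1 \<le> q")
      case q: True
      show ?thesis
        by (rule good_weight_trig_sum_tail[OF p[OF q] J[OF q], where l="l q"]) blast+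
    qed simp
  qed
  from choice[OF this] obtain A where "\<forall>q. q1 \<le> q \<longrightarrow> A q \<in> events \<and> prob (A q) \<le> 32 * 8 ^ q * 2 ^ \<rho> * exp (1 - sqrt (good_prob f \<rho> q / 2 ^ q) * l q) \<and>
     (\<forall>\<omega> u. \<omega> \<in> space M - A q \<longrightarrow> cmod (\<Sum>i\<in>J q. complex_of_real (good_weight f \<rho> (X \<omega>) q i) * iexp (u * dy q i)) \<le> 2 * 2 ^ \<rho> * l q + 1)" ..
  then have A: "\<And>q. q1 \<le> q \<Longrightarrow> A q \<in> events"
    "\<And>q. q1 \<le> q \<Longrightarrow> prob (A q) \<le> 32 * 8 ^ q * 2 ^ \<rho> * exp (1 - sqrt (good_prob f \<rho> q / 2 ^ q) * l q)"
    "\<And>q \<omega> u. q1 \<le> q \<Longrightarrow> \<omega> \<in> space M - A q \<Longrightarrow> cmod (\<Sum>i\<in>J q. complex_of_real (good_weight f \<rho> (X \<omega>) q i) * iexp (u * dy q i)) \<le> 2 * 2 ^ \<rho> * l q + 1"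
    by blast+
  have Ap: "prob (A q) \<le> 32 * 2 ^ \<rho> * exp 1 * (8 ^ q * exp (- (2 powr (\<kappa> * real q))))" if q: "q1 \<le> q" for q
  proof -
    have "0 < good_prob f \<rho> q" by (rule less_le_trans[OF _ p[OF q]]) simp
    then have "sqrt (good_prob f \<rho> q / 2 ^ q) * l q = 2 powr (\<kappa> * real q)" by (simp add: l_def)
    then show ?thesis using A(2)[OF q] by (simp add: exp_diff exp_minus field_simps)
  qed
  have "summable (\<lambda>q. prob (A (q + q1)))"
  proof (rule summable_comparison_test')
    have "summable (\<lambda>q. 32 * 2 ^ \<rho> * exp 1 * (8 ^ q * exp (- (2 powr (\<kappa> * real q)))))"
      by (intro summable_mult summable_stretched_exp \<kappa>)
    then show "summable (\<lambda>q. 32 * 2 ^ \<rho> * exp 1 * (8 ^ (q + q1) * exp (- (2 powr (\<kappa> * real (q + q1))))))"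
      by (rule summable_ignore_initial_segment)
    show "norm (prob (A (q + q1))) \<le> 32 * 2 ^ \<rho> * exp 1 * (8 ^ (q + q1) * exp (- (2 powr (\<kappa> * real (q + q1)))))" for q
      using Ap[of "q + q1"] by simp
  qed
  then have "AE \<omega> in M. eventually (\<lambda>q. \<omega> \<in> space M - A (q + q1)) sequentially"
    by (intro borel_cantelli_AE1) (auto simp: emeasure_eq_measure intro: A(1))
  then show ?thesis
  proof eventually_elim
    case (elim \<omega>)
    then obtain q2 where q2: "\<And>q. q2 \<le> q \<Longrightarrow> \<omega> \<in> space M - A (q + q1)" by (auto simp: eventually_sequentially)
    define B where "B = 2 * (2 * 2 ^ \<rho> / sqrt c + 1)"
    have B: "0 < B" unfolding B_def using c by (simp add: add_pos_pos)
    have bound: "cmod (cell_discrepancy f \<rho> (X \<omega>) q m k u) \<le> B * 2 powr (- \<kappa> * real q) * decay_weight a u" if q: "q1 + q2 \<le> q" for q u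
    proof -
      have qq: "q1 \<le> q" "\<omega> \<in> space M - A q" using q q2[of "q - q1"] by auto
      let ?W = "\<Sum>i\<in>J q. complex_of_real (good_weight f \<rho> (X \<omega>) q i) * iexp (u * dy q i)"
      have p0: "0 < good_prob f \<rho> q" by (rule less_le_trans[OF _ p[OF qq(1)]]) simp
      have W: "cmod ?W \<le> 2 * 2 ^ \<rho> * l q + 1" by (rule A(3)[OF qq])
      have eq: "cell_discrepancy f \<rho> (X \<omega>) q m k u = ?W * cell_transform q 0 u"
        unfolding cell_discrepancy_def J_def[symmetric] sum_distrib_right
        by (rule sum.cong[OF refl], subst cell_transform_shift, simp only: mult.assoc)
      have lq: "l q \<le> 2 powr (\<kappa> * real q + (1 + \<alpha>) / 2 * real q) / sqrt c"
      proof -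
        have "sqrt c * 2 powr (- (1 + \<alpha>) / 2 * real q) = sqrt (c * 2 powr (- \<alpha> * real q) / 2 ^ q)"
        proof -
          have "2 powr (- \<alpha> * real q) / 2 ^ q = 2 powr (- \<alpha> * real q - real q)"
            by (simp add: powr_diff powr_realpow)
          also have "\<dots> = 2 powr (- (1 + \<alpha>) / 2 * real q + - (1 + \<alpha>) / 2 * real q)"
            by (rule arg_cong[where f="\<lambda>z. 2 powr z"]) (simp add: field_simps)
          also have "\<dots> = (2 powr (- (1 + \<alpha>) / 2 * real q))\<^sup>2"
            unfolding powr_add power2_eq_square ..
          finally have "c * (2 powr (- \<alpha> * real q) / 2 ^ q) = c * (2 powr (- (1 + \<alpha>) / 2 * real q))\<^sup>2"
            by (rule arg_cong)
          then have "c * 2 powr (- \<alpha> * real q) / 2 ^ q = c * (2 powr (- (1 + \<alpha>) / 2 * real q))\<^sup>2"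
            by (simp only: times_divide_eq_right)
          then have "sqrt (c * 2 powr (- \<alpha> * real q) / 2 ^ q) = sqrt (c * (2 powr (- (1 + \<alpha>) / 2 * real q))\<^sup>2)"
            by (rule arg_cong)
          also have "\<dots> = sqrt c * 2 powr (- (1 + \<alpha>) / 2 * real q)"
            unfolding real_sqrt_mult by (simp only: real_sqrt_abs abs_of_nonneg powr_ge_zero)
          finally show ?thesis by (rule sym)
        qed
        also have "\<dots> \<le> sqrt (good_prob f \<rho> q / 2 ^ q)"
          using c(2)[of q] q1[OF qq(1)] by (intro real_sqrt_le_mono divide_right_mono) auto
        finally have "l q \<le> 2 powr (\<kappa> * real q) / (sqrt c * 2 powr (- (1 + \<alpha>) / 2 * real q))"
          unfolding l_def using c(1) by (intro divide_left_mono mult_pos_pos) (auto simp: p0)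
        also have "\<dots> = 2 powr (\<kappa> * real q + (1 + \<alpha>) / 2 * real q) / sqrt c"
        proof -
          have "2 powr y / (sqrt c * 2 powr (- z)) = 2 powr (y + z) / sqrt c" for y z :: real
            by (simp add: powr_add powr_minus field_simps)
          moreover have "- (1 + \<alpha>) / 2 * real q = - ((1 + \<alpha>) / 2 * real q)" by (simp add: algebra_simps)
          ultimately show ?thesis by (simp only:)
        qed
        finally show ?thesis .
      qed
      have d0: "0 \<le> decay_weight a u" by (simp add: decay_weight_def)
      have "2 * 2 ^ \<rho> * l q + 1 \<le> 2 * 2 ^ \<rho> * (2 powr (\<kappa> * real q + (1 + \<alpha>) / 2 * real q) / sqrt c) + 2 powr (\<kappa> * real q + (1 + \<alpha>) / 2 * real q)"
      proof (intro add_mono mult_left_mono lq)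
        have "(2::real) powr 0 \<le> 2 powr (\<kappa> * real q + (1 + \<alpha>) / 2 * real q)" using \<kappa> \<alpha>0 by (intro powr_mono) auto
        then show "1 \<le> (2::real) powr (\<kappa> * real q + (1 + \<alpha>) / 2 * real q)" by simp
      qed simp
      also have "\<dots> = B / 2 * 2 powr (\<kappa> * real q + (1 + \<alpha>) / 2 * real q)" by (simp add: B_def algebra_simps)
      finally have W': "cmod ?W \<le> B / 2 * 2 powr (\<kappa> * real q + (1 + \<alpha>) / 2 * real q)" using W by linarith
      have "cmod (cell_discrepancy f \<rho> (X \<omega>) q m k u) = cmod ?W * cmod (cell_transform q 0 u)"
        unfolding eq by (rule norm_mult)
      also have "\<dots> \<le> (B / 2 * 2 powr (\<kappa> * real q + (1 + \<alpha>) / 2 * real q)) * (2 * 2 powr (- (1 - a / 2) * real q) * decay_weight a u)"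
        using W' a \<alpha>0 B by (intro mult_mono cell_transform_decay) auto
      also have "\<dots> = B * (2 powr (\<kappa> * real q + (1 + \<alpha>) / 2 * real q) * 2 powr (- (1 - a / 2) * real q)) * decay_weight a u" by simp
      also have "2 powr (\<kappa> * real q + (1 + \<alpha>) / 2 * real q) * 2 powr (- (1 - a / 2) * real q) = 2 powr (- \<kappa> * real q)"
        unfolding powr_add[symmetric] by (rule arg_cong[where f="\<lambda>z. 2 powr z"]) (simp add: \<kappa>_def field_simps)
      finally show ?thesis .
    qed
    show ?case
    proof (intro allI impI)
      fix \<epsilon> :: real assume \<epsilon>: "0 < \<epsilon>"
      have "(\<lambda>q. B * (2 powr (- \<kappa>)) ^ q) \<longlonglongrightarrow> B * 0"
      proof (intro tendsto_mult tendsto_const LIMSEQ_power_zero)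
        have "(2::real) powr (- \<kappa>) < 2 powr 0" using \<kappa> by (intro powr_less_mono) auto
        then show "norm ((2::real) powr (- \<kappa>)) < 1" by simp
      qed
      then have "eventually (\<lambda>q. B * (2 powr (- \<kappa>)) ^ q < \<epsilon>) sequentially"
        using \<epsilon> by (intro order_tendstoD(2)) auto
      then obtain q3 where q3: "\<And>q. q3 \<le> q \<Longrightarrow> B * (2 powr (- \<kappa>)) ^ q < \<epsilon>" by (auto simp: eventually_sequentially)
      show "\<exists>q0. \<forall>q\<ge>q0. \<forall>u. cmod (cell_discrepancy f \<rho> (X \<omega>) q m k u) \<le> \<epsilon> * decay_weight a u"
      proof (intro exI allI impI)
        fix q u assume q: "max (q1 + q2) q3 \<le> q"
        have "cmod (cell_discrepancy f \<rho> (X \<omega>) q m k u) \<le> B * 2 powr (- \<kappa> * real q) * decay_weight a u" using q by (intro bound) simp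
        also have "\<dots> \<le> \<epsilon> * decay_weight a u"
        proof (rule mult_right_mono)
          have "B * (2 powr (- \<kappa>)) ^ q < \<epsilon>" using q by (intro q3) simp
          then show "B * 2 powr (- \<kappa> * real q) \<le> \<epsilon>" by (simp add: powr_realpow[symmetric] powr_powr)
        qed (simp add: decay_weight_def)
        finally show "cmod (cell_discrepancy f \<rho> (X \<omega>) q m k u) \<le> \<epsilon> * decay_weight a u" .
      qed
    qed
  qed
qed

end

section \<open>Measures on rapid points\<close>

lemma rapid_pointsI:
  assumes t: "0 \<le> t" "t < 1"
    and H: "\<And>\<epsilon> h0. 0 < \<epsilon> \<Longrightarrow> 0 < h0 \<Longrightarrow> \<exists>h. 0 < h \<and> h < h0 \<and> h \<le> 1 - t \<and>
      (\<forall>s\<in>{0..1}. \<bar>(x (t + s * h) - x t) / sqrt (2 * h * ln (inverse h)) - f s\<bar> \<le> \<epsilon>)"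
  shows "t \<in> rapid_points f x"
proof -
  define g where "g h = (SUP s\<in>{0..1}. ereal \<bar>(x (t + s * h) - x t) / sqrt (2 * h * ln (inverse h)) - f s\<bar>)" for h
  let ?F = "at 0 within {0<..1 - t}"
  have g0: "0 \<le> g h" for h
    unfolding g_def by (rule SUP_upper2[of 0]) auto
  have "Liminf ?F g = 0"
  proof (rule antisym)
    show "0 \<le> Liminf ?F g" using g0 by (intro Liminf_bounded) auto
    show "Liminf ?F g \<le> 0"
    proof (rule ccontr)
      assume "\<not> Liminf ?F g \<le> 0"
      then obtain \<epsilon> where \<epsilon>: "0 < ereal \<epsilon>" "ereal \<epsilon> < Liminf ?F g"
        using ereal_dense2[of 0 "Liminf ?F g"] by (auto simp: not_le)
      have "eventually (\<lambda>h. ereal \<epsilon> < g h) ?F"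
        using \<epsilon>(2) le_Liminf_iff[of "Liminf ?F g" ?F g] by auto
      then obtain d where d: "0 < d" "\<And>h. h \<in> {0<..1 - t} \<Longrightarrow> h \<noteq> 0 \<Longrightarrow> dist h 0 < d \<Longrightarrow> ereal \<epsilon> < g h"
        unfolding eventually_at by auto
      obtain h where h: "0 < h" "h < d" "h \<le> 1 - t"
        "\<forall>s\<in>{0..1}. \<bar>(x (t + s * h) - x t) / sqrt (2 * h * ln (inverse h)) - f s\<bar> \<le> \<epsilon>"
        using H[of \<epsilon> d] d(1) \<epsilon>(1) by auto
      have "g h \<le> ereal \<epsilon>" unfolding g_def using h(4) by (intro SUP_least) auto
      moreover have "ereal \<epsilon> < g h" using d(2)[of h] h by auto
      ultimately show False by simp
    qed
  qed
  then show ?thesis using t by (simp add: rapid_points_def g_def[abs_def])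
qed

text \<open>The windows for the increments are one-sided, so the deviations from the rescaled f are
  nonnegative and accumulate to at most k grid standard deviations.\<close>

lemma good_cell_grid:
  assumes "good_cell f \<rho> x q i" "f 0 = 0" "k \<le> 2 ^ \<rho>"
  shows "x (dy q (i + k)) - x (dy q i) \<in>
    {sqrt (2 * (2 ^ \<rho> / 2 ^ q) * ln (2 ^ q / 2 ^ \<rho>)) * f (dy \<rho> k) ..
     sqrt (2 * (2 ^ \<rho> / 2 ^ q) * ln (2 ^ q / 2 ^ \<rho>)) * f (dy \<rho> k) + real k * sqrt (1 / 2 ^ q)}"
  using assms(3)
proof (induction k)
  case 0
  then show ?case using assms(2) by simp
next
  case (Suc k)
  define D where "D = sqrt (2 * (2 ^ \<rho> / 2 ^ q) * ln (2 ^ q / 2 ^ \<rho>))"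
  define \<sigma> where "\<sigma> = sqrt (1 / (2::real) ^ q)"
  have D: "\<sigma> * (sqrt (2 * 2 ^ \<rho> * ln (2 ^ q / 2 ^ \<rho>)) * z) = D * z" for z
  proof -
    have "\<sigma> * sqrt (2 * 2 ^ \<rho> * ln (2 ^ q / 2 ^ \<rho>)) = D"
      unfolding \<sigma>_def D_def real_sqrt_mult[symmetric] by (rule arg_cong[where f=sqrt]) simp
    then show ?thesis by (simp only: mult.assoc[symmetric])
  qed
  have "x (dy q (Suc (i + k))) - x (dy q (i + k)) \<in> increment_window f \<rho> q k"
    using assms(1) Suc.prems unfolding good_cell_def by simp
  then have 1: "x (dy q (Suc (i + k))) - x (dy q (i + k)) \<in> {D * (f (dy \<rho> (Suc k)) - f (dy \<rho> k)) .. D * (f (dy \<rho> (Suc k)) - f (dy \<rho> k)) + \<sigma>}"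
    unfolding increment_window_def Let_def \<sigma>_def[symmetric] D .
  have 2: "x (dy q (i + k)) - x (dy q i) \<in> {D * f (dy \<rho> k) .. D * f (dy \<rho> k) + real k * \<sigma>}"
    using Suc unfolding D_def \<sigma>_def by simp
  show ?case
    unfolding D_def[symmetric] \<sigma>_def[symmetric] using 1 2 by (auto simp: algebra_simps)
qed

text \<open>With S = sqrt(q / 2^q) the path error is 65 S: 48 S between t + s h and the grid point
  at most two cells before it, 16 S between t and the start of its cell, and S for the accumulated
  window widths, the last because 4^\<rho> <= q. Since 2 \<rho> <= q gives ln(1/h) >= q / 4, S is at
  most sqrt(2 / 2^\<rho>) times the scaling factor. The term w is the change of f between s and its
  grid point.\<close>

lemma good_cell_estimate:
  assumes mod: "dyadic_modulus x q" and good: "good_cell f \<rho> x q i" and f0: "f 0 = 0"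
    and osc: "\<And>s s'. s \<in> {0..1} \<Longrightarrow> s' \<in> {0..1} \<Longrightarrow> \<bar>s - s'\<bar> \<le> 1 / 2 ^ \<rho> \<Longrightarrow> \<bar>f s - f s'\<bar> \<le> w"
    and t: "t \<in> {dy q i..dy q (Suc i)}" and i: "i + 2 ^ \<rho> + 1 \<le> 2 ^ q"
    and q: "4 ^ \<rho> \<le> q" "2 * \<rho> \<le> q"
    and s: "s \<in> {0..1}"
  defines "h \<equiv> 2 ^ \<rho> / 2 ^ q"
  shows "\<bar>(x (t + s * h) - x t) / sqrt (2 * h * ln (inverse h)) - f s\<bar> \<le> 65 * sqrt (2 / 2 ^ \<rho>) + w"
proof -
  define D where "D = sqrt (2 * h * ln (inverse h))"
  define S where "S = sqrt (real q / 2 ^ q)"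
  define \<sigma> where "\<sigma> = sqrt (1 / (2::real) ^ q)"
  have h0: "0 < h" by (simp add: h_def)
  have ih: "inverse h = 2 ^ q / 2 ^ \<rho>" by (simp add: h_def)
  have q0: "0 < q" using q(1) by (rule less_le_trans[rotated]) simp
  have L: "real q / 4 \<le> ln (inverse h)"
  proof -
    have "ln (inverse h) = (real q - real \<rho>) * ln 2" unfolding ih by (simp add: ln_div ln_realpow algebra_simps)
    moreover have "(real q / 2) * (1 / 2) \<le> (real q - real \<rho>) * ln 2"
      using q(2) ln2_ge_two_thirds by (intro mult_mono) auto
    ultimately show ?thesis by simp
  qed
  have L0: "0 \<le> ln (inverse h)" by (rule order_trans[OF _ L]) simp
  have D2: "D\<^sup>2 = 2 * h * ln (inverse h)" unfolding D_def using h0 L0 by (intro real_sqrt_pow2 mult_nonneg_nonneg) auto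
  have D2': "2 ^ \<rho> * (real q / 2 ^ q) \<le> 2 * D\<^sup>2"
    unfolding D2 using L h0 mult_left_mono[OF L, of "4 * h"] by (simp add: h_def)
  have D0: "0 < D" unfolding D_def using h0 less_le_trans[OF _ L, of 0] q0 by (intro real_sqrt_gt_zero mult_pos_pos) auto
  have SD: "S \<le> sqrt (2 / 2 ^ \<rho>) * D"
  proof -
    have "real q / 2 ^ q \<le> 2 / 2 ^ \<rho> * D\<^sup>2" using D2' by (simp add: field_simps)
    then have "S \<le> sqrt (2 / 2 ^ \<rho> * D\<^sup>2)" unfolding S_def by (rule real_sqrt_le_mono)
    also have "\<dots> = sqrt (2 / 2 ^ \<rho>) * D"
      unfolding real_sqrt_mult using D0 by (simp only: real_sqrt_abs abs_of_pos)
    finally show ?thesis .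
  qed
  have \<sigma>S: "2 ^ \<rho> * \<sigma> \<le> S"
  proof -
    have "(2 ^ \<rho> :: real)\<^sup>2 = 4 ^ \<rho>" by (simp add: power2_eq_square flip: power_mult_distrib)
    then have "(2 ^ \<rho> * \<sigma>)\<^sup>2 = 4 ^ \<rho> / 2 ^ q"
      by (simp add: \<sigma>_def power_mult_distrib real_sqrt_divide power_divide)
    also have "\<dots> \<le> real q / 2 ^ q"
    proof (rule divide_right_mono)
      have "real (4 ^ \<rho>) \<le> real q" using q(1) by (simp only: of_nat_le_iff)
      then show "4 ^ \<rho> \<le> real q" by simp
    qed simp
    finally show ?thesis unfolding S_def by (rule real_le_rsqrt)
  qed
  define k where "k = nat \<lfloor>s * 2 ^ \<rho>\<rfloor>"
  have s0: "0 \<le> s" "s \<le> 1" using s by auto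
  have k: "dy \<rho> k \<le> s" "s < dy \<rho> (Suc k)" unfolding k_def using dyadic_floor_bounds[OF s0(1)] by auto
  have "dy \<rho> k \<le> 1" using k(1) s0(2) by (rule order_trans)
  then have k2: "k \<le> 2 ^ \<rho>" by (simp add: dy_def divide_le_eq)
  have sh: "s * h = s * 2 ^ \<rho> / 2 ^ q" by (simp add: h_def)
  have 1: "dy q (i + k) \<le> t + s * h"
  proof -
    have "real k \<le> s * 2 ^ \<rho>" using k(1) by (simp add: dy_def field_simps)
    then have "real k / 2 ^ q \<le> s * h" unfolding sh by (rule divide_right_mono) simp
    then show ?thesis using t by (simp add: dy_def add_divide_distrib)
  qed
  have 2: "t + s * h \<le> dy q (i + k + 2)"
  proof -
    have "s * 2 ^ \<rho> \<le> real k + 1" using k(2) by (simp add: dy_def field_simps)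
    then have "s * h \<le> (real k + 1) / 2 ^ q" unfolding sh by (rule divide_right_mono) simp
    then show ?thesis using t by (simp add: dy_def add_divide_distrib)
  qed
  have 3: "t + s * h \<le> 1"
  proof -
    have "t + s * h \<le> dy q (Suc i) + 1 * h" using t s0 h0 by (intro add_mono mult_right_mono) auto
    also have "\<dots> = dy q (i + 2 ^ \<rho> + 1)" by (simp add: dy_def h_def add_divide_distrib)
    also have "\<dots> \<le> 1" using i by (rule dy_le_1)
    finally show ?thesis .
  qed
  have n1: "\<bar>x (t + s * h) - x (dy q (i + k))\<bar> \<le> 48 * S"
    using dyadic_modulus_near[OF mod 1 2 3] k2 i by (simp add: S_def)
  have n2: "\<bar>x t - x (dy q i)\<bar> \<le> 16 * S"
    using mod t i unfolding dyadic_modulus_def S_def by auto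
  have grid: "x (dy q (i + k)) - x (dy q i) \<in> {D * f (dy \<rho> k) .. D * f (dy \<rho> k) + real k * \<sigma>}"
    using good_cell_grid[OF good f0 k2] unfolding D_def h_def[symmetric] ih \<sigma>_def .
  have "real k \<le> real (2 ^ \<rho>)" using k2 by (simp only: of_nat_le_iff)
  then have "real k * \<sigma> \<le> 2 ^ \<rho> * \<sigma>" by (intro mult_right_mono) (auto simp: \<sigma>_def)
  then have k\<sigma>: "real k * \<sigma> \<le> S" using \<sigma>S by linarith
  have "\<bar>f s - f (dy \<rho> k)\<bar> \<le> w"
  proof (rule osc[OF s])
    show "dy \<rho> k \<in> {0..1}" using k(1) s0 by (simp add: \<open>dy \<rho> k \<le> 1\<close>)
    show "\<bar>s - dy \<rho> k\<bar> \<le> 1 / 2 ^ \<rho>" using k by (simp add: dy_Suc)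
  qed
  then have "D * \<bar>f s - f (dy \<rho> k)\<bar> \<le> D * w" using D0 by (intro mult_left_mono) auto
  then have fw: "\<bar>D * f s - D * f (dy \<rho> k)\<bar> \<le> D * w"
    using D0 by (simp add: abs_mult right_diff_distrib[symmetric])
  have "\<bar>(x (t + s * h) - x t) - D * f s\<bar> \<le> 65 * S + D * w"
    using n1 n2 grid k\<sigma> fw unfolding atLeastAtMost_iff by linarith
  also have "\<dots> \<le> D * (65 * sqrt (2 / 2 ^ \<rho>) + w)" using SD by (simp add: algebra_simps)
  finally have "\<bar>(x (t + s * h) - x t) - D * f s\<bar> / D \<le> 65 * sqrt (2 / 2 ^ \<rho>) + w"
    using D0 by (simp add: pos_divide_le_eq mult.commute)
  moreover have "(x (t + s * h) - x t) / D - f s = ((x (t + s * h) - x t) - D * f s) / D"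
    using D0 by (simp add: field_simps)
  ultimately show ?thesis using D0 by (simp add: D_def[symmetric])
qed

section \<open>Measures carried by nested unions of dyadic cells\<close>

lemma cell_transform_integral:
  "has_bochner_integral lborel (\<lambda>x. indicator {dy q i..dy q (Suc i)} x *\<^sub>R iexp (u * x)) (cell_transform q i u)"
proof (cases "u = 0")
  case True
  have "has_bochner_integral lborel (\<lambda>x. indicator {dy q i..dy q (Suc i)} x *\<^sub>R (1::complex)) (measure lborel {dy q i..dy q (Suc i)} *\<^sub>R 1)"
    by (rule has_bochner_integral_indicator) auto
  then show ?thesis using True by (simp add: cell_transform_def dy_Suc scaleR_conv_of_real)
next
  case False
  have "has_bochner_integral lborel (\<lambda>x. indicator {dy q i..dy q (Suc i)} x *\<^sub>R iexp (u * x))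
     (iexp (u * dy q (Suc i)) / (\<i> * complex_of_real u) - iexp (u * dy q i) / (\<i> * complex_of_real u))"
  proof (rule has_bochner_integral_FTC_Icc)
    show "dy q i \<le> dy q (Suc i)" by simp
    fix x
    have "((\<lambda>x. iexp (u * x)) has_vector_derivative (u *\<^sub>R (\<i> * iexp (u * x)))) (at x within {dy q i..dy q (Suc i)})"
    proof -
      have "((iexp \<circ> (\<lambda>x. u * x)) has_vector_derivative (u *\<^sub>R (\<i> * iexp (u * x)))) (at x within {dy q i..dy q (Suc i)})"
        by (rule vector_diff_chain_within) (auto intro!: derivative_eq_intros has_vector_derivative_iexp simp: has_real_derivative_iff_has_vector_derivative[symmetric])
      then show ?thesis by (simp add: comp_def)
    qed
    then have "((\<lambda>x. iexp (u * x) / (\<i> * complex_of_real u)) has_vector_derivative (u *\<^sub>R (\<i> * iexp (u * x))) / (\<i> * complex_of_real u)) (at x within {dy q i..dy q (Suc i)})"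
      by (rule has_vector_derivative_divide)
    moreover have "(u *\<^sub>R (\<i> * iexp (u * x))) / (\<i> * complex_of_real u) = iexp (u * x)"
      using False by (simp add: scaleR_conv_of_real)
    ultimately show "((\<lambda>x. iexp (u * x) / (\<i> * complex_of_real u)) has_vector_derivative iexp (u * x)) (at x within {dy q i..dy q (Suc i)})" by simp
  qed (intro continuous_intros)
  then show ?thesis using False by (simp add: cell_transform_def diff_divide_distrib)
qed

text \<open>The deterministic half of the lower bound. The measures behind \<open>\<Psi>\<close> are
  not normalised; \<open>close\<close> at frequency 0 keeps their masses within 1/2 of the initial
  mass 1. The bound a < 2 makes 1 / |u| negligible against the target decay.\<close>

locale cell_scheme =
  fixes Q :: "nat \<Rightarrow> nat" and A :: "nat \<Rightarrow> nat set" and c :: "nat \<Rightarrow> real" and \<Psi> :: "nat \<Rightarrow> real \<Rightarrow> complex" and a :: real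
  defines "\<Psi> m u \<equiv> complex_of_real (c m) * (\<Sum>i\<in>A m. cell_transform (Q m) i u)"
  assumes a: "0 < a" "a < 2"
    and c: "\<And>m. 0 < c m"
    and A: "\<And>m. A m \<subseteq> {..<2 ^ Q m}"
    and Q: "\<And>m. Q m \<le> Q (Suc m)"
    and nested: "\<And>m i. i \<in> A (Suc m) \<Longrightarrow> i div 2 ^ (Q (Suc m) - Q m) \<in> A m"
    and init: "\<Psi> 0 0 = 1"
    and close: "\<And>m u. cmod (\<Psi> (Suc m) u - \<Psi> m u) \<le> (1/2) ^ (m + 2) * decay_weight a u"
begin

lemma decay_weight_0: "decay_weight a 0 = 1" "0 \<le> decay_weight a u"
  by (simp_all add: decay_weight_def)

lemma A_finite: "finite (A m)"
  using A finite_subset by blast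

lemma close_general: "cmod (\<Psi> (n + d) u - \<Psi> n u) \<le> ((1/2) ^ (n + 1) - (1/2) ^ (n + d + 1)) * decay_weight a u"
proof (induction d)
  case (Suc d)
  have "cmod (\<Psi> (n + Suc d) u - \<Psi> n u) \<le> cmod (\<Psi> (Suc (n + d)) u - \<Psi> (n + d) u) + cmod (\<Psi> (n + d) u - \<Psi> n u)"
    using norm_triangle_ineq[of "\<Psi> (Suc (n + d)) u - \<Psi> (n + d) u" "\<Psi> (n + d) u - \<Psi> n u"] by simp
  also have "\<dots> \<le> (1/2) ^ (n + d + 2) * decay_weight a u + ((1/2) ^ (n + 1) - (1/2) ^ (n + d + 1)) * decay_weight a u"
    by (intro add_mono close Suc)
  also have "\<dots> = ((1/2) ^ (n + 1) - (1/2) ^ (n + Suc d + 1)) * decay_weight a u" by (simp add: algebra_simps)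
  finally show ?case .
qed simp

lemma close_le: "n \<le> l \<Longrightarrow> cmod (\<Psi> l u - \<Psi> n u) \<le> (1/2) ^ (n + 1) * decay_weight a u"
proof -
  assume "n \<le> l"
  then obtain d where l: "l = n + d" using le_Suc_ex by blast
  have "cmod (\<Psi> l u - \<Psi> n u) \<le> ((1/2) ^ (n + 1) - (1/2) ^ (n + d + 1)) * decay_weight a u"
    unfolding l by (rule close_general)
  also have "\<dots> \<le> (1/2) ^ (n + 1) * decay_weight a u" by (intro mult_right_mono decay_weight_0) simp
  finally show ?thesis .
qed

definition mass :: "nat \<Rightarrow> real" where
  "mass m = c m * real (card (A m)) / 2 ^ Q m"

lemma Psi_0: "\<Psi> m 0 = complex_of_real (mass m)"
  by (simp add: \<Psi>_def mass_def cell_transform_def)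

lemma mass_ge: "1 / 2 \<le> mass m"
proof -
  have "cmod (\<Psi> m 0 - \<Psi> 0 0) \<le> (1/2) ^ (0 + 1) * decay_weight a 0" by (rule close_le) simp
  then have "cmod (complex_of_real (mass m - 1)) \<le> 1 / 2"
    by (simp add: init decay_weight_0 Psi_0[of m])
  then have "\<bar>mass m - 1\<bar> \<le> 1 / 2" by (simp only: norm_of_real)
  then show ?thesis by linarith
qed

definition dens :: "nat \<Rightarrow> real \<Rightarrow> real" where
  "dens m x = c m / mass m * (\<Sum>i\<in>A m. indicator {dy (Q m) i..dy (Q m) (Suc i)} x)"

definition stage :: "nat \<Rightarrow> real measure" where
  "stage m = density lborel (\<lambda>x. ennreal (dens m x))"

text \<open>Closed cells make the limit set compact; their common end points are null for the
  densities.\<close>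

definition cells :: "nat \<Rightarrow> real set" where
  "cells m = (\<Union>i\<in>A m. {dy (Q m) i..dy (Q m) (Suc i)})"

lemma dens_nonneg: "0 \<le> dens m x"
  unfolding dens_def using c[of m] mass_ge[of m] by (intro mult_nonneg_nonneg sum_nonneg) auto

lemma dens_measurable [measurable]: "dens m \<in> borel_measurable borel"
  unfolding dens_def[abs_def] by measurable

lemma dens_integral:
  "has_bochner_integral lborel (\<lambda>x. dens m x *\<^sub>R iexp (u * x)) (\<Psi> m u / complex_of_real (mass m))"
proof -
  have "has_bochner_integral lborel (\<lambda>x. (c m / mass m) *\<^sub>R (\<Sum>i\<in>A m. indicator {dy (Q m) i..dy (Q m) (Suc i)} x *\<^sub>R iexp (u * x)))
      ((c m / mass m) *\<^sub>R (\<Sum>i\<in>A m. cell_transform (Q m) i u))"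
    by (intro has_bochner_integral_scaleR_right has_bochner_integral_sum cell_transform_integral)
  moreover have "(c m / mass m) *\<^sub>R (\<Sum>i\<in>A m. indicator {dy (Q m) i..dy (Q m) (Suc i)} x *\<^sub>R iexp (u * x)) = dens m x *\<^sub>R iexp (u * x)" for x
    by (simp only: dens_def scaleR_sum_left[symmetric] scaleR_scaleR)
  moreover have "(c m / mass m) *\<^sub>R (\<Sum>i\<in>A m. cell_transform (Q m) i u) = \<Psi> m u / complex_of_real (mass m)"
    by (simp add: \<Psi>_def scaleR_conv_of_real)
  ultimately show ?thesis by (simp only:)
qed

lemma dens_total: "has_bochner_integral lborel (dens m) 1"
proof -
  have "has_bochner_integral lborel (\<lambda>x. complex_of_real (dens m x)) (complex_of_real 1)"
    using dens_integral[of m 0] mass_ge[of m] by (simp add: Psi_0 scaleR_conv_of_real)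
  then have "has_bochner_integral lborel (\<lambda>x. Re (complex_of_real (dens m x))) (Re (complex_of_real 1))"
    by (rule has_bochner_integral_Re)
  then show ?thesis by simp
qed

lemma stage_sets [measurable_cong, simp]: "sets (stage m) = sets borel"
  by (simp add: stage_def)

lemma stage_space [simp]: "space (stage m) = UNIV"
  by (simp add: stage_def)

lemma stage_real_distribution: "real_distribution (stage m)"
proof -
  have "emeasure (stage m) (space (stage m)) = (\<integral>\<^sup>+x. ennreal (dens m x) \<partial>lborel)"
    by (simp add: stage_def emeasure_density)
  also have "\<dots> = 1"
    using dens_total[of m] dens_nonneg[of m]
    by (subst nn_integral_eq_integral) (auto simp: has_bochner_integral_iff)
  finally have "prob_space (stage m)" by (rule prob_spaceI)
  then show ?thesis by (simp add: real_distribution_def real_distribution_axioms_def)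
qed

lemma char_stage: "char (stage m) u = \<Psi> m u / complex_of_real (mass m)"
proof -
  have "char (stage m) u = (\<integral>x. dens m x *\<^sub>R iexp (u * x) \<partial>lborel)"
    unfolding char_def stage_def by (rule integral_density) (auto simp: dens_nonneg)
  also have "\<dots> = \<Psi> m u / complex_of_real (mass m)"
    by (rule has_bochner_integral_integral_eq[OF dens_integral])
  finally show ?thesis .
qed

lemma cells_closed: "closed (cells m)"
  unfolding cells_def using A_finite by (intro closed_UN) auto

lemma cells_subset: "cells m \<subseteq> {0..1}"
proof
  fix x assume "x \<in> cells m"
  then obtain i where i: "i \<in> A m" "dy (Q m) i \<le> x" "x \<le> dy (Q m) (Suc i)" by (auto simp: cells_def)
  have "0 \<le> x" by (rule order_trans[OF dy_nonneg i(2)])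
  moreover have "dy (Q m) (Suc i) \<le> 1" using i(1) A[of m] by (intro dy_le_1) auto
  ultimately show "x \<in> {0..1}" using order_trans[OF i(3)] by simp
qed

lemma cells_Suc: "cells (Suc m) \<subseteq> cells m"
proof
  fix x assume "x \<in> cells (Suc m)"
  then obtain i where i: "i \<in> A (Suc m)" "dy (Q (Suc m)) i \<le> x" "x \<le> dy (Q (Suc m)) (Suc i)" by (auto simp: cells_def)
  define d where "d = Q (Suc m) - Q m"
  have Qd: "Q (Suc m) = Q m + d" using Q[of m] by (simp add: d_def)
  define k where "k = i div 2 ^ d"
  have kA: "k \<in> A m" unfolding k_def d_def by (rule nested[OF i(1)])
  have "k * 2 ^ d \<le> i" "Suc i \<le> Suc k * 2 ^ d"
    using dividend_less_div_times[of "2 ^ d" i] by (simp_all add: k_def div_times_less_eq_dividend)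
  then have "dy (Q m + d) (k * 2 ^ d) \<le> dy (Q m + d) i" "dy (Q m + d) (Suc i) \<le> dy (Q m + d) (Suc k * 2 ^ d)"
    by (simp_all only: dy_le_iff)
  then have "dy (Q m) k \<le> x" "x \<le> dy (Q m) (Suc k)"
    using i(2,3) unfolding Qd dy_refine by (auto intro: order_trans)
  then show "x \<in> cells m" using kA by (auto simp: cells_def)
qed

lemma cells_mono: "m \<le> l \<Longrightarrow> cells l \<subseteq> cells m"
  by (rule lift_Suc_antimono_le[of cells]) (use cells_Suc in auto)

lemma AE_stage_cells: "m \<le> l \<Longrightarrow> AE x in stage l. x \<in> cells m"
proof -
  assume ml: "m \<le> l"
  have "0 < dens l x \<Longrightarrow> x \<in> cells l" for x
  proof (rule ccontr)
    assume "0 < dens l x" "x \<notin> cells l"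
    then show False by (simp add: dens_def cells_def)
  qed
  then show ?thesis
    unfolding stage_def using cells_mono[OF ml] by (subst AE_density) (auto intro!: AE_I2)
qed

lemma cells_nonempty: "cells m \<noteq> {}"
proof
  assume "cells m = {}"
  then have "A m = {}" by (auto simp: cells_def)
  then show False using mass_ge[of m] by (simp add: mass_def)
qed

text \<open>All stages live on [0,1], so a subsequence converges weakly and the transforms converge
  pointwise. Each stage n bounds the limit by (1/2)^n times the weight plus a multiple of 1 / |u|,
  and the latter is negligible at infinity; letting n grow gives the little-o.\<close>

lemma M_set_limit: "M_set (a / 2) (\<Inter>m. cells m)"
proof -
  have "tight stage"
    unfolding tight_def
  proof (intro conjI allI impI)
    show "real_distribution (stage n)" for n by (rule stage_real_distribution)
    fix \<epsilon> :: real assume \<epsilon>: "0 < \<epsilon>"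
    have "measure (stage n) {-1<..1} = 1" for n
    proof -
      interpret real_distribution "stage n" by (rule stage_real_distribution)
      have "AE x in stage n. x \<in> {-1<..1}"
        using AE_stage_cells[OF order_refl, of n] cells_subset[of n] by (auto elim!: eventually_mono)
      then show ?thesis by (simp add: prob_eq_1)
    qed
    then show "\<exists>a b. a < b \<and> (\<forall>n. 1 - \<epsilon> < measure (stage n) {a<..b})"
      using \<epsilon> by (intro exI[of _ "-1"] exI[of _ 1]) auto
  qed
  then obtain r \<mu> where r: "strict_mono r" and \<mu>: "real_distribution \<mu>" and conv: "weak_conv_m (stage \<circ> id \<circ> r) \<mu>"
    using tight_imp_convergent_subsubsequence[of stage id] strict_mono_id by auto
  interpret \<mu>: real_distribution \<mu> by (rule \<mu>)
  have conv': "weak_conv_m (\<lambda>n. stage (r n)) \<mu>" using conv by (simp add: comp_def)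
  have rd: "real_distribution (stage (r n))" for n by (rule stage_real_distribution)
  have chars: "(\<lambda>n. char (stage (r n)) u) \<longlonglongrightarrow> char \<mu> u" for u
    by (rule levy_continuity1[OF rd \<mu> conv'])
  have rn: "n \<le> r n" for n using r by (rule strict_mono_imp_increasing)
  have AEc: "AE x in \<mu>. x \<in> cells m" for m
  proof -
    \<comment> \<open>A bounded continuous function vanishing exactly on the closed set
      \<open>cells m\<close>; its integrals against late stages are 0, hence so is the integral
      against the limit.\<close>
    define \<phi> where "\<phi> x = min 1 (infdist x (cells m))" for x
    have \<phi>m[measurable]: "\<phi> \<in> borel_measurable borel"
      unfolding \<phi>_def[abs_def] by (intro borel_measurable_continuous_onI continuous_intros)
    have \<phi>0: "0 \<le> \<phi> x" "\<phi> x \<le> 1" for x by (auto simp: \<phi>_def infdist_nonneg)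
    have lim: "(\<lambda>n. integral\<^sup>L (stage (r n)) \<phi>) \<longlonglongrightarrow> integral\<^sup>L \<mu> \<phi>"
    proof (rule weak_conv_imp_integral_bdd_continuous_conv[OF rd \<mu> conv'])
      show "isCont \<phi> x" for x unfolding \<phi>_def[abs_def] by (intro continuous_intros)
      show "norm (\<phi> x) \<le> 1" for x using \<phi>0[of x] by simp
    qed
    have "integral\<^sup>L (stage (r n)) \<phi> = 0" if "m \<le> n" for n
    proof -
      have "AE x in stage (r n). \<phi> x = 0"
        using AE_stage_cells[OF order_trans[OF that rn]] by eventually_elim (simp add: \<phi>_def)
      then show ?thesis by (rule integral_eq_zero_AE)
    qed
    then have "eventually (\<lambda>n. integral\<^sup>L (stage (r n)) \<phi> = 0) sequentially" by (auto simp: eventually_sequentially)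
    then have "(\<lambda>n. integral\<^sup>L (stage (r n)) \<phi>) \<longlonglongrightarrow> 0" by (rule tendsto_eventually)
    with lim have "integral\<^sup>L \<mu> \<phi> = 0" by (rule LIMSEQ_unique)
    moreover have "integrable \<mu> \<phi>"
      by (rule \<mu>.integrable_const_bound[of _ 1]) (use \<phi>0 in auto)
    ultimately have "AE x in \<mu>. \<phi> x = 0"
      using \<phi>0 by (subst (asm) integral_nonneg_eq_0_iff_AE) auto
    then show ?thesis
    proof eventually_elim
      case (elim x)
      then have "infdist x (cells m) = 0" using infdist_nonneg[of x "cells m"] by (auto simp: \<phi>_def min_def split: if_splits)
      then show ?case using in_closed_iff_infdist_zero[OF cells_closed cells_nonempty] by blast
    qed
  qed
  define K where "K = (\<Inter>m. cells m)"
  have Kc: "closed K" unfolding K_def by (intro closed_INT ballI cells_closed)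
  have Kcomp: "compact K"
    using Kc cells_subset[of 0] bounded_subset[of "{0..1::real}" K] by (auto simp: compact_eq_bounded_closed K_def)
  have AEK: "AE x in \<mu>. x \<in> K" using AEc by (simp add: K_def AE_all_countable)
  have Kb: "K \<in> sets \<mu>" using Kc by simp
  have mK: "emeasure \<mu> K = 1"
    using AEK Kb by (subst \<mu>.emeasure_eq_1_AE) auto
  have mK': "emeasure \<mu> (- K) = 0"
  proof -
    have "emeasure \<mu> (space \<mu> - K) = emeasure \<mu> (space \<mu>) - emeasure \<mu> K"
      by (rule emeasure_compl) (use Kb mK in auto)
    then show ?thesis using \<mu>.emeasure_space_1 by (simp add: mK Compl_eq_Diff_UNIV)
  qed
  \<comment> \<open>Each cell transform is at most 2 / |u|, so C n / |u| bounds
    \<open>\<Psi> n\<close>; the further factor 2 in \<open>cb\<close> comes from dividing by masses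
    of at least 1/2.\<close>
  define C where "C n = c n * real (card (A n)) * 2" for n
  have C0: "0 \<le> C n" for n unfolding C_def using c[of n] by simp
  have cb: "cmod (char \<mu> u) \<le> (1/2) ^ n * decay_weight a u + 2 * (C n / \<bar>u\<bar>)" if u: "u \<noteq> 0" for n u
  proof (rule tendsto_upperbound)
    show "(\<lambda>l. cmod (char (stage (r l)) u)) \<longlonglongrightarrow> cmod (char \<mu> u)" by (intro tendsto_norm chars)
    show "eventually (\<lambda>l. cmod (char (stage (r l)) u) \<le> (1/2) ^ n * decay_weight a u + 2 * (C n / \<bar>u\<bar>)) sequentially"
      unfolding eventually_sequentially
    proof (intro exI allI impI)
      fix l assume l: "n \<le> l"
      have "cmod (\<Psi> n u) \<le> c n * (\<Sum>i\<in>A n. 2 / \<bar>u\<bar>)"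
        unfolding \<Psi>_def norm_mult using c[of n] u
        by (intro mult_mono order_trans[OF norm_sum] sum_mono cell_transform_bounds) auto
      also have "\<dots> = C n / \<bar>u\<bar>" by (simp add: C_def)
      finally have 1: "cmod (\<Psi> n u) \<le> C n / \<bar>u\<bar>" .
      have 2: "cmod (\<Psi> (r l) u - \<Psi> n u) \<le> (1/2) ^ (n + 1) * decay_weight a u"
        by (rule close_le) (use l rn[of l] in linarith)
      have 3: "cmod (\<Psi> (r l) u) \<le> (1/2) ^ (n + 1) * decay_weight a u + C n / \<bar>u\<bar>"
        using 1 2 norm_triangle_sub[of "\<Psi> (r l) u" "\<Psi> n u"] by linarith
      have "cmod (char (stage (r l)) u) = cmod (\<Psi> (r l) u) / mass (r l)"
        using mass_ge[of "r l"] by (simp add: char_stage norm_divide)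
      also have "\<dots> \<le> cmod (\<Psi> (r l) u) / (1 / 2)"
        using mass_ge[of "r l"] by (intro divide_left_mono) auto
      also have "\<dots> \<le> ((1/2) ^ (n + 1) * decay_weight a u + C n / \<bar>u\<bar>) / (1 / 2)"
        using 3 by (rule divide_right_mono) simp
      finally show "cmod (char (stage (r l)) u) \<le> (1/2) ^ n * decay_weight a u + 2 * (C n / \<bar>u\<bar>)" by (simp add: mult.commute)
    qed
  qed simp
  have o: "(\<lambda>u. norm (char \<mu> u)) \<in> o[at_infinity](\<lambda>u. \<bar>u\<bar> powr (- (a / 2)))"
  proof (rule landau_o.smallI)
    fix \<epsilon> :: real assume \<epsilon>: "0 < \<epsilon>"
    obtain n where n: "(1/2::real) ^ n < \<epsilon> / 2" using real_arch_pow_inv[of "\<epsilon> / 2" "1/2"] \<epsilon> by auto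
    \<comment> \<open>Beyond b the term 2 C n / |u| is at most (\<epsilon> / 2) |u|^(-a/2).\<close>
    define b where "b = max 1 ((4 * C n / \<epsilon>) powr (1 / (1 - a / 2)))"
    show "eventually (\<lambda>u. norm (norm (char \<mu> u)) \<le> \<epsilon> * norm (\<bar>u\<bar> powr (- (a / 2)))) at_infinity"
      unfolding eventually_at_infinity
    proof (intro exI allI impI)
      fix u :: real assume "b \<le> norm u"
      then have u: "1 \<le> \<bar>u\<bar>" "(4 * C n / \<epsilon>) powr (1 / (1 - a / 2)) \<le> \<bar>u\<bar>" by (auto simp: b_def)
      have dw: "decay_weight a u = \<bar>u\<bar> powr (- (a / 2))" using u by (simp add: decay_weight_def max_def)
      have "4 * C n / \<epsilon> = ((4 * C n / \<epsilon>) powr (1 / (1 - a / 2))) powr (1 - a / 2)"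
        using a C0[of n] \<epsilon> by (simp add: powr_powr)
      also have "\<dots> \<le> \<bar>u\<bar> powr (1 - a / 2)" using u a by (intro powr_mono2) auto
      finally have "4 * C n / \<epsilon> * \<bar>u\<bar> powr (- 1) \<le> \<bar>u\<bar> powr (1 - a / 2) * \<bar>u\<bar> powr (- 1)" by (rule mult_right_mono) simp
      also have "\<dots> = \<bar>u\<bar> powr (- (a / 2))" by (subst powr_add[symmetric]) simp
      finally have "4 * C n / \<epsilon> / \<bar>u\<bar> \<le> \<bar>u\<bar> powr (- (a / 2))" using u by (simp add: powr_minus_divide)
      then have "\<epsilon> / 2 * (4 * C n / \<epsilon> / \<bar>u\<bar>) \<le> \<epsilon> / 2 * \<bar>u\<bar> powr (- (a / 2))"
        using \<epsilon> by (intro mult_left_mono) auto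
      moreover have "\<epsilon> / 2 * (4 * C n / \<epsilon> / \<bar>u\<bar>) = 2 * (C n / \<bar>u\<bar>)" using \<epsilon> by simp
      ultimately have "2 * (C n / \<bar>u\<bar>) \<le> \<epsilon> / 2 * \<bar>u\<bar> powr (- (a / 2))" by simp
      moreover have "(1/2) ^ n * decay_weight a u \<le> \<epsilon> / 2 * \<bar>u\<bar> powr (- (a / 2))"
        unfolding dw using n by (intro mult_right_mono) auto
      moreover have "u \<noteq> 0" using u by auto
      ultimately have "cmod (char \<mu> u) \<le> \<epsilon> / 2 * \<bar>u\<bar> powr (- (a / 2)) + \<epsilon> / 2 * \<bar>u\<bar> powr (- (a / 2))"
        using cb[of u n] by linarith
      then show "norm (norm (char \<mu> u)) \<le> \<epsilon> * norm (\<bar>u\<bar> powr (- (a / 2)))" by simp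
    qed
  qed
  show ?thesis
    unfolding M_set_def K_def[symmetric]
  proof (intro conjI exI[of _ \<mu>] Kcomp mK' o)
    show "finite_measure \<mu>" by (rule \<mu>.finite_measure_axioms)
    show "sets \<mu> = sets borel" by simp
    show "emeasure \<mu> K \<noteq> 0" by (simp add: mK)
  qed
qed

end

section \<open>The iterative construction on a fixed path\<close>

lemma sum_dyadic_block: "sum g {k * 2 ^ d..<Suc k * 2 ^ d} = (\<Sum>i<2 ^ d. g (k * 2 ^ d + i))"
  for k :: nat
  using sum.shift_bounds_nat_ivl[of g 0 "k * 2 ^ d" "2 ^ d"] by (simp add: atLeast0LessThan add.commute)

text \<open>Finitely many old cells have to be served, and on each the discrepancy tends to 0
  relative to the weight, so one sufficiently high level handles all of them together with the
  remaining growth conditions.\<close>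

lemma cell_scheme_step:
  assumes A: "finite A" "\<And>i. i \<in> A \<Longrightarrow> 2 * Suc i \<le> 2 ^ Q" and c: "0 < c" and \<epsilon>: "0 < \<epsilon>"
    and mod: "eventually (dyadic_modulus x) sequentially"
    and pos: "\<And>q. \<rho> \<le> q \<Longrightarrow> 0 < good_prob f \<rho> q"
    and disc: "\<And>k \<epsilon>. 2 * Suc k \<le> 2 ^ Q \<Longrightarrow> 0 < \<epsilon> \<Longrightarrow>
      \<exists>q0. \<forall>q\<ge>q0. \<forall>u. cmod (cell_discrepancy f \<rho> x q Q k u) \<le> \<epsilon> * decay_weight a u"
  obtains Q' A' where "Q \<le> Q'" "\<rho> < Q'" "4 ^ \<rho> \<le> Q'" "2 * \<rho> \<le> Q'" "dyadic_modulus x Q'"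
    "finite A'" "\<And>i. i \<in> A' \<Longrightarrow> 2 * Suc i \<le> 2 ^ Q'"
    "\<And>i. i \<in> A' \<Longrightarrow> i div 2 ^ (Q' - Q) \<in> A \<and> good_cell f \<rho> x Q' i"
    "\<And>u. cmod (complex_of_real (c / good_prob f \<rho> Q') * (\<Sum>i\<in>A'. cell_transform Q' i u)
        - complex_of_real c * (\<Sum>i\<in>A. cell_transform Q i u)) \<le> \<epsilon> * decay_weight a u"
proof -
  \<comment> \<open>The error is shared among the old cells after multiplication by c; the summand 1
    keeps the quotient meaningful when A is empty.\<close>
  define e where "e = \<epsilon> / (c * (real (card A) + 1))"
  have e: "0 < e" unfolding e_def using \<epsilon> c by (intro divide_pos_pos mult_pos_pos) auto
  have "eventually (\<lambda>q. \<forall>k\<in>A. \<forall>u. cmod (cell_discrepancy f \<rho> x q Q k u) \<le> e * decay_weight a u) sequentially"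
  proof (intro eventually_ball_finite A(1) ballI)
    fix k assume "k \<in> A"
    from disc[OF A(2)[OF this] e]
    show "eventually (\<lambda>q. \<forall>u. cmod (cell_discrepancy f \<rho> x q Q k u) \<le> e * decay_weight a u) sequentially"
      unfolding eventually_sequentially by blast
  qed
  moreover have "eventually (\<lambda>q. Q + Suc \<rho> + 4 ^ \<rho> + 2 * \<rho> \<le> q) sequentially" by (rule eventually_ge_at_top)
  ultimately have "eventually (\<lambda>q. (\<forall>k\<in>A. \<forall>u. cmod (cell_discrepancy f \<rho> x q Q k u) \<le> e * decay_weight a u) \<and>
      Q + Suc \<rho> + 4 ^ \<rho> + 2 * \<rho> \<le> q \<and> dyadic_modulus x q) sequentially"
    using mod by eventually_elim simp
  then obtain Q' where Q': "\<forall>k\<in>A. \<forall>u. cmod (cell_discrepancy f \<rho> x Q' Q k u) \<le> e * decay_weight a u"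
      "Q + Suc \<rho> + 4 ^ \<rho> + 2 * \<rho> \<le> Q'" "dyadic_modulus x Q'"
    using eventually_happens'[OF sequentially_bot] by blast
  define d where "d = Q' - Q"
  have Qd: "Q' = Q + d" using Q'(2) by (simp add: d_def)
  define p where "p = good_prob f \<rho> Q'"
  have p: "0 < p" unfolding p_def by (rule pos) (use Q'(2) in linarith)
  define A' where "A' = {i. i div 2 ^ d \<in> A \<and> good_cell f \<rho> x Q' i}"
  have A'2: "2 * Suc i \<le> 2 ^ Q'" if "i \<in> A'" for i
  proof -
    define k where "k = i div 2 ^ d"
    have k: "k \<in> A" using that by (simp add: A'_def k_def)
    have "i < Suc k * 2 ^ d" using dividend_less_div_times[of "2 ^ d" i] by (simp add: k_def)
    then have "2 * Suc i \<le> 2 * Suc k * 2 ^ d" by simp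
    also have "\<dots> \<le> 2 ^ Q * 2 ^ d" using A(2)[OF k] by (rule mult_right_mono) simp
    finally show ?thesis by (simp add: Qd power_add)
  qed
  have A'fin: "finite A'"
  proof (rule finite_subset)
    show "A' \<subseteq> {..<2 ^ Q'}"
    proof
      fix i assume "i \<in> A'"
      from A'2[OF this] show "i \<in> {..<2 ^ Q'}" by simp
    qed
  qed simp
  have blk: "{i\<in>A'. i div 2 ^ d = k} = {i\<in>{k * 2 ^ d..<Suc k * 2 ^ d}. good_cell f \<rho> x Q' i}" if "k \<in> A" for k
  proof -
    have "i div 2 ^ d = k \<longleftrightarrow> k * 2 ^ d \<le> i \<and> i < Suc k * 2 ^ d" for i
    proof
      assume "i div 2 ^ d = k"
      then show "k * 2 ^ d \<le> i \<and> i < Suc k * 2 ^ d"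
        using dividend_less_div_times[of "2 ^ d" i] div_times_less_eq_dividend[of i "2 ^ d"]
        by (simp add: add.commute)
    next
      assume "k * 2 ^ d \<le> i \<and> i < Suc k * 2 ^ d"
      then show "i div 2 ^ d = k" by (intro div_nat_eqI) (simp_all only: mult.commute)
    qed
    then have *: "i div 2 ^ d = k \<longleftrightarrow> i \<in> {k * 2 ^ d..<Suc k * 2 ^ d}" for i
      by (simp only: atLeastLessThan_iff)
    show ?thesis
    proof (rule set_eqI)
      fix i
      show "i \<in> {i\<in>A'. i div 2 ^ d = k} \<longleftrightarrow> i \<in> {i\<in>{k * 2 ^ d..<Suc k * 2 ^ d}. good_cell f \<rho> x Q' i}"
        unfolding mem_Collect_eq *[symmetric] A'_def using that by blast
    qed
  qed
  \<comment> \<open>The transform of an old cell is the sum over its subcells, so replacing it by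
    its good subcells with factor 1/p changes the transform by exactly the discrepancy.\<close>
  have diff: "complex_of_real (c / p) * (\<Sum>i\<in>A'. cell_transform Q' i u) - complex_of_real c * (\<Sum>i\<in>A. cell_transform Q i u)
      = complex_of_real c * (\<Sum>k\<in>A. cell_discrepancy f \<rho> x Q' Q k u)" for u
  proof -
    let ?I = "\<lambda>k. {k * 2 ^ d..<Suc k * 2 ^ d}"
    have "(\<Sum>i\<in>A'. cell_transform Q' i u) = (\<Sum>k\<in>A. \<Sum>i\<in>{i\<in>A'. i div 2 ^ d = k}. cell_transform Q' i u)"
      by (rule sum.group[symmetric, OF A'fin A(1)]) (auto simp: A'_def)
    also have "\<dots> = (\<Sum>k\<in>A. \<Sum>i\<in>?I k. if good_cell f \<rho> x Q' i then cell_transform Q' i u else 0)"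
    proof (rule sum.cong[OF refl])
      fix k assume "k \<in> A"
      then show "(\<Sum>i\<in>{i\<in>A'. i div 2 ^ d = k}. cell_transform Q' i u) = (\<Sum>i\<in>?I k. if good_cell f \<rho> x Q' i then cell_transform Q' i u else 0)"
        unfolding blk[OF \<open>k \<in> A\<close>] by (intro sum.inter_filter) simp
    qed
    finally have 1: "complex_of_real (c / p) * (\<Sum>i\<in>A'. cell_transform Q' i u)
       = complex_of_real c * (\<Sum>k\<in>A. \<Sum>i\<in>?I k. complex_of_real (if good_cell f \<rho> x Q' i then 1 / p else 0) * cell_transform Q' i u)"
      by (simp add: sum_distrib_left if_distrib[where f="\<lambda>z. _ * z"] if_distrib[where f="\<lambda>z. z * _"] if_distrib[where f=complex_of_real] cong: if_cong)
    have 2: "(\<Sum>i\<in>A. cell_transform Q i u) = (\<Sum>k\<in>A. \<Sum>i\<in>?I k. cell_transform Q' i u)"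
      unfolding sum_dyadic_block Qd cell_transform_refine ..
    have "cell_discrepancy f \<rho> x Q' Q k u = (\<Sum>i\<in>?I k. complex_of_real (if good_cell f \<rho> x Q' i then 1 / p else 0) * cell_transform Q' i u) - (\<Sum>i\<in>?I k. cell_transform Q' i u)" for k
      unfolding cell_discrepancy_def good_weight_def p_def[symmetric] d_def[symmetric] sum_subtractf[symmetric]
      by (intro sum.cong refl) (simp add: left_diff_distrib)
    then show ?thesis unfolding 1 2 by (simp add: sum_subtractf right_diff_distrib)
  qed
  show thesis
  proof (rule that[of Q' A'])
    show "Q \<le> Q'" "\<rho> < Q'" "4 ^ \<rho> \<le> Q'" "2 * \<rho> \<le> Q'" using Q'(2) by simp_all
    show "dyadic_modulus x Q'" "finite A'" by fact+
    show "2 * Suc i \<le> 2 ^ Q'" if "i \<in> A'" for i by (rule A'2[OF that])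
    show "i div 2 ^ (Q' - Q) \<in> A \<and> good_cell f \<rho> x Q' i" if "i \<in> A'" for i using that by (simp add: A'_def d_def)
    fix u
    have dw: "0 \<le> decay_weight a u" by (simp add: decay_weight_def)
    have "cmod (complex_of_real c * (\<Sum>k\<in>A. cell_discrepancy f \<rho> x Q' Q k u)) \<le> c * (\<Sum>k\<in>A. e * decay_weight a u)"
      unfolding norm_mult using c Q'(1) by (intro mult_mono order_trans[OF norm_sum] sum_mono) auto
    also have "\<dots> = (c * real (card A) * e) * decay_weight a u" by simp
    also have "\<dots> \<le> \<epsilon> * decay_weight a u"
    proof (rule mult_right_mono[OF _ dw])
      have "c * real (card A) * e \<le> c * (real (card A) + 1) * e" using c e by (intro mult_right_mono mult_left_mono) auto
      also have "\<dots> = \<epsilon>" using c by (simp add: e_def add_pos_nonneg)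
      finally show "c * real (card A) * e \<le> \<epsilon>" .
    qed
    finally show "cmod (complex_of_real (c / good_prob f \<rho> Q') * (\<Sum>i\<in>A'. cell_transform Q' i u)
        - complex_of_real c * (\<Sum>i\<in>A. cell_transform Q i u)) \<le> \<epsilon> * decay_weight a u"
      unfolding diff p_def[symmetric] .
  qed
qed

text \<open>The window parameter of stage n is n itself, so a point of the limit set sees, at scales
  tending to 0, windows in which the path follows f with errors tending to 0.\<close>

lemma M_set_subset_rapid_points:
  assumes f0: "f 0 = 0" and cont: "continuous_on {0..1} f" and a: "0 < a" "a < 2"
    and mod: "eventually (dyadic_modulus x) sequentially"
    and pos: "\<And>\<rho> q. \<rho> \<le> q \<Longrightarrow> 0 < good_prob f \<rho> q"
    and disc: "\<And>\<rho> m k \<epsilon>. 2 * Suc k \<le> 2 ^ m \<Longrightarrow> 0 < \<epsilon> \<Longrightarrow>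
      \<exists>q0. \<forall>q\<ge>q0. \<forall>u. cmod (cell_discrepancy f \<rho> x q m k u) \<le> \<epsilon> * decay_weight a u"
  obtains K where "M_set (a / 2) K" "K \<subseteq> rapid_points f x"
proof -
  \<comment> \<open>The initial state is twice Lebesgue measure on [0, 1/2], of mass 1. The
    condition on A keeps every later cell in this half.\<close>
  define P :: "nat \<Rightarrow> nat \<times> nat set \<times> real \<Rightarrow> bool" where
    "P n = (\<lambda>(Q, A, c). finite A \<and> (\<forall>i\<in>A. 2 * Suc i \<le> 2 ^ Q) \<and> 0 < c \<and> (n = 0 \<longrightarrow> Q = 1 \<and> A = {0} \<and> c = 2))" for n
  define R :: "nat \<Rightarrow> nat \<times> nat set \<times> real \<Rightarrow> nat \<times> nat set \<times> real \<Rightarrow> bool" where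
    "R n = (\<lambda>(Q, A, c) (Q', A', c'). Q \<le> Q' \<and> n < Q' \<and> 4 ^ n \<le> Q' \<and> 2 * n \<le> Q' \<and> dyadic_modulus x Q' \<and>
       (\<forall>i\<in>A'. i div 2 ^ (Q' - Q) \<in> A \<and> good_cell f n x Q' i) \<and>
       (\<forall>u. cmod (complex_of_real c' * (\<Sum>i\<in>A'. cell_transform Q' i u) - complex_of_real c * (\<Sum>i\<in>A. cell_transform Q i u))
          \<le> (1/2) ^ (n + 2) * decay_weight a u))" for n
  have "\<exists>g. \<forall>n. P n (g n) \<and> R n (g n) (g (Suc n))"
  proof (rule dependent_nat_choice)
    have "P 0 (1, {0}, 2)" by (simp add: P_def)
    then show "\<exists>s. P 0 s" by blast
    fix s n assume "P n s"
    then obtain Q A c where s: "s = (Q, A, c)" and A: "finite A" "\<And>i. i \<in> A \<Longrightarrow> 2 * Suc i \<le> 2 ^ Q" and c: "0 < c"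
      by (cases s) (auto simp: P_def)
    have \<epsilon>: "0 < (1/2::real) ^ (n + 2)" by simp
    obtain Q' A' where *: "Q \<le> Q'" "n < Q'" "4 ^ n \<le> Q'" "2 * n \<le> Q'" "dyadic_modulus x Q'"
      "finite A'" "\<And>i. i \<in> A' \<Longrightarrow> 2 * Suc i \<le> 2 ^ Q'"
      "\<And>i. i \<in> A' \<Longrightarrow> i div 2 ^ (Q' - Q) \<in> A \<and> good_cell f n x Q' i"
      "\<And>u. cmod (complex_of_real (c / good_prob f n Q') * (\<Sum>i\<in>A'. cell_transform Q' i u)
        - complex_of_real c * (\<Sum>i\<in>A. cell_transform Q i u)) \<le> (1/2) ^ (n + 2) * decay_weight a u"
      by (rule cell_scheme_step[OF A c \<epsilon> mod pos disc, of n]) blast+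
    have "P (Suc n) (Q', A', c / good_prob f n Q')" unfolding P_def using * c pos[of n Q'] by auto
    moreover have "R n s (Q', A', c / good_prob f n Q')" unfolding R_def s using * by auto
    ultimately show "\<exists>s'. P (Suc n) s' \<and> R n s s'" by blast
  qed
  then obtain g where g: "\<And>n. P n (g n)" "\<And>n. R n (g n) (g (Suc n))" by blast
  define Q A c where "Q n = fst (g n)" and "A n = fst (snd (g n))" and "c n = snd (snd (g n))" for n
  have gn: "g n = (Q n, A n, c n)" for n by (simp add: Q_def A_def c_def)
  have P: "finite (A n)" "\<And>i. i \<in> A n \<Longrightarrow> 2 * Suc i \<le> 2 ^ Q n" "0 < c n" for n
    using g(1)[of n] by (auto simp: gn P_def)
  have P0: "Q 0 = 1" "A 0 = {0}" "c 0 = 2" using g(1)[of 0] by (auto simp: gn P_def)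
  have R: "Q n \<le> Q (Suc n)" "n < Q (Suc n)" "4 ^ n \<le> Q (Suc n)" "2 * n \<le> Q (Suc n)" "dyadic_modulus x (Q (Suc n))"
    "\<And>i. i \<in> A (Suc n) \<Longrightarrow> i div 2 ^ (Q (Suc n) - Q n) \<in> A n \<and> good_cell f n x (Q (Suc n)) i"
    "\<And>u. cmod (complex_of_real (c (Suc n)) * (\<Sum>i\<in>A (Suc n). cell_transform (Q (Suc n)) i u) - complex_of_real (c n) * (\<Sum>i\<in>A n. cell_transform (Q n) i u))
          \<le> (1/2) ^ (n + 2) * decay_weight a u" for n
    using g(2)[of n] by (auto simp: gn R_def)
  interpret S: cell_scheme Q A c "\<lambda>m u. complex_of_real (c m) * (\<Sum>i\<in>A m. cell_transform (Q m) i u)" a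
  proof (unfold_locales)
    show "A m \<subseteq> {..<2 ^ Q m}" for m
    proof
      fix i assume "i \<in> A m"
      from P(2)[OF this] show "i \<in> {..<2 ^ Q m}" by simp
    qed
    show "complex_of_real (c 0) * (\<Sum>i\<in>A 0. cell_transform (Q 0) i 0) = 1"
      by (simp add: P0 cell_transform_def)
  qed (use a P R in auto)
  show thesis
  proof (rule that[OF S.M_set_limit])
    show "(\<Inter>m. S.cells m) \<subseteq> rapid_points f x"
    proof
      fix t assume t: "t \<in> (\<Inter>m. S.cells m)"
      have "t \<in> S.cells 0" using t by blast
      then have t01: "0 \<le> t" "t \<le> 1 / 2" by (auto simp: S.cells_def P0 dy_def)
      show "t \<in> rapid_points f x"
      proof (rule rapid_pointsI)
        show "0 \<le> t" "t < 1" using t01 by auto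
        fix \<epsilon> h0 :: real assume \<epsilon>: "0 < \<epsilon>" and h0: "0 < h0"
        have "uniformly_continuous_on {0..1} f" by (rule compact_uniformly_continuous[OF cont]) simp
        then obtain \<delta> where \<delta>: "0 < \<delta>" "\<And>s s'. s \<in> {0..1} \<Longrightarrow> s' \<in> {0..1} \<Longrightarrow> dist s' s < \<delta> \<Longrightarrow> dist (f s') (f s) < \<epsilon> / 2"
          unfolding uniformly_continuous_on_def using \<epsilon> by (metis half_gt_zero)
        have l0: "(\<lambda>n. (1/2::real) ^ n) \<longlonglongrightarrow> 0" by (rule LIMSEQ_power_zero) simp
        have l1: "(\<lambda>n. 65 * sqrt (2 * (1/2) ^ n)) \<longlonglongrightarrow> 65 * sqrt (2 * 0)" by (intro tendsto_intros l0)
        have "eventually (\<lambda>n. 65 * sqrt (2 * (1/2) ^ n) < \<epsilon> / 2) sequentially"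
          by (rule order_tendstoD(2)[OF l1]) (use \<epsilon> in simp)
        moreover have "eventually (\<lambda>n. (1/2::real) ^ n < min \<delta> (min h0 (1/2))) sequentially"
          using \<delta> h0 by (intro order_tendstoD(2)[OF l0]) auto
        ultimately have "eventually (\<lambda>n. 65 * sqrt (2 * (1/2) ^ n) < \<epsilon> / 2 \<and> (1/2::real) ^ n < min \<delta> (min h0 (1/2))) sequentially"
          by eventually_elim simp
        then obtain n where n: "65 * sqrt (2 * (1/2) ^ n) < \<epsilon> / 2" "(1/2::real) ^ n < \<delta>" "(1/2::real) ^ n < h0" "(1/2::real) ^ n < 1/2"
          using eventually_happens'[OF sequentially_bot] by fastforce
        define q where "q = Q (Suc n)"
        have "t \<in> S.cells (Suc n)" using t by blast
        then obtain i where i: "i \<in> A (Suc n)" "t \<in> {dy q i..dy q (Suc i)}" by (auto simp: S.cells_def q_def)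
        have good: "good_cell f n x q i" using R(6)[OF i(1)] by (simp add: q_def)
        define h where "h = (2::real) ^ n / 2 ^ q"
        \<comment> \<open>The growth condition 2 n <= q gives h <= 2^(-n), so the windows shrink
          with the stage.\<close>
        have h: "0 < h" "h \<le> (1/2) ^ n"
        proof -
          have "(2::real) ^ (2 * n) \<le> 2 ^ q" unfolding q_def by (intro power_increasing R) simp
          then have "2 ^ n * (2 ^ n * (1/2::real) ^ n) \<le> 2 ^ q * (1/2) ^ n"
            by (simp add: mult_2 power_add mult.assoc[symmetric])
          then show "h \<le> (1/2) ^ n" by (simp add: h_def divide_le_eq mult.commute power_one_over)
        qed (simp add: h_def)
        have ile: "i + 2 ^ n + 1 \<le> 2 ^ q"
        proof -
          have "2 * Suc i \<le> 2 ^ q" unfolding q_def by (rule P(2)[OF i(1)])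
          moreover have "(2::nat) ^ Suc n \<le> 2 ^ q" unfolding q_def using R(2)[of n] by (intro power_increasing) auto
          ultimately show ?thesis by simp
        qed
        have osc: "\<bar>f s - f s'\<bar> \<le> \<epsilon> / 2" if "s \<in> {0..1}" "s' \<in> {0..1}" "\<bar>s - s'\<bar> \<le> 1 / 2 ^ n" for s s'
        proof -
          have "dist s s' < \<delta>" using that(3) n(2) by (simp add: dist_real_def power_one_over)
          from \<delta>(2)[OF that(2,1) this] show ?thesis by (simp add: dist_real_def)
        qed
        show "\<exists>h. 0 < h \<and> h < h0 \<and> h \<le> 1 - t \<and> (\<forall>s\<in>{0..1}. \<bar>(x (t + s * h) - x t) / sqrt (2 * h * ln (inverse h)) - f s\<bar> \<le> \<epsilon>)"
        proof (intro exI[of _ h] conjI ballI)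
          show "0 < h" "h < h0" "h \<le> 1 - t" using h n t01 by linarith+
          fix s :: real assume s: "s \<in> {0..1}"
          have "\<bar>(x (t + s * h) - x t) / sqrt (2 * h * ln (inverse h)) - f s\<bar> \<le> 65 * sqrt (2 / 2 ^ n) + \<epsilon> / 2"
            unfolding h_def
            by (rule good_cell_estimate[OF R(5)[of n, folded q_def] good f0 osc i(2) ile _ _ s]) (use R(3,4)[of n] in \<open>auto simp: q_def\<close>)
          also have "\<dots> \<le> \<epsilon>" using n(1) by (simp add: power_one_over)
          finally show "\<bar>(x (t + s * h) - x t) / sqrt (2 * h * ln (inverse h)) - f s\<bar> \<le> \<epsilon>" .
        qed
      qed
    qed
  qed
qed

section \<open>Dimension of the set of rapid points\<close>

lemma fourier_dim_nonneg: "0 \<le> fourier_dim E"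
proof -
  have bdd: "bdd_above (insert 0 {a. 0 < a \<and> a \<le> 1 \<and> M_set (a / 2) K})" for K
    by (rule bdd_aboveI[of _ 1]) auto
  have ge: "0 \<le> fourier_dim_compact K" for K
    unfolding fourier_dim_compact_def by (rule cSup_upper[OF _ bdd]) simp
  have le1: "fourier_dim_compact K \<le> 1" for K
    unfolding fourier_dim_compact_def by (rule cSup_least) auto
  have "0 \<le> fourier_dim_compact {}" by (rule ge)
  also have "fourier_dim_compact {} \<le> (SUP K\<in>{K. compact K \<and> K \<subseteq> E}. fourier_dim_compact K)"
  proof (rule cSUP_upper)
    show "bdd_above (fourier_dim_compact ` {K. compact K \<and> K \<subseteq> E})"
      using le1 by (intro bdd_aboveI2[of _ _ 1])
  qed simp
  finally show ?thesis using ge by (simp add: fourier_dim_def)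
qed

text \<open>Sandwich: d <= Fourier dimension <= Hausdorff dimension <= d. The bounds are required
  along the sequence 1 / (k + 1) only, so that countably many almost sure statements
  suffice.\<close>

lemma dims_eqI:
  assumes upper: "\<And>k::nat. hausdorff_measure (d + 1 / real (Suc k)) E = 0" and d: "0 \<le> d"
    and lower: "\<And>k::nat. d - 1 / real (Suc k) \<le> fourier_dim E"
  shows "fourier_dim E = d \<and> salem_set E"
proof -
  define S where "S = {s. 0 < s \<and> hausdorff_measure s E = 0}"
  have sk: "d + 1 / real (Suc k) \<in> S" for k unfolding S_def using upper[of k] d by (simp add: add_nonneg_pos)
  have fS: "fourier_dim E \<le> s" if "s \<in> S" for s using that fourier_dim_le by (auto simp: S_def)
  have bdd: "bdd_below S" using fS by (rule bdd_belowI)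
  have H: "hausdorff_dim E = Inf S" by (simp add: hausdorff_dim_def S_def)
  have fH: "fourier_dim E \<le> hausdorff_dim E"
    unfolding H by (rule cInf_greatest) (use sk fS in auto)
  have Hd: "hausdorff_dim E \<le> d"
  proof (rule field_le_epsilon)
    fix e :: real assume "0 < e"
    then obtain k where k: "inverse (real (Suc k)) < e" using reals_Archimedean by blast
    have "hausdorff_dim E \<le> d + 1 / real (Suc k)" unfolding H by (rule cInf_lower[OF sk bdd])
    then show "hausdorff_dim E \<le> d + e" using k by (simp add: inverse_eq_divide)
  qed
  have df: "d \<le> fourier_dim E"
  proof (rule field_le_epsilon)
    fix e :: real assume "0 < e"
    then obtain k where k: "inverse (real (Suc k)) < e" using reals_Archimedean by blast
    then show "d \<le> fourier_dim E + e" using lower[of k] by (simp add: inverse_eq_divide)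
  qed
  show ?thesis using fH Hd df by (simp add: salem_set_def)
qed

text \<open>For positive a, take \<alpha> midway between the energy and 1 - a. The exceptional sets
  of all triples (\<rho>, m, k) are united into one null set, outside which the deterministic
  construction runs. For a <= 0 the bound is trivial.\<close>

lemma (in brownian) AE_fourier_dim_ge:
  assumes f: "f \<in> energy_space" and a: "a < 1 - (energy_norm f)\<^sup>2"
  shows "AE \<omega> in M. a \<le> fourier_dim (rapid_points f (X \<omega>))"
proof (cases "0 < a")
  case True
  define \<alpha> where "\<alpha> = ((energy_norm f)\<^sup>2 + (1 - a)) / 2"
  have \<alpha>: "(energy_norm f)\<^sup>2 < \<alpha>" "a + \<alpha> < 1" using a by (simp_all add: \<alpha>_def field_simps)
  have a1: "a \<le> 1" using a zero_le_power2[of "energy_norm f"] by linarith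
  have ac: "abs_continuous_on 0 1 f" and f0: "f 0 = 0" using f by (auto simp: energy_space_def)
  have pos: "0 < good_prob f \<rho> q" if "\<rho> \<le> q" for \<rho> q
  proof -
    obtain c where c: "0 < c" "\<And>q. \<rho> \<le> q \<Longrightarrow> c * 2 powr (- \<alpha> * real q) \<le> good_prob f \<rho> q"
      using good_prob_lower_bound[OF f \<alpha>(1)] by blast
    have "0 < c * 2 powr (- \<alpha> * real q)" using c(1) by simp
    also have "\<dots> \<le> good_prob f \<rho> q" by (rule c(2)[OF that])
    finally show ?thesis .
  qed
  have "AE \<omega> in M. 2 * Suc k \<le> 2 ^ m \<longrightarrow> (\<forall>\<epsilon>>0. \<exists>q0. \<forall>q\<ge>q0. \<forall>u. cmod (cell_discrepancy f \<rho> (X \<omega>) q m k u) \<le> \<epsilon> * decay_weight a u)" for \<rho> m k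
    using AE_cell_discrepancy_small[OF f \<alpha>(1) True \<alpha>(2)] by (cases "2 * Suc k \<le> 2 ^ m") simp_all
  then have "AE \<omega> in M. \<forall>\<rho> m k. 2 * Suc k \<le> 2 ^ m \<longrightarrow> (\<forall>\<epsilon>>0. \<exists>q0. \<forall>q\<ge>q0. \<forall>u. cmod (cell_discrepancy f \<rho> (X \<omega>) q m k u) \<le> \<epsilon> * decay_weight a u)"
    by (simp only: AE_all_countable) simp
  then show ?thesis using AE_dyadic_modulus
  proof eventually_elim
    case (elim \<omega>)
    have mod: "eventually (dyadic_modulus (X \<omega>)) sequentially" using elim(2) by (simp add: eventually_sequentially)
    have disc: "\<exists>q0. \<forall>q\<ge>q0. \<forall>u. cmod (cell_discrepancy f \<rho> (X \<omega>) q m k u) \<le> \<epsilon> * decay_weight a u"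
      if "2 * Suc k \<le> 2 ^ m" "0 < \<epsilon>" for \<rho> m k \<epsilon> using elim(1) that by blast
    obtain K where K: "M_set (a / 2) K" "K \<subseteq> rapid_points f (X \<omega>)"
      by (rule M_set_subset_rapid_points[OF f0 abs_continuous_on_imp_continuous_on[OF ac] True _ mod pos disc])
        (use a1 in auto)
    show ?case by (rule fourier_dim_ge[OF True a1 K])
  qed
next
  case False
  then show ?thesis using order_trans[OF _ fourier_dim_nonneg, of a] by (intro AE_I2) simp
qed

theorem theorem4p2:
  fixes M :: "'w measure" and X :: "'w \<Rightarrow> real \<Rightarrow> real" and f :: "real \<Rightarrow> real"
  assumes "brownian_motion M X"
    and "f \<in> energy_space"
  shows "AE \<omega> in M.
           fourier_dim (rapid_points f (X \<omega>)) = max 0 (1 - (energy_norm f)\<^sup>2) \<and>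
           salem_set (rapid_points f (X \<omega>))"
proof -
  interpret brownian M X by (rule brownian.intro) fact
  \<comment> \<open>Truncation at 0 is needed because dimensions are nonnegative while the energy
    may exceed 1.\<close>
  define d where "d = max 0 (1 - (energy_norm f)\<^sup>2)"
  have "AE \<omega> in M. hausdorff_measure (d + 1 / real (Suc k)) (rapid_points f (X \<omega>)) = 0" for k
  proof (rule AE_hausdorff_measure_rapid_points[OF assms(2)])
    have "0 \<le> d" "1 - (energy_norm f)\<^sup>2 \<le> d" "0 < 1 / real (Suc k)" by (simp_all add: d_def)
    then show "0 < d + 1 / real (Suc k)" "1 - (energy_norm f)\<^sup>2 < d + 1 / real (Suc k)" by linarith+
  qed
  then have upper: "AE \<omega> in M. \<forall>k. hausdorff_measure (d + 1 / real (Suc k)) (rapid_points f (X \<omega>)) = 0"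
    by (simp only: AE_all_countable) simp
  have "AE \<omega> in M. d - 1 / real (Suc k) \<le> fourier_dim (rapid_points f (X \<omega>))" for k
  proof (cases "1 \<le> (energy_norm f)\<^sup>2")
    case True
    then have "d - 1 / real (Suc k) \<le> 0" by (simp add: d_def)
    then show ?thesis using order_trans[OF _ fourier_dim_nonneg] by (intro AE_I2) blast
  next
    case False
    then show ?thesis by (intro AE_fourier_dim_ge assms(2)) (simp add: d_def)
  qed
  then have lower: "AE \<omega> in M. \<forall>k. d - 1 / real (Suc k) \<le> fourier_dim (rapid_points f (X \<omega>))"
    by (simp only: AE_all_countable) simp
  show ?thesis
    using upper lower
  proof eventually_elim
    case (elim \<omega>)
    have "fourier_dim (rapid_points f (X \<omega>)) = d \<and> salem_set (rapid_points f (X \<omega>))"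
      by (rule dims_eqI) (use elim in \<open>auto simp: d_def\<close>)
    then show ?case by (simp add: d_def)
  qed
qed

end
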